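(* Let $d$ be a positive integer. The subspaces $I_{d}^{+}$ and $I_{d}^{-}$ are closed $SL(2,\mathbb{R})$-invariant subspaces of $I_{d}$, and they are irreducible as Fréchet representations of $SL(2,\mathbb{R})$.
   Context: $I_d$ is the space of smooth functions $\phi:\mathbb{R}\to\mathbb{C}$ such that $x\mapsto x^{-d-1}\phi(-1/x)$ ($x\neq0$) extends to a smooth function on $\mathbb{R}$. $G=SL(2,\mathbb{R})$ acts on $I_d$ by $\left(\pi_d\begin{pmatrix}p & q \\ r & s\end{pmatrix}\phi\right)(x)=(rx+p)^{-d-1}\phi\left(\frac{sx+q}{rx+p}\right)$ (extended smoothly where $rx+p=0$). Differentiating gives an action of the enveloping algebra $U(\mathfrak{g})$, $\mathfrak{g}=\mathrm{Lie}(G)$. The Fréchet topology on $I_d$ is defined by the seminorms $\phi\mapsto\left(\int_{-\infty}^{\infty}(1+x^2)^d|(D\phi)(x)|^2dx\right)^{1/2}$, $D\in U(\mathfrak{g})$. $S_d([0,\infty))$ is the space of functions $f(x)=x^{(d+1)/2}f_1(x)$ with $f_1$ smooth on $[0,\infty)$ and rapidly decreasing at $\infty$ together with all derivatives; $S_d((-\infty,0])$ is the space of functions $f(x)=|x|^{(d+1)/2}f_1(x)$ with $f_1$ smooth on $(-\infty,0]$ and rapidly decreasing at $-\infty$ together with all derivatives. Both are regarded as functions on $\mathbb{R}$ by extending by zero. $T_d(f)(z)=(2\pi)^{-1/2}\int_{-\infty}^{\infty}|y|^{(d-1)/2}f(y)e^{iyz}dy$. Then $I_d^+=T_d(S_d([0,\infty)))$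 and $I_d^-=T_d(S_d((-\infty,0]))$, both contained in $I_d$. Irreducible as a Fréchet representation means having no closed $G$-invariant subspaces other than $0$ and the whole space. *)

theory Defs
  imports "HOL-Analysis.Analysis"
begin

section \<open>Smooth functions\<close>

text \<open>Derivatives are taken within \<open>S\<close>, so they are one-sided at a boundary point of a
  half-line. The values outside \<open>S\<close> have no meaning.\<close>

primrec nth_deriv_on :: "real set \<Rightarrow> nat \<Rightarrow> (real \<Rightarrow> complex) \<Rightarrow> real \<Rightarrow> complex" where
  "nth_deriv_on S 0 f = f"
| "nth_deriv_on S (Suc n) f = (\<lambda>x. vector_derivative (nth_deriv_on S n f) (at x within S))"

definition smooth_on :: "real set \<Rightarrow> (real \<Rightarrow> complex) \<Rightarrow> bool" where
  "smooth_on S f \<longleftrightarrow> (\<forall>n. \<forall>x\<in>S. nth_deriv_on S n f differentiable (at x within S))"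

definition rapidly_decreasing_on :: "real set \<Rightarrow> (real \<Rightarrow> complex) \<Rightarrow> bool" where
  "rapidly_decreasing_on S f \<longleftrightarrow>
     (\<forall>m n. bounded ((\<lambda>x. x ^ m *\<^sub>R nth_deriv_on S n f x) ` S))"


section \<open>The representation of \<open>SL(2,\<real>)\<close> on \<open>I\<^sub>d\<close>\<close>

definition I_space :: "nat \<Rightarrow> (real \<Rightarrow> complex) set" where
  "I_space d = {\<phi>. smooth_on UNIV \<phi> \<and>
     (\<exists>\<psi>. smooth_on UNIV \<psi> \<and>
        (\<forall>x. x \<noteq> 0 \<longrightarrow> \<psi> x = x powi (- int d - 1) *\<^sub>R \<phi> (- 1 / x)))}"

definition SL2 :: "(real^2^2) set" where
  "SL2 = {g. det g = 1}"

text \<open>At the possible zero of the denominator the value is the limit, which for \<open>\<phi> \<in> I\<^sub>d\<close> is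
  the value of the smooth extension.\<close>

definition pi_rep :: "nat \<Rightarrow> real^2^2 \<Rightarrow> (real \<Rightarrow> complex) \<Rightarrow> real \<Rightarrow> complex" where
  "pi_rep d g \<phi> =
     (let p = g $ 1 $ 1; q = g $ 1 $ 2; r = g $ 2 $ 1; s = g $ 2 $ 2;
          F = (\<lambda>x. (r * x + p) powi (- int d - 1) *\<^sub>R \<phi> ((s * x + q) / (r * x + p)))
      in (\<lambda>x. if r * x + p = 0 then Lim (at x) F else F x))"


section \<open>The enveloping algebra and the Frechet topology\<close>

text \<open>The library's \<open>exp\<close> does not apply here: multiplication on the type of matrices is
  componentwise.\<close>

definition mat_exp :: "real^2^2 \<Rightarrow> real^2^2" where
  "mat_exp X = (\<Sum>n. (1 / fact n) *\<^sub>R (((**) X) ^^ n) (mat 1))"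

definition Lie_SL2 :: "(real^2^2) set" where
  "Lie_SL2 = {X. \<forall>t. mat_exp (t *\<^sub>R X) \<in> SL2}"

definition dpi :: "nat \<Rightarrow> real^2^2 \<Rightarrow> (real \<Rightarrow> complex) \<Rightarrow> real \<Rightarrow> complex" where
  "dpi d X \<phi> x = vector_derivative (\<lambda>t. pi_rep d (mat_exp (t *\<^sub>R X)) \<phi> x) (at 0)"

text \<open>The operators by which the elements of \<open>U(\<gg>)\<close> act. Since \<open>U(\<gg>)\<close> is generated as a
  unital algebra by \<open>\<gg>\<close>, its image is the unital algebra of operators generated by the
  \<open>dpi d X\<close>; the seminorms depend on an element of \<open>U(\<gg>)\<close> only through its operator.\<close>

inductive_set U_ops :: "nat \<Rightarrow> ((real \<Rightarrow> complex) \<Rightarrow> real \<Rightarrow> complex) set" for d :: nat where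
  one: "(\<lambda>\<phi>. \<phi>) \<in> U_ops d"
| gen: "X \<in> Lie_SL2 \<Longrightarrow> dpi d X \<in> U_ops d"
| mult: "D \<in> U_ops d \<Longrightarrow> E \<in> U_ops d \<Longrightarrow> (\<lambda>\<phi>. D (E \<phi>)) \<in> U_ops d"
| add: "D \<in> U_ops d \<Longrightarrow> E \<in> U_ops d \<Longrightarrow> (\<lambda>\<phi> x. D \<phi> x + E \<phi> x) \<in> U_ops d"
| scale: "D \<in> U_ops d \<Longrightarrow> (\<lambda>\<phi> x. (c::real) *\<^sub>R D \<phi> x) \<in> U_ops d"

definition I_seminorm ::
    "nat \<Rightarrow> ((real \<Rightarrow> complex) \<Rightarrow> real \<Rightarrow> complex) \<Rightarrow> (real \<Rightarrow> complex) \<Rightarrow> real" where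
  "I_seminorm d D \<phi> = sqrt (LINT x|lborel. (1 + x\<^sup>2) ^ d * (norm (D \<phi> x))\<^sup>2)"

definition I_topology :: "nat \<Rightarrow> (real \<Rightarrow> complex) topology" where
  "I_topology d = topology_generated_by
     {{\<psi> \<in> I_space d. I_seminorm d D (\<lambda>x. \<psi> x - \<phi> x) < \<epsilon>} | \<phi> D \<epsilon>.
        \<phi> \<in> I_space d \<and> D \<in> U_ops d \<and> \<epsilon> > 0}"


section \<open>Invariant subspaces and irreducibility\<close>

definition complex_subspace :: "(real \<Rightarrow> complex) set \<Rightarrow> bool" where
  "complex_subspace V \<longleftrightarrow> (\<lambda>x. 0) \<in> V \<and>
     (\<forall>\<phi>\<in>V. \<forall>\<psi>\<in>V. (\<lambda>x. \<phi> x + \<psi> x) \<in> V) \<and> (\<forall>c. \<forall>\<phi>\<in>V. (\<lambda>x. c * \<phi> x) \<in> V)"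

definition SL2_invariant :: "nat \<Rightarrow> (real \<Rightarrow> complex) set \<Rightarrow> bool" where
  "SL2_invariant d V \<longleftrightarrow> (\<forall>g\<in>SL2. \<forall>\<phi>\<in>V. pi_rep d g \<phi> \<in> V)"

definition irreducible_rep :: "nat \<Rightarrow> (real \<Rightarrow> complex) set \<Rightarrow> bool" where
  "irreducible_rep d V \<longleftrightarrow>
     (\<forall>W. complex_subspace W \<and> closedin (subtopology (I_topology d) V) W \<and> SL2_invariant d W
        \<longrightarrow> W = {\<lambda>x. 0} \<or> W = V)"


section \<open>The subspaces \<open>I\<^sub>d\<^sup>+\<close> and \<open>I\<^sub>d\<^sup>-\<close>\<close>

definition S_space :: "nat \<Rightarrow> real set \<Rightarrow> (real \<Rightarrow> complex) set" where
  "S_space d S = {f. \<exists>f1. smooth_on S f1 \<and> rapidly_decreasing_on S f1 \<and>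
     f = (\<lambda>x. if x \<in> S then (\<bar>x\<bar> powr ((real d + 1) / 2)) *\<^sub>R f1 x else 0)}"

definition T_op :: "nat \<Rightarrow> (real \<Rightarrow> complex) \<Rightarrow> real \<Rightarrow> complex" where
  "T_op d f z = ((2 * pi) powr (- 1 / 2)) *\<^sub>R
     (LINT y|lborel. (\<bar>y\<bar> powr ((real d - 1) / 2)) *\<^sub>R f y * exp (\<i> * y * z))"

definition I_plus :: "nat \<Rightarrow> (real \<Rightarrow> complex) set" where
  "I_plus d = T_op d ` S_space d {0..}"

definition I_minus :: "nat \<Rightarrow> (real \<Rightarrow> complex) set" where
  "I_minus d = T_op d ` S_space d {..0}"

end

theory Submission
  imports Defs "HOL-Complex_Analysis.Complex_Analysis" "HOL-Probability.Probability_Measure"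
begin

text \<open>In the Cayley coordinate \<open>w = (x - \<i>) / (x + \<i>)\<close> a function \<open>\<phi>\<close> lies in \<open>I\<^sub>d\<close> iff
  \<open>(x + \<i>)\<^sup>d\<^sup>+\<^sup>1 \<phi>(x)\<close> is a smooth function on the circle. The space \<open>I\<^sub>d\<^sup>+\<close> consists of those \<open>\<phi>\<close>
  for which this function is the boundary value \<open>\<Sum>n. a\<^sub>n w\<^sup>n\<close> of a power series with rapidly decreasing
  coefficients: expanding the exponential kernel by the Laguerre generating function expresses \<open>a\<^sub>n\<close> as
  Laguerre coefficients of \<open>f\<^sub>1\<close>, and these decrease rapidly because the Laguerre functions are
  eigenfunctions of a symmetric differential operator with eigenvalues linear in \<open>n\<close>.
  Closedness holds since the negative Fourier coefficients are continuous for the seminorm of \<open>D = 1\<close>.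
  An element of the group acts through an automorphism of the disc. For irreducibility, averaging over
  rotations by roots of unity isolates one monomial \<open>w\<^sup>n\<close> in a closed invariant subspace, a hyperbolic
  element moves it to a function with nonzero constant term, hence to \<open>w\<^sup>0\<close>, and from there to a function
  all of whose coefficients are nonzero. Complex conjugation exchanges \<open>I\<^sub>d\<^sup>+\<close> and \<open>I\<^sub>d\<^sup>-\<close>.\<close>

text \<open>Decay of Fourier coefficients is obtained without a theory of smooth functions on the
  circle. The rotation generator (1 + x^2) d/dx maps I_d to itself and multiplies the n-th
  coefficient by i (2n + d + 1), so its iterates give every power of n; boundary terms cancel
  because (x + i)^(d+1) phi(x) has the same limit at both ends of the line. The weight (1 + x^2)^d
  fits this picture: it is |x + i|^(2d+2) times pi times the Cauchy density, and the Cauchy density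
  is normalised arc length in w.

  The Laguerre generating function becomes the kernel e^(iyz) only on |w| = 1, while its series is
  available only for |w| < 1; that comparison is therefore a radial limit. The converse inclusion is
  explicit: y^d times a Laguerre function is transformed into a multiple of w^n / (x + i)^(d+1), so
  a rapidly decreasing sequence gives a Laguerre series, which is a Schwartz function. For the group
  action, the derivative of a transformed power series is of the same kind with a larger power of
  the denominator; this recursion keeps the coefficients rapidly decreasing.\<close>

no_notation fps_nth (infixl "$" 75)

section \<open>Smooth functions and vector fields on \<open>I\<^sub>d\<close>\<close>

text \<open>At an isolated point of S the filter \<open>at x within S\<close> is trivial. On perfect
  sets derivatives within S are unique, so the whole line and the closed half-lines are treated
  alike.\<close>

definition perfect_set :: "real set \<Rightarrow> bool" where
  "perfect_set S \<longleftrightarrow> (\<forall>x\<in>S. at x within S \<noteq> bot)"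

lemma perfect_set_UNIV [simp]: "perfect_set UNIV"
  by (simp add: perfect_set_def)

lemma perfect_set_atLeast [simp]: "perfect_set {a..}"
proof -
  have "x islimpt {a..}" if "a \<le> x" for x
  proof (rule islimpt_subset)
    show "x islimpt {x<..<x+1}" by (simp add: islimpt_greaterThanLessThan1)
  qed (use that in auto)
  then show ?thesis by (auto simp: perfect_set_def trivial_limit_within)
qed

lemma perfect_set_atMost [simp]: "perfect_set {..a}"
proof -
  have "x islimpt {..a}" if "x \<le> a" for x
  proof (rule islimpt_subset)
    show "x islimpt {x-1<..<x}" by (simp add: islimpt_greaterThanLessThan2)
  qed (use that in auto)
  then show ?thesis by (auto simp: perfect_set_def trivial_limit_within)
qed

lemma nth_deriv_on_add: "nth_deriv_on S m (nth_deriv_on S n f) = nth_deriv_on S (m + n) f"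
  by (induction m) auto

text \<open>Iterated derivatives are defined by choice. Given a tower \<open>g n\<close> of
  successive derivatives, uniqueness within a perfect set identifies them one by one; this is how
  iterated derivatives are computed below.\<close>

lemma nth_deriv_on_family:
  assumes "perfect_set S"
    and g: "\<And>n x. x \<in> S \<Longrightarrow> (g n has_vector_derivative g (Suc n) x) (at x within S)"
  shows "x \<in> S \<Longrightarrow> nth_deriv_on S n (g 0) x = g n x"
proof (induction n arbitrary: x)
  case (Suc n)
  have "(nth_deriv_on S n (g 0) has_vector_derivative g (Suc n) x) (at x within S)"
    by (rule has_vector_derivative_transform[OF Suc.prems _ g[OF Suc.prems]]) (simp add: Suc.IH)
  then show ?case
    using assms(1) Suc.prems by (auto simp: perfect_set_def intro: vector_derivative_within)
qed simp

lemma smooth_on_family: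
  assumes "perfect_set S"
    and g: "\<And>n x. x \<in> S \<Longrightarrow> (g n has_vector_derivative g (Suc n) x) (at x within S)"
  shows "smooth_on S (g 0)"
  unfolding smooth_on_def
proof (intro allI ballI)
  fix n x assume x: "x \<in> S"
  have "(nth_deriv_on S n (g 0) has_vector_derivative g (Suc n) x) (at x within S)"
    by (rule has_vector_derivative_transform[OF x _ g[OF x]])
       (simp add: nth_deriv_on_family[where g=g, OF assms])
  then show "nth_deriv_on S n (g 0) differentiable (at x within S)"
    by (rule differentiableI_vector)
qed

lemma smooth_onD:
  assumes "smooth_on S f" "x \<in> S"
  shows "(nth_deriv_on S n f has_vector_derivative nth_deriv_on S (Suc n) f x) (at x within S)"
  using assms by (auto simp: smooth_on_def vector_derivative_works[symmetric])

lemma smooth_on_nth_deriv: "smooth_on S f \<Longrightarrow> smooth_on S (nth_deriv_on S n f)"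
  by (auto simp: smooth_on_def nth_deriv_on_add)

text \<open>Coinduction: iterating a choice of derivative inside the class \<open>R\<close> produces
  the tower for \<open>smooth_on_family\<close>. Smoothness of products and of Hardy functions then
  needs no formula for the n-th derivative.\<close>

lemma smooth_on_coinduct:
  assumes S: "perfect_set S" and f: "f \<in> R"
    and R: "\<And>h. h \<in> R \<Longrightarrow> \<exists>h'\<in>R. \<forall>x\<in>S. (h has_vector_derivative h' x) (at x within S)"
  shows "smooth_on S f"
proof -
  from R obtain D where D: "\<And>h. h \<in> R \<Longrightarrow> D h \<in> R"
    "\<And>h x. h \<in> R \<Longrightarrow> x \<in> S \<Longrightarrow> (h has_vector_derivative D h x) (at x within S)"
    by metis
  have mem: "(D ^^ n) f \<in> R" for n
    by (induction n) (auto simp: f D)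
  show ?thesis
    using smooth_on_family[OF S, of "\<lambda>n. (D ^^ n) f"] D(2)[OF mem] by simp
qed

text \<open>By Leibniz the derivative of a product is a sum of two products, so it is the class of
  sums of products that is closed under differentiation and can be fed to
  \<open>smooth_on_coinduct\<close>.\<close>

inductive_set prod_span :: "real set \<Rightarrow> (real \<Rightarrow> complex) set" for S where
  mult: "smooth_on S f \<Longrightarrow> smooth_on S g \<Longrightarrow> (\<lambda>x. f x * g x) \<in> prod_span S"
| add: "u \<in> prod_span S \<Longrightarrow> v \<in> prod_span S \<Longrightarrow> (\<lambda>x. u x + v x) \<in> prod_span S"

lemma smooth_on_prod_span:
  assumes S: "perfect_set S" and "u \<in> prod_span S"
  shows "smooth_on S u"
proof (rule smooth_on_coinduct[OF S assms(2)])
  fix h assume "h \<in> prod_span S"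
  then show "\<exists>h'\<in>prod_span S. \<forall>x\<in>S. (h has_vector_derivative h' x) (at x within S)"
  proof induction
    case (mult f g)
    let ?D = "nth_deriv_on S 1"
    have "(\<lambda>x. f x * ?D g x + ?D f x * g x) \<in> prod_span S"
      by (intro prod_span.intros smooth_on_nth_deriv mult)
    moreover have "((\<lambda>x. f x * g x) has_vector_derivative f x * ?D g x + ?D f x * g x) (at x within S)"
      if "x \<in> S" for x
      using has_vector_derivative_mult[OF smooth_onD[OF mult(1) that, of 0] smooth_onD[OF mult(2) that, of 0]]
      by simp
    ultimately show ?case
      by (intro bexI[of _ "\<lambda>x. f x * ?D g x + ?D f x * g x"] ballI)
  next
    case (add u v)
    then obtain u' v' where "u' \<in> prod_span S" "v' \<in> prod_span S"
      "\<forall>x\<in>S. (u has_vector_derivative u' x) (at x within S)"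
      "\<forall>x\<in>S. (v has_vector_derivative v' x) (at x within S)" by blast
    then show ?case
      by (intro bexI[of _ "\<lambda>x. u' x + v' x"]) (auto intro: prod_span.add has_vector_derivative_add)
  qed
qed

lemma smooth_on_const [simp]: "perfect_set S \<Longrightarrow> smooth_on S (\<lambda>x. c)"
  by (rule smooth_on_coinduct[of _ _ "range (\<lambda>c x. c)"]) (auto intro!: derivative_eq_intros)

lemma smooth_on_of_real: "perfect_set S \<Longrightarrow> smooth_on S complex_of_real"
proof (rule smooth_on_coinduct[of _ _ "insert complex_of_real (range (\<lambda>c x. c))"])
  fix h assume "h \<in> insert complex_of_real (range (\<lambda>c x. c))"
  then consider "h = complex_of_real" | c where "h = (\<lambda>x. c)" by auto
  then show "\<exists>h'\<in>insert complex_of_real (range (\<lambda>c x. c)).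
      \<forall>x\<in>S. (h has_vector_derivative h' x) (at x within S)"
  proof cases
    case 1
    have "(complex_of_real has_vector_derivative 1) (at x within S)" for x
      by (auto intro!: derivative_eq_intros simp: has_vector_derivative_def scaleR_conv_of_real)
    then show ?thesis unfolding 1 by (intro bexI[of _ "\<lambda>x. 1"]) auto
  next
    case 2
    show ?thesis unfolding 2 by (intro bexI[of _ "\<lambda>x. 0"]) auto
  qed
qed auto

lemma smooth_on_mult:
  assumes "perfect_set S" "smooth_on S f" "smooth_on S g"
  shows "smooth_on S (\<lambda>x. f x * g x)"
  using smooth_on_prod_span[OF assms(1) prod_span.mult[OF assms(2,3)]] .

lemma smooth_on_add:
  assumes "perfect_set S" "smooth_on S f" "smooth_on S g"
  shows "smooth_on S (\<lambda>x. f x + g x)"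
proof -
  have "(\<lambda>x. f x * 1 + g x * 1) \<in> prod_span S"
    using assms by (intro prod_span.intros) auto
  from smooth_on_prod_span[OF assms(1) this] show ?thesis by simp
qed

lemma smooth_on_power_of_real: "perfect_set S \<Longrightarrow> smooth_on S (\<lambda>x. complex_of_real x ^ n)"
  by (induction n) (auto intro: smooth_on_mult smooth_on_of_real)

lemma nth_deriv_on_cnj:
  assumes "perfect_set S" "smooth_on S f"
  shows "smooth_on S (\<lambda>x. cnj (f x))"
    and "x \<in> S \<Longrightarrow> nth_deriv_on S n (\<lambda>x. cnj (f x)) x = cnj (nth_deriv_on S n f x)"
proof -
  let ?g = "\<lambda>n x. cnj (nth_deriv_on S n f x)"
  have "(?g n has_vector_derivative ?g (Suc n) x) (at x within S)" if "x \<in> S" for n x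
    using smooth_onD[OF assms(2) that, of n] by (simp add: has_vector_derivative_cnj)
  from smooth_on_family[of S ?g, OF assms(1) this] nth_deriv_on_family[of S ?g, OF assms(1) this]
  show "smooth_on S (\<lambda>x. cnj (f x))" 
    "x \<in> S \<Longrightarrow> nth_deriv_on S n (\<lambda>x. cnj (f x)) x = cnj (nth_deriv_on S n f x)" by auto
qed

section \<open>The space I_d in two charts\<close>

lemma power_int_minus_Suc: "(x::real) powi (- int d - 1) = inverse x ^ Suc d"
proof -
  have "nat (1 + int d) = Suc d" by simp
  then show ?thesis by (simp add: power_int_def add.commute)
qed

text \<open>The function \<open>\<psi>\<close> is \<open>\<phi>\<close> read in the chart at
  infinity. Its value at 0 is left open here; continuity determines it once \<open>\<psi>\<close> is
  smooth.\<close>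

definition partner :: "nat \<Rightarrow> (real \<Rightarrow> complex) \<Rightarrow> (real \<Rightarrow> complex) \<Rightarrow> bool" where
  "partner d \<phi> \<psi> \<longleftrightarrow> (\<forall>x. x \<noteq> 0 \<longrightarrow> \<psi> x = inverse (complex_of_real x) ^ Suc d * \<phi> (- 1 / x))"

lemma I_space_iff:
  "\<phi> \<in> I_space d \<longleftrightarrow> smooth_on UNIV \<phi> \<and> (\<exists>\<psi>. smooth_on UNIV \<psi> \<and> partner d \<phi> \<psi>)"
  by (simp add: I_space_def partner_def power_int_minus_Suc scaleR_conv_of_real)

lemma I_space_cmul: "\<phi> \<in> I_space d \<Longrightarrow> (\<lambda>x. c * \<phi> x) \<in> I_space d"
proof -
  assume "\<phi> \<in> I_space d"
  then obtain \<psi> where *: "smooth_on UNIV \<phi>" "smooth_on UNIV \<psi>" "partner d \<phi> \<psi>"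
    by (auto simp: I_space_iff)
  have "partner d (\<lambda>x. c * \<phi> x) (\<lambda>x. c * \<psi> x)"
    using *(3) by (auto simp: partner_def algebra_simps)
  then show ?thesis using * unfolding I_space_iff
    by (intro conjI exI[of _ "\<lambda>x. c * \<psi> x"] smooth_on_mult) auto
qed

lemma I_space_add: "\<phi> \<in> I_space d \<Longrightarrow> \<psi> \<in> I_space d \<Longrightarrow> (\<lambda>x. \<phi> x + \<psi> x) \<in> I_space d"
proof -
  assume "\<phi> \<in> I_space d" "\<psi> \<in> I_space d"
  then obtain \<phi>' \<psi>' where *: "smooth_on UNIV \<phi>" "smooth_on UNIV \<phi>'" "partner d \<phi> \<phi>'"
     "smooth_on UNIV \<psi>" "smooth_on UNIV \<psi>'" "partner d \<psi> \<psi>'"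
    by (auto simp: I_space_iff)
  have "partner d (\<lambda>x. \<phi> x + \<psi> x) (\<lambda>x. \<phi>' x + \<psi>' x)"
    using *(3,6) by (auto simp: partner_def algebra_simps)
  then show ?thesis using * unfolding I_space_iff
    by (intro conjI exI[of _ "\<lambda>x. \<phi>' x + \<psi>' x"] smooth_on_add) auto
qed

lemma I_space_diff: "\<phi> \<in> I_space d \<Longrightarrow> \<psi> \<in> I_space d \<Longrightarrow> (\<lambda>x. \<phi> x - \<psi> x) \<in> I_space d"
  using I_space_add[of \<phi> d "\<lambda>x. -1 * \<psi> x"] I_space_cmul[of \<psi> d "-1"] by simp

lemma I_space_cnj: "\<phi> \<in> I_space d \<Longrightarrow> (\<lambda>x. cnj (\<phi> x)) \<in> I_space d"
proof -
  assume "\<phi> \<in> I_space d"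
  then obtain \<psi> where *: "smooth_on UNIV \<phi>" "smooth_on UNIV \<psi>" "partner d \<phi> \<psi>"
    by (auto simp: I_space_iff)
  have "partner d (\<lambda>x. cnj (\<phi> x)) (\<lambda>x. cnj (\<psi> x))"
    using *(3) by (auto simp: partner_def)
  then show ?thesis using * unfolding I_space_iff
    by (intro conjI exI[of _ "\<lambda>x. cnj (\<psi> x)"] nth_deriv_on_cnj(1)) auto
qed

text \<open>The action on \<open>I\<^sub>d\<close> of the vector field \<open>(\<alpha> + \<beta> x + \<gamma> x\<^sup>2) d/dx\<close>.\<close>

definition vf :: "nat \<Rightarrow> complex \<Rightarrow> complex \<Rightarrow> complex \<Rightarrow> (real \<Rightarrow> complex) \<Rightarrow> real \<Rightarrow> complex" where
  "vf d \<alpha> \<beta> \<gamma> \<phi> x = (\<alpha> + \<beta> * x + \<gamma> * x\<^sup>2) * vector_derivative \<phi> (at x)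
     + (of_nat d + 1) / 2 * (\<beta> + 2 * \<gamma> * x) * \<phi> x"

lemma smooth_vector_derivative:
  "smooth_on UNIV \<phi> \<Longrightarrow> (\<phi> has_vector_derivative vector_derivative \<phi> (at x)) (at x)"
  using smooth_onD[of UNIV \<phi> x 0] by simp

lemma smooth_on_vf:
  assumes "smooth_on UNIV \<phi>" shows "smooth_on UNIV (vf d \<alpha> \<beta> \<gamma> \<phi>)"
proof -
  have 1: "smooth_on UNIV (\<lambda>x. vector_derivative \<phi> (at x))"
    using smooth_on_nth_deriv[OF assms, of 1] by simp
  have 2: "smooth_on UNIV (\<lambda>x. c * complex_of_real x ^ n)" for c n
    by (intro smooth_on_mult smooth_on_power_of_real) auto
  have 3: "smooth_on UNIV (\<lambda>x. \<alpha> + \<beta> * complex_of_real x + \<gamma> * (complex_of_real x)\<^sup>2)"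
    using smooth_on_add[OF _ smooth_on_add[OF _ 2[of \<alpha> 0] 2[of \<beta> 1]] 2[of \<gamma> 2]] by simp
  have 4: "smooth_on UNIV (\<lambda>x. (of_nat d + 1) / 2 * (\<beta> + 2 * \<gamma> * complex_of_real x))"
    using smooth_on_mult[OF _ 2[of "(of_nat d + 1) / 2" 0] smooth_on_add[OF _ 2[of \<beta> 0] 2[of "2*\<gamma>" 1]]] by simp
  show ?thesis unfolding vf_def
    using smooth_on_add[OF _ smooth_on_mult[OF _ 3 1] smooth_on_mult[OF _ 4 assms]] by simp
qed

text \<open>Under x = -1/y the field (a + b x + c x^2) d/dx becomes (c - b y + a y^2) d/dy. The
  chart at infinity sees a field of the same kind, which is why these fields preserve I_d.\<close>

lemma vf_partner:
  assumes \<phi>: "smooth_on UNIV \<phi>" and \<psi>: "smooth_on UNIV \<psi>" and p: "partner d \<phi> \<psi>"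
  shows "partner d (vf d \<alpha> \<beta> \<gamma> \<phi>) (vf d \<gamma> (-\<beta>) \<alpha> \<psi>)"
  unfolding partner_def
proof (intro allI impI)
  fix x :: real assume x: "x \<noteq> 0"
  define X where "X = complex_of_real x"
  define u where "u = \<phi> (-1/x)"
  define v where "v = vector_derivative \<phi> (at (-1/x))"
  have X: "X \<noteq> 0" using x by (simp add: X_def)
  have d1: "((\<lambda>x. - 1 / x) has_real_derivative (1 / x\<^sup>2)) (at x)"
    using x by (auto intro!: derivative_eq_intros simp: power2_eq_square)
  have "((\<phi> \<circ> (\<lambda>x. - 1 / x)) has_vector_derivative (1 / x\<^sup>2) *\<^sub>R v) (at x)"
    by (rule vector_diff_chain_at)
       (use d1 in \<open>auto simp: has_real_derivative_iff_has_vector_derivative v_def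
          intro!: smooth_vector_derivative \<phi>\<close>)
  then have d2: "((\<lambda>x. \<phi> (- 1 / x)) has_vector_derivative inverse X ^ 2 * v) (at x)"
    by (simp add: o_def X_def scaleR_conv_of_real field_simps)
  have "((\<lambda>z. inverse z ^ Suc d) has_field_derivative - of_nat (Suc d) * inverse X ^ (d+2)) (at X)"
    using DERIV_power[OF DERIV_inverse[OF X], of "Suc d"]
    by (simp add: power_add power2_eq_square algebra_simps)
  then have "((\<lambda>z. inverse z ^ Suc d) has_field_derivative - of_nat (Suc d) * inverse X ^ (d+2)) (at (complex_of_real x))"
    by (simp add: X_def)
  from has_vector_derivative_real_field[OF this]
  have d3: "((\<lambda>x. inverse (complex_of_real x) ^ Suc d) has_vector_derivative
     - of_nat (Suc d) * inverse X ^ (d+2)) (at x)" by simp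
  have "((\<lambda>x. inverse (complex_of_real x) ^ Suc d * \<phi> (- 1 / x)) has_vector_derivative
     inverse X ^ Suc d * (inverse X ^ 2 * v) + - of_nat (Suc d) * inverse X ^ (d+2) * u) (at x)"
    using has_vector_derivative_mult[OF d3 d2] by (simp add: X_def u_def)
  then have "(\<psi> has_vector_derivative
     inverse X ^ Suc d * (inverse X ^ 2 * v) + - of_nat (Suc d) * inverse X ^ (d+2) * u) (at x)"
    by (rule has_vector_derivative_transform_within_open[where S="-{0}"])
       (use x p in \<open>auto simp: partner_def\<close>)
  then have e1: "vector_derivative \<psi> (at x) =
     inverse X ^ Suc d * (inverse X ^ 2 * v) + - of_nat (Suc d) * inverse X ^ (d+2) * u"
    by (rule vector_derivative_at)
  have e2: "\<psi> x = inverse X ^ Suc d * u"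
    using p x by (simp add: partner_def X_def u_def)
  define Y where "Y = inverse X"
  define P where "P = inverse X ^ Suc d"
  have XY: "X * Y = 1" using X by (simp add: Y_def)
  have e3: "complex_of_real (-1/x) = - Y"
    by (simp add: Y_def X_def divide_inverse)
  have e4: "inverse X ^ (d + 2) = Y * P" by (simp add: Y_def P_def)
  define h :: complex where "h = (of_nat d + 1) / 2"
  have h: "of_nat (Suc d) = 2 * h" by (simp add: h_def)
  have "(\<gamma> + - \<beta> * X + \<alpha> * X\<^sup>2) * (P * (Y^2 * v) + - (2 * h) * (Y * P) * u)
     + h * (- \<beta> + 2 * \<alpha> * X) * (P * u)
    = P * ((\<alpha> + \<beta> * - Y + \<gamma> * (-Y)\<^sup>2) * v + h * (\<beta> + 2 * \<gamma> * - Y) * u)"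
    (is "?L = ?R")
  proof -
    have "?L = P * v * (\<gamma> * Y^2 - \<beta> * (X*Y) * Y + \<alpha> * (X*Y)^2)
       + h * P * u * (- 2 * \<gamma> * Y + 2 * \<beta> * (X * Y) - 2 * \<alpha> * X * (X * Y) - \<beta> + 2 * \<alpha> * X)"
      by (simp add: algebra_simps power2_eq_square)
    also have "\<dots> = ?R" unfolding XY by (simp add: algebra_simps)
    finally show ?thesis .
  qed
  then show "vf d \<gamma> (-\<beta>) \<alpha> \<psi> x = inverse (complex_of_real x) ^ Suc d * vf d \<alpha> \<beta> \<gamma> \<phi> (- 1 / x)"
    unfolding vf_def of_real_power e1 e2 e3 e4 h u_def[symmetric] v_def[symmetric] X_def[symmetric] h_def[symmetric]
    unfolding P_def[symmetric] unfolding Y_def[symmetric] by (simp only:)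
qed

lemma vf_I_space: "\<phi> \<in> I_space d \<Longrightarrow> vf d \<alpha> \<beta> \<gamma> \<phi> \<in> I_space d"
  unfolding I_space_iff using smooth_on_vf vf_partner by blast

section \<open>The differentiated representation and the operators of the enveloping algebra\<close>

text \<open>The entries of the exponential are power series in t. The entries of the n-th power of X
  are at most M^n, with M the sum of the moduli of the entries of X, so these series converge
  everywhere and are differentiated termwise.\<close>

lemma DERIV_mat_exp:
  fixes X :: "real^2^2"
  shows "((\<lambda>t. mat_exp (t *\<^sub>R X) $ i $ j) has_real_derivative X $ i $ j) (at 0)"
    and "mat_exp (0 *\<^sub>R X) = mat 1"
proof -
  define A where "A n = (((**) X) ^^ n) (mat 1)" for n
  define M where "M = (\<Sum>i\<in>UNIV. \<Sum>j\<in>UNIV. \<bar>X $ i $ j\<bar>)"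
  have M0: "0 \<le> M" unfolding M_def by (intro sum_nonneg) auto
  have A: "\<bar>A n $ i $ j\<bar> \<le> M ^ n" for n i j
  proof (induction n arbitrary: i j)
    case (Suc n)
    have "A (Suc n) $ i $ j = (\<Sum>k\<in>UNIV. X $ i $ k * A n $ k $ j)"
      by (simp add: A_def matrix_matrix_mult_def)
    also have "\<bar>\<dots>\<bar> \<le> (\<Sum>k\<in>UNIV. \<bar>X $ i $ k\<bar> * M ^ n)"
      by (rule order_trans[OF sum_abs]) (auto simp: abs_mult intro!: sum_mono mult_left_mono Suc.IH)
    also have "\<dots> = (\<Sum>k\<in>UNIV. \<bar>X $ i $ k\<bar>) * M ^ n" by (simp add: sum_distrib_right)
    also have "\<dots> \<le> M * M ^ n"
      unfolding M_def
      by (intro mult_right_mono member_le_sum) (auto intro!: sum_nonneg zero_le_power)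
    finally show ?case by simp
  qed (auto simp: A_def mat_def)
  have pw: "(((**) (t *\<^sub>R X)) ^^ n) (mat 1) = t ^ n *\<^sub>R A n" for t n
  proof (induction n)
    case (Suc n)
    show ?case
      by (simp add: Suc.IH) (simp add: A_def matrix_matrix_mult_def vec_eq_iff sum_distrib_left mult_ac)
  qed (simp add: A_def)
  have summ: "summable (\<lambda>n. (A n $ i $ j / fact n) * t ^ n)" for i j and t :: real
  proof (rule summable_comparison_test')
    show "summable (\<lambda>n. (M * \<bar>t\<bar>) ^ n /\<^sub>R fact n)" by (rule summable_exp_generic)
    show "norm ((A n $ i $ j / fact n) * t ^ n) \<le> (M * \<bar>t\<bar>) ^ n /\<^sub>R fact n" for n
    proof -
      have "\<bar>A n $ i $ j\<bar> * \<bar>t\<bar> ^ n / fact n \<le> M ^ n * \<bar>t\<bar> ^ n / fact n"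
        by (intro divide_right_mono mult_right_mono A) auto
      then show ?thesis
        by (simp add: abs_mult power_mult_distrib power_abs divide_inverse mult_ac)
    qed
  qed
  have "(\<lambda>n. (1 / fact n) *\<^sub>R (((**) (t *\<^sub>R X)) ^^ n) (mat 1)) sums
      (\<chi> i j. \<Sum>n. (A n $ i $ j / fact n) * t ^ n)" for t
    unfolding sums_def
  proof (intro vec_tendstoI)
    fix i j
    have "(\<lambda>n. \<Sum>k<n. (A k $ i $ j / fact k) * t ^ k) \<longlonglongrightarrow> (\<Sum>n. (A n $ i $ j / fact n) * t ^ n)"
      using summable_LIMSEQ[OF summ] .
    then show "(\<lambda>n. (\<Sum>k<n. (1 / fact k) *\<^sub>R (((**) (t *\<^sub>R X)) ^^ k) (mat 1)) $ i $ j)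
       \<longlonglongrightarrow> (\<chi> i j. \<Sum>n. (A n $ i $ j / fact n) * t ^ n) $ i $ j"
      by (simp add: pw mult_ac)
  qed
  then have eq: "mat_exp (t *\<^sub>R X) = (\<chi> i j. \<Sum>n. (A n $ i $ j / fact n) * t ^ n)" for t
    unfolding mat_exp_def by (rule sums_unique[symmetric])
  have "((\<lambda>t. \<Sum>n. (A n $ i $ j / fact n) * t ^ n) has_real_derivative
     (\<Sum>n. diffs (\<lambda>n. A n $ i $ j / fact n) n * 0 ^ n)) (at 0)"
    by (rule termdiffs_strong_converges_everywhere[OF summ])
  moreover have "(\<Sum>n. diffs (\<lambda>n. A n $ i $ j / fact n) n * 0 ^ n) = X $ i $ j"
    using powser_zero[of "diffs (\<lambda>n. A n $ i $ j / fact n)"] by (simp add: diffs_def A_def)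
  ultimately show "((\<lambda>t. mat_exp (t *\<^sub>R X) $ i $ j) has_real_derivative X $ i $ j) (at 0)"
    unfolding eq by simp
  show "mat_exp (0 *\<^sub>R X) = mat 1"
    unfolding eq using powser_zero[of "\<lambda>n. A n $ i $ j / fact n" for i j]
    by (simp add: A_def vec_eq_iff)
qed

text \<open>The determinant is constantly 1 along the one-parameter group, and its derivative at 0
  is the trace.\<close>

lemma Lie_SL2_trace:
  assumes "X \<in> Lie_SL2" shows "X $ 2 $ 2 = - X $ 1 $ 1"
proof -
  note D = DERIV_mat_exp(1)[of X]
  have "((\<lambda>t. det (mat_exp (t *\<^sub>R X))) has_real_derivative X $ 1 $ 1 + X $ 2 $ 2) (at 0)"
    unfolding det_2
    by (rule derivative_eq_intros D refl)+ (simp add: DERIV_mat_exp(2)[simplified] mat_def)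
  moreover have "(\<lambda>t. det (mat_exp (t *\<^sub>R X))) = (\<lambda>t. 1)"
    using assms by (auto simp: Lie_SL2_def SL2_def)
  ultimately have "X $ 1 $ 1 + X $ 2 $ 2 = 0"
    using DERIV_unique[OF _ DERIV_const] by metis
  then show ?thesis by simp
qed

lemma pi_rep_apply:
  "g $ 2 $ 1 * x + g $ 1 $ 1 \<noteq> 0 \<Longrightarrow> pi_rep d g \<phi> x =
    inverse (complex_of_real (g $ 2 $ 1 * x + g $ 1 $ 1)) ^ Suc d
      * \<phi> ((g $ 2 $ 2 * x + g $ 1 $ 2) / (g $ 2 $ 1 * x + g $ 1 $ 1))"
  by (simp add: pi_rep_def Let_def power_int_minus_Suc scaleR_conv_of_real)

text \<open>The one-parameter group moves x with initial velocity b - 2 a x - c x^2, which gives the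
  first-order part. The automorphy factor contributes -(d+1) (c x + a), which is (d+1)/2 times the
  derivative of that velocity.\<close>

lemma dpi_eq_vf:
  assumes X: "X \<in> Lie_SL2" and \<phi>: "smooth_on UNIV \<phi>"
  shows "dpi d X \<phi> = vf d (X $ 1 $ 2) (- 2 * X $ 1 $ 1) (- X $ 2 $ 1) \<phi>"
proof
  fix x
  define p q r s where
    "p t = mat_exp (t *\<^sub>R X) $ 1 $ 1" and "q t = mat_exp (t *\<^sub>R X) $ 1 $ 2" and
    "r t = mat_exp (t *\<^sub>R X) $ 2 $ 1" and "s t = mat_exp (t *\<^sub>R X) $ 2 $ 2" for t
  define a b c where "a = X $ 1 $ 1" and "b = X $ 1 $ 2" and "c = X $ 2 $ 1"
  have pqrs0: "p 0 = 1" "q 0 = 0" "r 0 = 0" "s 0 = 1"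
    using DERIV_mat_exp(2)[of X] by (simp_all add: p_def q_def r_def s_def mat_def)
  note D = DERIV_mat_exp(1)[of X 1 1, folded p_def a_def] DERIV_mat_exp(1)[of X 1 2, folded q_def b_def]
     DERIV_mat_exp(1)[of X 2 1, folded r_def c_def]
     DERIV_mat_exp(1)[of X 2 2, folded s_def, unfolded Lie_SL2_trace[OF X], folded a_def]
  define u where "u t = r t * x + p t" for t
  define m where "m t = (s t * x + q t) / u t" for t
  have u0: "u 0 = 1" by (simp add: u_def pqrs0)
  have Du: "(u has_real_derivative c * x + a) (at 0)"
    unfolding u_def by (rule derivative_eq_intros D refl)+ simp
  have m0: "m 0 = x" by (simp add: m_def u0 pqrs0)
  have Dm: "(m has_real_derivative (b - 2 * a * x - c * x\<^sup>2)) (at 0)"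
    unfolding m_def
    by (rule derivative_eq_intros D Du refl)+
       (auto simp: u0 pqrs0 algebra_simps power2_eq_square)
  have DF: "((\<lambda>t. inverse (complex_of_real (u t)) ^ Suc d) has_vector_derivative
      - (of_nat d + 1) * of_real (c * x + a)) (at 0)"
  proof -
    have "((\<lambda>z. inverse z ^ Suc d) has_field_derivative - of_nat (Suc d)) (at (1::complex))"
      using DERIV_power[OF DERIV_inverse[of "1::complex"], of "Suc d"] by simp
    then have "((\<lambda>z. inverse z ^ Suc d) has_field_derivative - of_nat (Suc d)) (at (complex_of_real 1))"
      by simp
    from has_vector_derivative_real_field[OF this]
    have "((\<lambda>x. inverse (complex_of_real x) ^ Suc d) has_vector_derivative - of_nat (Suc d)) (at (u 0))"
      by (simp add: u0)
    from vector_diff_chain_at[OF Du[unfolded has_real_derivative_iff_has_vector_derivative] this]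
    show ?thesis by (simp add: o_def scaleR_conv_of_real algebra_simps)
  qed
  have Dp: "((\<lambda>t. \<phi> (m t)) has_vector_derivative
      of_real (b - 2 * a * x - c * x\<^sup>2) * vector_derivative \<phi> (at x)) (at 0)"
  proof -
    have "(\<phi> has_vector_derivative vector_derivative \<phi> (at x)) (at (m 0))"
      using smooth_vector_derivative[OF \<phi>] by (simp add: m0)
    from vector_diff_chain_at[OF Dm[unfolded has_real_derivative_iff_has_vector_derivative] this]
    show ?thesis by (simp add: o_def scaleR_conv_of_real)
  qed
  have prod: "((\<lambda>t. inverse (complex_of_real (u t)) ^ Suc d * \<phi> (m t)) has_vector_derivative
      vf d b (- 2 * a) (- c) \<phi> x) (at 0)"
    by (rule has_vector_derivative_eq_rhs[OF has_vector_derivative_mult[OF DF Dp]])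
       (simp add: vf_def u0 m0 field_simps power2_eq_square)
  \<comment> \<open>Near t = 0 the denominator is nonzero, so the limit clause of
    \<open>pi_rep\<close> does not enter the derivative.\<close>
  have "isCont u 0" using Du by (rule DERIV_isCont)
  then have "\<forall>\<^sub>F t in at 0. u t \<noteq> 0"
    unfolding isCont_def u0 by (rule tendsto_imp_eventually_ne) simp
  then have ev: "\<forall>\<^sub>F t in at 0. inverse (complex_of_real (u t)) ^ Suc d * \<phi> (m t)
       = pi_rep d (mat_exp (t *\<^sub>R X)) \<phi> x"
    by eventually_elim (simp add: pi_rep_apply u_def m_def p_def q_def r_def s_def)
  have at0: "inverse (complex_of_real (u 0)) ^ Suc d * \<phi> (m 0) = pi_rep d (mat_exp (0 *\<^sub>R X)) \<phi> x"
    using pi_rep_apply[of "mat_exp (0 *\<^sub>R X)" x d \<phi>] DERIV_mat_exp(2)[of X]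
    by (simp add: u0 m0 mat_def)
  have "((\<lambda>t. pi_rep d (mat_exp (t *\<^sub>R X)) \<phi> x) has_vector_derivative vf d b (- 2 * a) (- c) \<phi> x) (at 0)"
    using prod unfolding has_vector_derivative_def
    by (rule has_derivative_transform_eventually[OF _ ev at0]) simp
  then show "dpi d X \<phi> x = vf d b (- 2 * a) (- c) \<phi> x"
    unfolding dpi_def by (rule vector_derivative_at)
qed

lemma vf_add:
  assumes "smooth_on UNIV \<phi>" "smooth_on UNIV \<psi>"
  shows "vf d \<alpha> \<beta> \<gamma> (\<lambda>x. \<phi> x + \<psi> x) = (\<lambda>x. vf d \<alpha> \<beta> \<gamma> \<phi> x + vf d \<alpha> \<beta> \<gamma> \<psi> x)"
proof
  fix x
  have "vector_derivative (\<lambda>x. \<phi> x + \<psi> x) (at x) = vector_derivative \<phi> (at x) + vector_derivative \<psi> (at x)"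
    by (intro vector_derivative_at has_vector_derivative_add smooth_vector_derivative assms)
  then show "vf d \<alpha> \<beta> \<gamma> (\<lambda>x. \<phi> x + \<psi> x) x = vf d \<alpha> \<beta> \<gamma> \<phi> x + vf d \<alpha> \<beta> \<gamma> \<psi> x"
    by (simp add: vf_def algebra_simps add_divide_distrib)
qed

lemma vf_cmul:
  assumes "smooth_on UNIV \<phi>"
  shows "vf d \<alpha> \<beta> \<gamma> (\<lambda>x. c * \<phi> x) = (\<lambda>x. c * vf d \<alpha> \<beta> \<gamma> \<phi> x)"
proof
  fix x
  have "vector_derivative (\<lambda>x. c * \<phi> x) (at x) = c * vector_derivative \<phi> (at x)"
    by (intro vector_derivative_at has_vector_derivative_mult_right smooth_vector_derivative assms)
  then show "vf d \<alpha> \<beta> \<gamma> (\<lambda>x. c * \<phi> x) x = c * vf d \<alpha> \<beta> \<gamma> \<phi> x"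
    by (simp add: vf_def algebra_simps add_divide_distrib)
qed

lemma vf_cnj:
  assumes "smooth_on UNIV \<phi>"
  shows "vf d \<alpha> \<beta> \<gamma> (\<lambda>x. cnj (\<phi> x)) = (\<lambda>x. cnj (vf d (cnj \<alpha>) (cnj \<beta>) (cnj \<gamma>) \<phi> x))"
proof
  fix x
  have "vector_derivative (\<lambda>x. cnj (\<phi> x)) (at x) = cnj (vector_derivative \<phi> (at x))"
    by (intro vector_derivative_at has_vector_derivative_cnj smooth_vector_derivative assms)
  then show "vf d \<alpha> \<beta> \<gamma> (\<lambda>x. cnj (\<phi> x)) x = cnj (vf d (cnj \<alpha>) (cnj \<beta>) (cnj \<gamma>) \<phi> x)"
    by (simp add: vf_def)
qed

lemma I_space_smooth: "\<phi> \<in> I_space d \<Longrightarrow> smooth_on UNIV \<phi>"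
  by (simp add: I_space_iff)

text \<open>Invariance of I_d is proved together with linearity, since in the product step D is
  applied to \<open>E \<phi>\<close>. Compatibility with conjugation holds because the generators
  and scalars are real; it later carries results from I_d^+ to I_d^-.\<close>

lemma U_ops_real_linear:
  assumes "D \<in> U_ops d"
  shows "(\<forall>\<phi>\<in>I_space d. D \<phi> \<in> I_space d \<and> (\<forall>c. D (\<lambda>x. c * \<phi> x) = (\<lambda>x. c * D \<phi> x))
      \<and> D (\<lambda>x. cnj (\<phi> x)) = (\<lambda>x. cnj (D \<phi> x))
      \<and> (\<forall>\<psi>\<in>I_space d. D (\<lambda>x. \<phi> x + \<psi> x) = (\<lambda>x. D \<phi> x + D \<psi> x)))"
  using assms
proof induction
  case (gen X)
  have s: "\<phi> \<in> I_space d \<Longrightarrow> smooth_on UNIV \<phi>" for \<phi> by (rule I_space_smooth)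
  from gen show ?case
    by (auto simp: dpi_eq_vf s vf_I_space vf_add vf_cmul vf_cnj I_space_add I_space_cmul I_space_cnj)
next
  case (mult D E)
  then show ?case by (simp add: I_space_add I_space_cmul I_space_cnj)
next
  case (add D E)
  then show ?case by (simp add: I_space_add I_space_cmul I_space_cnj algebra_simps)
next
  case (scale D c)
  then show ?case 
    by (simp add: I_space_add I_space_cmul I_space_cnj algebra_simps scaleR_conv_of_real)
qed auto

lemma
  assumes "D \<in> U_ops d" "\<phi> \<in> I_space d"
  shows U_ops_I_space: "D \<phi> \<in> I_space d"
    and U_ops_cmul: "D (\<lambda>x. c * \<phi> x) = (\<lambda>x. c * D \<phi> x)"
    and U_ops_cnj: "D (\<lambda>x. cnj (\<phi> x)) = (\<lambda>x. cnj (D \<phi> x))"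
    and U_ops_add: "\<psi> \<in> I_space d \<Longrightarrow> D (\<lambda>x. \<phi> x + \<psi> x) = (\<lambda>x. D \<phi> x + D \<psi> x)"
  using U_ops_real_linear[OF assms(1)] assms(2) by auto

lemma U_ops_diff:
  assumes "D \<in> U_ops d" "\<phi> \<in> I_space d" "\<psi> \<in> I_space d"
  shows "D (\<lambda>x. \<phi> x - \<psi> x) = (\<lambda>x. D \<phi> x - D \<psi> x)"
  using U_ops_add[OF assms(1,2) I_space_cmul[OF assms(3), of "-1"]] U_ops_cmul[OF assms(1,3), of "-1"]
  by simp

section \<open>Behaviour of elements of I_d at infinity\<close>

lemma norm_of_real_plus_ii: "norm (complex_of_real x + \<i>) ^ 2 = 1 + x\<^sup>2"
  by (simp add: cmod_def)

lemma of_real_plus_ii_neq_0 [simp]: "complex_of_real x + \<i> \<noteq> 0"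
  by (auto simp: complex_eq_iff)

text \<open>In the chart at infinity the product is a polynomial in 1/x times
  \<open>\<psi> (- 1 / x)\<close>, so both limits are (-1)^(d+1) \<open>\<psi> 0\<close>. Their
  equality says that the circle function is continuous at w = 1.\<close>

lemma I_space_limits:
  assumes "\<phi> \<in> I_space d"
  shows "\<exists>L. ((\<lambda>x. (complex_of_real x + \<i>) ^ Suc d * \<phi> x) \<longlongrightarrow> L) at_top \<and>
             ((\<lambda>x. (complex_of_real x + \<i>) ^ Suc d * \<phi> x) \<longlongrightarrow> L) at_bot"
proof -
  from assms obtain \<psi> where \<psi>: "smooth_on UNIV \<psi>" "partner d \<phi> \<psi>"
    by (auto simp: I_space_iff)
  have eq: "(- 1 - \<i> / of_real x) ^ Suc d * \<psi> (- 1 / x) = (complex_of_real x + \<i>) ^ Suc d * \<phi> x"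
    if "x \<noteq> 0" for x
  proof -
    have "\<psi> (- 1 / x) = (- of_real x) ^ Suc d * \<phi> x"
      using \<psi>(2) that by (simp add: partner_def del: power_Suc)
    moreover have "(- 1 - \<i> / of_real x) * (- of_real x) = complex_of_real x + \<i>"
      using that by (simp add: field_simps)
    ultimately show ?thesis
      by (metis mult.assoc power_mult_distrib)
  qed
  have "isCont \<psi> 0"
    by (rule has_vector_derivative_continuous[OF smooth_vector_derivative[OF \<psi>(1)]])
  then have c: "(\<psi> \<longlongrightarrow> \<psi> 0) (nhds 0)"
    by (simp add: isCont_def tendsto_at_iff_tendsto_nhds)
  have 0: "((\<lambda>x. - 1 / x) \<longlongrightarrow> (0::real)) at_top" "((\<lambda>x. - 1 / x) \<longlongrightarrow> (0::real)) at_bot"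
    by real_asymp+
  have i: "((\<lambda>x. \<i> / complex_of_real x) \<longlongrightarrow> 0) at_top" "((\<lambda>x. \<i> / complex_of_real x) \<longlongrightarrow> 0) at_bot"
  proof -
    have "((\<lambda>x. - \<i> * complex_of_real (- 1 / x)) \<longlongrightarrow> - \<i> * complex_of_real 0) at_top"
      "((\<lambda>x. - \<i> * complex_of_real (- 1 / x)) \<longlongrightarrow> - \<i> * complex_of_real 0) at_bot"
      by (intro tendsto_intros 0)+
    then show "((\<lambda>x. \<i> / complex_of_real x) \<longlongrightarrow> 0) at_top" "((\<lambda>x. \<i> / complex_of_real x) \<longlongrightarrow> 0) at_bot"
      by simp_all
  qed
  have "((\<lambda>x. (- 1 - \<i> / complex_of_real x) ^ Suc d * \<psi> (- 1 / x)) \<longlongrightarrow> (- 1 - 0) ^ Suc d * \<psi> 0) at_top"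
    "((\<lambda>x. (- 1 - \<i> / complex_of_real x) ^ Suc d * \<psi> (- 1 / x)) \<longlongrightarrow> (- 1 - 0) ^ Suc d * \<psi> 0) at_bot"
    by (intro tendsto_intros i filterlim_compose[OF c] 0)+
  moreover have "\<forall>\<^sub>F x::real in at_top. x \<noteq> 0" "\<forall>\<^sub>F x::real in at_bot. x \<noteq> 0"
    using eventually_gt_at_top[of 0] eventually_gt_at_bot[of 0] by (auto elim: eventually_mono)
  ultimately show ?thesis
    by (intro exI[of _ "(- 1 - 0) ^ Suc d * \<psi> 0"] conjI)
       (erule Lim_transform_eventually, erule eventually_mono, erule eq)+
qed

lemma bounded_range_if_limits:
  fixes f :: "real \<Rightarrow> 'a::real_normed_vector"
  assumes "continuous_on UNIV f" "(f \<longlongrightarrow> L) at_top" "(f \<longlongrightarrow> M) at_bot"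
  shows "\<exists>C. \<forall>x. norm (f x) \<le> C"
proof -
  from tendstoD[OF assms(2), of 1] tendstoD[OF assms(3), of 1]
  obtain a b where a: "\<And>x. x \<ge> a \<Longrightarrow> dist (f x) L < 1" and b: "\<And>x. x \<le> b \<Longrightarrow> dist (f x) M < 1"
    by (auto simp: eventually_at_top_linorder eventually_at_bot_linorder)
  have "compact (f ` {b..a})"
    by (intro compact_continuous_image continuous_on_subset[OF assms(1)]) auto
  then obtain C where C: "\<And>x. x \<in> {b..a} \<Longrightarrow> norm (f x) \<le> C"
    using compact_imp_bounded bounded_iff by (metis imageI)
  have "norm (f x) \<le> max C (max (norm L + 1) (norm M + 1))" for x
  proof -
    have "norm (f x) \<le> norm L + 1" if "x \<ge> a"
      using a[OF that] norm_triangle_ineq2[of "f x" L] by (simp add: dist_norm)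
    moreover have "norm (f x) \<le> norm M + 1" if "x \<le> b"
      using b[OF that] norm_triangle_ineq2[of "f x" M] by (simp add: dist_norm)
    ultimately show ?thesis using C[of x] by (cases "x \<ge> a"; cases "x \<le> b") auto
  qed
  then show ?thesis by blast
qed

lemma smooth_on_continuous: "smooth_on UNIV \<phi> \<Longrightarrow> continuous_on UNIV \<phi>"
  by (intro continuous_at_imp_continuous_on ballI has_vector_derivative_continuous[OF smooth_vector_derivative])

lemma I_space_bound:
  assumes "\<phi> \<in> I_space d"
  shows "\<exists>C. \<forall>x. norm ((complex_of_real x + \<i>) ^ Suc d * \<phi> x) \<le> C"
proof -
  have "continuous_on UNIV (\<lambda>x. (complex_of_real x + \<i>) ^ Suc d * \<phi> x)"
    by (intro continuous_intros smooth_on_continuous I_space_smooth[OF assms])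
  with I_space_limits[OF assms] show ?thesis by (blast dest: bounded_range_if_limits)
qed

section \<open>Rapidly decreasing sequences and boundary values of power series\<close>

definition rapid :: "(nat \<Rightarrow> complex) \<Rightarrow> bool" where
  "rapid a \<longleftrightarrow> (\<forall>k. summable (\<lambda>n. real (Suc n) ^ k * norm (a n)))"

text \<open>The weight is a power of \<open>Suc n\<close>, so it never vanishes and the norms
  increase with k.\<close>

definition wnorm :: "nat \<Rightarrow> (nat \<Rightarrow> complex) \<Rightarrow> real" where
  "wnorm k a = (\<Sum>n. real (Suc n) ^ k * norm (a n))"

definition psum :: "(nat \<Rightarrow> complex) \<Rightarrow> complex \<Rightarrow> complex" where
  "psum a w = (\<Sum>n. a n * w ^ n)"

definition cay :: "real \<Rightarrow> complex" where
  "cay x = (of_real x - \<i>) / (of_real x + \<i>)"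

definition Hf :: "nat \<Rightarrow> (nat \<Rightarrow> complex) \<Rightarrow> real \<Rightarrow> complex" where
  "Hf d a x = psum a (cay x) / (of_real x + \<i>) ^ Suc d"

definition Hardy :: "nat \<Rightarrow> (real \<Rightarrow> complex) set" where
  "Hardy d = Hf d ` {a. rapid a}"

lemma norm_cay [simp]: "norm (cay x) = 1"
proof -
  have "norm (complex_of_real x - \<i>) = norm (complex_of_real x + \<i>)" by (simp add: cmod_def)
  then show ?thesis by (simp add: cay_def norm_divide)
qed

lemma rapid_summable: "rapid a \<Longrightarrow> summable (\<lambda>n. real (Suc n) ^ k * norm (a n))"
  unfolding rapid_def by blast

lemma wnorm_nonneg: "rapid a \<Longrightarrow> 0 \<le> wnorm k a"
  unfolding wnorm_def by (intro suminf_nonneg rapid_summable) auto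

lemma rapid_comparison:
  assumes "rapid a" "\<And>n. norm (b n) \<le> C * real (Suc n) ^ j * norm (a n)"
  shows "rapid b" "wnorm k b \<le> C * wnorm (j + k) a"
proof -
  have le: "real (Suc n) ^ k * norm (b n) \<le> C * (real (Suc n) ^ (j + k) * norm (a n))" for n k
  proof -
    have "real (Suc n) ^ k * norm (b n) \<le> real (Suc n) ^ k * (C * real (Suc n) ^ j * norm (a n))"
      by (intro mult_left_mono assms(2)) auto
    then show ?thesis by (simp only: power_add ac_simps)
  qed
  have s: "summable (\<lambda>n. C * (real (Suc n) ^ (j + k) * norm (a n)))" for k
    by (intro summable_mult rapid_summable assms(1))
  have b: "summable (\<lambda>n. real (Suc n) ^ k * norm (b n))" for k
    by (rule summable_comparison_test'[OF s[of k], of 0]) (use le[of _ k] in simp)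
  then show "rapid b" by (simp only: rapid_def) blast
  show "wnorm k b \<le> C * wnorm (j + k) a"
    unfolding wnorm_def suminf_mult[OF rapid_summable[OF assms(1)], symmetric]
    by (intro suminf_le le b s)
qed

lemma rapidI_bounded:
  assumes "\<And>k. \<exists>C. \<forall>n. real (Suc n) ^ k * norm (a n) \<le> C"
  shows "rapid a"
  unfolding rapid_def
proof
  fix k
  \<comment> \<open>Two spare powers of n turn boundedness into comparison with the series of
    1/(n+1)^2.\<close>
  obtain C where C: "\<And>n. real (Suc n) ^ (k + 2) * norm (a n) \<le> C" using assms by blast
  show "summable (\<lambda>n. real (Suc n) ^ k * norm (a n))"
  proof (rule summable_comparison_test')
    show "summable (\<lambda>n. C * (1 / (real (Suc n))\<^sup>2))"
      using inverse_power_summable[of 2, where 'a=real]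
      by (intro summable_mult) (subst summable_Suc_iff, simp add: inverse_eq_divide)
    show "norm (real (Suc n) ^ k * norm (a n)) \<le> C * (1 / (real (Suc n))\<^sup>2)" for n
    proof -
      have "real (Suc n) ^ k * norm (a n) * (real (Suc n))\<^sup>2 \<le> C"
        using C[of n] by (simp only: power_add ac_simps)
      then show ?thesis by (simp add: field_simps)
    qed
  qed
qed

lemma rapid_add: "rapid a \<Longrightarrow> rapid b \<Longrightarrow> rapid (\<lambda>n. a n + b n)"
  and wnorm_add: "rapid a \<Longrightarrow> rapid b \<Longrightarrow> wnorm k (\<lambda>n. a n + b n) \<le> wnorm k a + wnorm k b"
proof -
  assume a: "rapid a" and b: "rapid b"
  have le: "real (Suc n) ^ k * norm (a n + b n) \<le> real (Suc n) ^ k * norm (a n) + real (Suc n) ^ k * norm (b n)" for n k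
    unfolding distrib_left[symmetric] by (intro mult_left_mono norm_triangle_ineq) auto
  have s: "summable (\<lambda>n. real (Suc n) ^ k * norm (a n) + real (Suc n) ^ k * norm (b n))" for k
    by (intro summable_add rapid_summable a b)
  have ab: "summable (\<lambda>n. real (Suc n) ^ k * norm (a n + b n))" for k
    by (rule summable_comparison_test'[OF s[of k], of 0]) (use le[of _ k] in simp)
  then show "rapid (\<lambda>n. a n + b n)" by (simp only: rapid_def) blast
  show "wnorm k (\<lambda>n. a n + b n) \<le> wnorm k a + wnorm k b"
    unfolding wnorm_def suminf_add[OF rapid_summable[OF a] rapid_summable[OF b]]
    by (intro suminf_le le ab s)
qed

lemma rapid_cmul: "rapid a \<Longrightarrow> rapid (\<lambda>n. c * a n)"
  and wnorm_cmul: "rapid a \<Longrightarrow> wnorm k (\<lambda>n. c * a n) \<le> norm c * wnorm k a"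
  using rapid_comparison(1)[of a "\<lambda>n. c * a n" "norm c" 0]
    rapid_comparison(2)[of a "\<lambda>n. c * a n" "norm c" 0 k] by (simp_all add: norm_mult)

lemma rapid_times_n: "rapid a \<Longrightarrow> rapid (\<lambda>n. of_nat n * a n)"
  and wnorm_times_n: "rapid a \<Longrightarrow> wnorm k (\<lambda>n. of_nat n * a n) \<le> wnorm (Suc k) a"
  using rapid_comparison(1)[of a "\<lambda>n. of_nat n * a n" 1 1]
    rapid_comparison(2)[of a "\<lambda>n. of_nat n * a n" 1 1 k] by (simp_all add: norm_mult mult_right_mono)

lemma wnorm_mono: "rapid a \<Longrightarrow> k \<le> l \<Longrightarrow> wnorm k a \<le> wnorm l a"
  unfolding wnorm_def
  by (intro suminf_le mult_right_mono power_increasing rapid_summable) auto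

text \<open>The coefficients of w times the series. Together with \<open>dseq\<close>, the
  coefficients of the derivative, it expresses vector fields on the disc.\<close>

definition shift_up :: "(nat \<Rightarrow> complex) \<Rightarrow> nat \<Rightarrow> complex" where
  "shift_up a n = (case n of 0 \<Rightarrow> 0 | Suc m \<Rightarrow> a m)"

lemma rapid_shift_up: "rapid a \<Longrightarrow> rapid (shift_up a)"
  and wnorm_shift_up: "rapid a \<Longrightarrow> wnorm k (shift_up a) \<le> 2 ^ k * wnorm k a"
proof -
  assume a: "rapid a"
  have le: "real (Suc (Suc n)) ^ k * norm (a n) \<le> 2 ^ k * (real (Suc n) ^ k * norm (a n))" for n k
  proof -
    have "real (Suc (Suc n)) ^ k \<le> (2 * real (Suc n)) ^ k" by (intro power_mono) auto
    then show ?thesis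
      unfolding mult.assoc[symmetric] power_mult_distrib[symmetric] by (intro mult_right_mono) auto
  qed
  have s: "summable (\<lambda>n. 2 ^ k * (real (Suc n) ^ k * norm (a n)))" for k
    by (intro summable_mult rapid_summable a)
  have s2: "summable (\<lambda>n. real (Suc (Suc n)) ^ k * norm (a n))" for k
    by (rule summable_comparison_test'[OF s[of k], of 0]) (use le[of _ k] in simp)
  then have s3: "summable (\<lambda>n. real (Suc n) ^ k * norm (shift_up a n))" for k
    by (subst summable_Suc_iff[symmetric]) (simp add: shift_up_def)
  then show "rapid (shift_up a)" by (simp only: rapid_def) blast
  have "wnorm k (shift_up a) = (\<Sum>n. real (Suc (Suc n)) ^ k * norm (a n))"
    using suminf_split_head[OF s3[of k]] by (simp add: wnorm_def shift_up_def)
  also have "\<dots> \<le> 2 ^ k * wnorm k a"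
    unfolding wnorm_def suminf_mult[OF rapid_summable[OF a], symmetric]
    by (intro suminf_le le s s2)
  finally show "wnorm k (shift_up a) \<le> 2 ^ k * wnorm k a" .
qed

definition dseq :: "(nat \<Rightarrow> complex) \<Rightarrow> nat \<Rightarrow> complex" where
  "dseq a n = of_nat (Suc n) * a (Suc n)"

lemma rapid_dseq: "rapid a \<Longrightarrow> rapid (dseq a)"
  and wnorm_dseq: "rapid a \<Longrightarrow> wnorm k (dseq a) \<le> wnorm (Suc k) a"
proof -
  assume a: "rapid a"
  have le: "real (Suc n) ^ k * norm (dseq a n) \<le> real (Suc (Suc n)) ^ Suc k * norm (a (Suc n))" for n k
  proof -
    have "real (Suc n) ^ k * norm (dseq a n) = (real (Suc n) ^ k * real (Suc n)) * norm (a (Suc n))"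
      by (simp add: dseq_def norm_mult del: of_nat_Suc)
    also have "\<dots> \<le> (real (Suc (Suc n)) ^ k * real (Suc (Suc n))) * norm (a (Suc n))"
      by (intro mult_right_mono mult_mono power_mono) auto
    finally show ?thesis by (simp only: power_Suc ac_simps)
  qed
  have s: "summable (\<lambda>n. real (Suc (Suc n)) ^ Suc k * norm (a (Suc n)))" for k
    using rapid_summable[OF a, of "Suc k"] by (subst (asm) summable_Suc_iff[symmetric])
  have s2: "summable (\<lambda>n. real (Suc n) ^ k * norm (dseq a n))" for k
    by (rule summable_comparison_test'[OF s[of k], of 0]) (use le[of _ k] in simp)
  then show "rapid (dseq a)" by (simp only: rapid_def) blast
  have "wnorm k (dseq a) \<le> (\<Sum>n. real (Suc (Suc n)) ^ Suc k * norm (a (Suc n)))"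
    unfolding wnorm_def by (intro suminf_le le s s2)
  also have "\<dots> \<le> wnorm (Suc k) a"
    using suminf_split_head[OF rapid_summable[OF a, of "Suc k"]] by (simp add: wnorm_def)
  finally show "wnorm k (dseq a) \<le> wnorm (Suc k) a" .
qed

section \<open>Power series on the closed unit disc\<close>

lemma psum_summable_norm:
  assumes "rapid a" "norm w \<le> 1" shows "summable (\<lambda>n. norm (a n * w ^ n))"
proof (rule summable_comparison_test'[of "\<lambda>n. real (Suc n) ^ 0 * norm (a n)" 0])
  show "norm (norm (a n * w ^ n)) \<le> real (Suc n) ^ 0 * norm (a n)" for n
    using mult_left_mono[OF power_le_one[of "norm w" n], of "norm (a n)"] assms(2)
    by (simp add: norm_mult norm_power)
qed (rule rapid_summable[OF assms(1)])

lemma psum_sums: "rapid a \<Longrightarrow> norm w \<le> 1 \<Longrightarrow> (\<lambda>n. a n * w ^ n) sums psum a w"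
  unfolding psum_def by (rule summable_sums[OF summable_norm_cancel[OF psum_summable_norm]])

lemma norm_psum_le:
  assumes "rapid a" "norm w \<le> 1" shows "norm (psum a w) \<le> wnorm 0 a"
proof -
  have "norm (psum a w) \<le> (\<Sum>n. norm (a n * w ^ n))"
    unfolding psum_def by (rule summable_norm[OF psum_summable_norm[OF assms]])
  also have "\<dots> \<le> wnorm 0 a"
    unfolding wnorm_def
  proof (rule suminf_le[OF _ psum_summable_norm[OF assms] rapid_summable[OF assms(1)]])
    show "norm (a n * w ^ n) \<le> real (Suc n) ^ 0 * norm (a n)" for n
      using mult_left_mono[OF power_le_one[of "norm w" n], of "norm (a n)"] assms(2)
      by (simp add: norm_mult norm_power)
  qed
  finally show ?thesis .
qed

text \<open>Rapid decrease makes the differentiated series converge uniformly on the closed disc, so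
  the derivative exists up to the circle, where \<open>cay\<close> takes its values.\<close>

lemma psum_has_derivative:
  assumes a: "rapid a" and w: "w \<in> cball 0 1"
  shows "(psum a has_field_derivative psum (dseq a) w) (at w within cball 0 1)"
proof -
  let ?f = "\<lambda>n w. a n * w ^ n" and ?f' = "\<lambda>n w. a n * (of_nat n * w ^ (n - 1))"
  have d: "(?f n has_field_derivative ?f' n w) (at w within cball 0 1)" for n w
    by (auto intro!: derivative_eq_intros)
  have bd: "norm (?f' n w) \<le> real (Suc n) ^ 1 * norm (a n)" if "w \<in> cball 0 1" for n w
  proof -
    have "norm (?f' n w) = real n * norm w ^ (n - 1) * norm (a n)" by (simp add: norm_mult norm_power)
    also have "\<dots> \<le> real (Suc n) * 1 * norm (a n)"
      using that by (intro mult_right_mono mult_mono power_le_one) auto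
    finally show ?thesis by simp
  qed
  have ul: "uniform_limit (cball 0 1) (\<lambda>n w. \<Sum>i<n. ?f' i w) (\<lambda>w. \<Sum>i. ?f' i w) sequentially"
    by (rule Weierstrass_m_test[OF bd rapid_summable[OF a]])
  obtain g where g: "\<And>w. w \<in> cball 0 1 \<Longrightarrow> (\<lambda>n. ?f n w) sums g w"
      "\<And>w. w \<in> cball 0 1 \<Longrightarrow> (g has_field_derivative (\<Sum>i. ?f' i w)) (at w within cball 0 1)"
    using has_field_derivative_series[OF convex_cball d ul, of 0] psum_sums[OF a, of 0]
    by (auto simp: sums_iff)
  have eq: "g w = psum a w" if "w \<in> cball 0 1" for w
    using g(1)[OF that] by (simp add: psum_def sums_iff)
  have "summable (\<lambda>i. ?f' i w)"
    by (rule summable_comparison_test'[OF rapid_summable[OF a, of 1], of 0]) (use bd[OF w] in simp)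
  from suminf_split_head[OF this] have "(\<Sum>i. ?f' i w) = psum (dseq a) w"
    by (simp add: psum_def dseq_def ac_simps)
  then show ?thesis
    using has_field_derivative_transform_within[OF g(2)[OF w] zero_less_one w] eq by simp
qed

lemma continuous_on_psum: "rapid a \<Longrightarrow> continuous_on (cball 0 1) (psum a)"
  by (rule DERIV_continuous_on) (rule psum_has_derivative)

lemma psum_add: "rapid a \<Longrightarrow> rapid b \<Longrightarrow> norm w \<le> 1 \<Longrightarrow> psum (\<lambda>n. a n + b n) w = psum a w + psum b w"
  using sums_add[OF psum_sums psum_sums, of a w b w] by (simp add: psum_def sums_iff distrib_right)

lemma psum_cmul: "rapid a \<Longrightarrow> norm w \<le> 1 \<Longrightarrow> psum (\<lambda>n. c * a n) w = c * psum a w"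
  using sums_mult[OF psum_sums, of a w c] by (simp add: psum_def sums_iff ac_simps)

lemma psum_shift_up:
  assumes "rapid a" "norm w \<le> 1" shows "psum (shift_up a) w = w * psum a w"
proof -
  have "summable (\<lambda>n. shift_up a n * w ^ n)"
    using psum_sums[OF rapid_shift_up[OF assms(1)] assms(2)] by (simp add: sums_iff)
  from suminf_split_head[OF this] show ?thesis
    using sums_mult[OF psum_sums, of a w w] assms
    by (simp add: psum_def shift_up_def sums_iff ac_simps)
qed

lemma psum_times_n:
  assumes "rapid a" "norm w \<le> 1" shows "psum (\<lambda>n. of_nat n * a n) w = w * psum (dseq a) w"
proof -
  have "(\<lambda>n. of_nat n * a n) = shift_up (dseq a)"
    by (auto simp: fun_eq_iff shift_up_def dseq_def split: nat.split)
  then show ?thesis using psum_shift_up[OF rapid_dseq[OF assms(1)] assms(2)] by simp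
qed

section \<open>The Cayley coordinate and Hardy functions on the line\<close>

lemma cay_has_vector_derivative:
  "(cay has_vector_derivative 2 * \<i> / (of_real x + \<i>)\<^sup>2) (at x)"
proof -
  have "((\<lambda>z. (z - \<i>) / (z + \<i>)) has_field_derivative 2 * \<i> / (of_real x + \<i>)\<^sup>2) (at (complex_of_real x))"
    by (rule derivative_eq_intros refl | simp)+ (simp add: field_simps power2_eq_square)
  from has_vector_derivative_real_field[OF this] show ?thesis by (simp add: cay_def[abs_def])
qed

lemma psum_cay_has_vector_derivative:
  assumes "rapid a"
  shows "((\<lambda>x. psum a (cay x)) has_vector_derivative
    2 * \<i> / (of_real x + \<i>)\<^sup>2 * psum (dseq a) (cay x)) (at x)"
proof -
  have "(psum a has_field_derivative psum (dseq a) (cay x)) (at (cay x) within range cay)"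
    by (rule DERIV_subset[OF psum_has_derivative[OF assms]]) auto
  from field_vector_diff_chain_within[OF cay_has_vector_derivative this]
  show ?thesis by (simp add: o_def)
qed

lemma Hf_has_vector_derivative:
  assumes "rapid a"
  shows "(Hf d a has_vector_derivative
     (2 * \<i> / (of_real x + \<i>)\<^sup>2 * psum (dseq a) (cay x)
       - (of_nat d + 1) / (of_real x + \<i>) * psum a (cay x)) / (of_real x + \<i>) ^ Suc d) (at x)"
proof -
  let ?z = "complex_of_real x"
  have "((\<lambda>z. inverse (z + \<i>) ^ Suc d) has_field_derivative
     - (of_nat d + 1) / (?z + \<i>) / (?z + \<i>) ^ Suc d) (at ?z)"
  proof -
    have "((\<lambda>z. inverse (z + \<i>)) has_field_derivative - (1 / (?z + \<i>)\<^sup>2)) (at ?z)"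
      by (rule derivative_eq_intros refl | simp)+ (simp add: divide_inverse power2_eq_square)
    from DERIV_power[OF this, of "Suc d"] show ?thesis
    proof (rule DERIV_cong)
      have "of_nat (Suc d) * (- (1 / c\<^sup>2) * inverse c ^ (Suc d - Suc 0)) = - (of_nat d + 1) / c / c ^ Suc d"
        if "c \<noteq> 0" for c :: complex
        using that by (simp add: field_simps power2_eq_square)
      then show "of_nat (Suc d) * (- (1 / (?z + \<i>)\<^sup>2) * inverse (?z + \<i>) ^ (Suc d - Suc 0))
          = - (of_nat d + 1) / (?z + \<i>) / (?z + \<i>) ^ Suc d" by simp
    qed
  qed
  note D = has_vector_derivative_mult[OF psum_cay_has_vector_derivative[OF assms] has_vector_derivative_real_field[OF this]]
  have "Hf d a = (\<lambda>x. psum a (cay x) * inverse (of_real x + \<i>) ^ Suc d)"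
    by (simp add: Hf_def fun_eq_iff divide_inverse power_inverse del: power_Suc)
  then show ?thesis
    by (simp only:) (rule has_vector_derivative_eq_rhs[OF D],
        simp add: divide_inverse power_inverse algebra_simps del: power_Suc)
qed

text \<open>In the basis \<open>(x - \<i>)\<^sup>n / (x + \<i>)\<^sup>n\<^sup>+\<^sup>d\<^sup>+\<^sup>1\<close> the vector fields with quadratic coefficient
  \<open>u (x + \<i>)\<^sup>2 + v (1 + x\<^sup>2) + t (x - \<i>)\<^sup>2\<close> act by lowering, diagonal and raising operators.\<close>

definition seqop :: "nat \<Rightarrow> complex \<Rightarrow> complex \<Rightarrow> complex \<Rightarrow> (nat \<Rightarrow> complex) \<Rightarrow> nat \<Rightarrow> complex" where
  "seqop d u v t a = (\<lambda>n. 2 * \<i> * u * dseq a n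
     + (\<i> * v * (2 * (of_nat n * a n) + (of_nat d + 1) * a n)
     + 2 * \<i> * t * shift_up (\<lambda>n. of_nat n * a n + (of_nat d + 1) * a n) n))"

lemma rapid_seqop: "rapid a \<Longrightarrow> rapid (seqop d u v t a)"
  unfolding seqop_def
  by (intro rapid_add rapid_cmul rapid_dseq rapid_times_n rapid_shift_up)

section \<open>Vector fields and the enveloping algebra on coefficient sequences\<close>

text \<open>Continuity for the weighted norms with a loss \<open>K\<close> of weights that is
  independent of \<open>k\<close>; under composition the losses simply add.\<close>

definition bounded_seqop :: "((nat \<Rightarrow> complex) \<Rightarrow> nat \<Rightarrow> complex) \<Rightarrow> bool" where
  "bounded_seqop T \<longleftrightarrow> (\<forall>a. rapid a \<longrightarrow> rapid (T a)) \<and>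
     (\<exists>K. \<forall>k. \<exists>C\<ge>0. \<forall>a. rapid a \<longrightarrow> wnorm k (T a) \<le> C * wnorm (k + K) a)"

lemma bounded_seqopI:
  assumes "\<And>a. rapid a \<Longrightarrow> rapid (T a)"
    and "\<And>k a. rapid a \<Longrightarrow> wnorm k (T a) \<le> C k * wnorm (k + K) a" "\<And>k. 0 \<le> C k"
  shows "bounded_seqop T"
  using assms unfolding bounded_seqop_def by blast

lemma bounded_seqopE:
  assumes "bounded_seqop T"
  obtains C K where "\<And>a. rapid a \<Longrightarrow> rapid (T a)"
    "\<And>k a. rapid a \<Longrightarrow> wnorm k (T a) \<le> C k * wnorm (k + K) a" "\<And>k. 0 \<le> (C k :: real)"
proof -
  from assms obtain K where "\<forall>k. \<exists>C\<ge>0. \<forall>a. rapid a \<longrightarrow> wnorm k (T a) \<le> C * wnorm (k + K) a"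
    unfolding bounded_seqop_def by blast
  from choice[OF this] show ?thesis
    using assms that unfolding bounded_seqop_def by blast
qed

lemma bounded_seqop_id: "bounded_seqop (\<lambda>a. a)"
  by (rule bounded_seqopI[where C="\<lambda>_. 1" and K=0]) auto

lemma bounded_seqop_times_n: "bounded_seqop (\<lambda>a n. of_nat n * a n)"
  by (rule bounded_seqopI[where C="\<lambda>_. 1" and K=1]) (simp_all add: rapid_times_n wnorm_times_n)

lemma bounded_seqop_dseq: "bounded_seqop dseq"
  by (rule bounded_seqopI[where C="\<lambda>_. 1" and K=1]) (simp_all add: rapid_dseq wnorm_dseq)

lemma bounded_seqop_shift_up: "bounded_seqop shift_up"
  by (rule bounded_seqopI[where C="\<lambda>k. 2 ^ k" and K=0]) (simp_all add: rapid_shift_up wnorm_shift_up)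

lemma bounded_seqop_cmul:
  assumes "bounded_seqop T" shows "bounded_seqop (\<lambda>a n. c * T a n)"
proof -
  obtain C K where T: "\<And>a. rapid a \<Longrightarrow> rapid (T a)"
    "\<And>k a. rapid a \<Longrightarrow> wnorm k (T a) \<le> C k * wnorm (k + K) a" "\<And>k. 0 \<le> C k"
    using bounded_seqopE[OF assms] by blast
  show ?thesis
  proof (rule bounded_seqopI[where C="\<lambda>k. norm c * C k" and K=K])
    show "wnorm k (\<lambda>n. c * T a n) \<le> norm c * C k * wnorm (k + K) a" if "rapid a" for k a
      using order_trans[OF wnorm_cmul[OF T(1)[OF that]] mult_left_mono[OF T(2)[OF that]]] by (simp add: mult.assoc)
  qed (simp_all add: T rapid_cmul)
qed

lemma bounded_seqop_add:
  assumes "bounded_seqop S" "bounded_seqop T" shows "bounded_seqop (\<lambda>a n. S a n + T a n)"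
proof -
  obtain C K where S: "\<And>a. rapid a \<Longrightarrow> rapid (S a)"
    "\<And>k a. rapid a \<Longrightarrow> wnorm k (S a) \<le> C k * wnorm (k + K) a" "\<And>k. 0 \<le> C k"
    using bounded_seqopE[OF assms(1)] by blast
  obtain C' K' where T: "\<And>a. rapid a \<Longrightarrow> rapid (T a)"
    "\<And>k a. rapid a \<Longrightarrow> wnorm k (T a) \<le> C' k * wnorm (k + K') a" "\<And>k. 0 \<le> C' k"
    using bounded_seqopE[OF assms(2)] by blast
  show ?thesis
  proof (rule bounded_seqopI[where C="\<lambda>k. C k + C' k" and K="K + K'"])
    fix k a assume a: "rapid a"
    have "wnorm k (S a) \<le> C k * wnorm (k + (K + K')) a"
      by (rule order_trans[OF S(2)[OF a] mult_left_mono[OF wnorm_mono[OF a] S(3)]]) simp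
    moreover have "wnorm k (T a) \<le> C' k * wnorm (k + (K + K')) a"
      by (rule order_trans[OF T(2)[OF a] mult_left_mono[OF wnorm_mono[OF a] T(3)]]) simp
    ultimately show "wnorm k (\<lambda>n. S a n + T a n) \<le> (C k + C' k) * wnorm (k + (K + K')) a"
      using wnorm_add[OF S(1)[OF a] T(1)[OF a], of k] by (simp add: distrib_right)
  qed (simp_all add: S T rapid_add)
qed

lemma bounded_seqop_comp:
  assumes "bounded_seqop S" "bounded_seqop T" shows "bounded_seqop (\<lambda>a. S (T a))"
proof -
  obtain C K where S: "\<And>a. rapid a \<Longrightarrow> rapid (S a)"
    "\<And>k a. rapid a \<Longrightarrow> wnorm k (S a) \<le> C k * wnorm (k + K) a" "\<And>k. 0 \<le> C k"
    using bounded_seqopE[OF assms(1)] by blast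
  obtain C' K' where T: "\<And>a. rapid a \<Longrightarrow> rapid (T a)"
    "\<And>k a. rapid a \<Longrightarrow> wnorm k (T a) \<le> C' k * wnorm (k + K') a" "\<And>k. 0 \<le> C' k"
    using bounded_seqopE[OF assms(2)] by blast
  show ?thesis
  proof (rule bounded_seqopI[where C="\<lambda>k. C k * C' (k + K)" and K="K + K'"])
    fix k a assume a: "rapid a"
    show "wnorm k (S (T a)) \<le> C k * C' (k + K) * wnorm (k + (K + K')) a"
      using order_trans[OF S(2)[OF T(1)[OF a], of k] mult_left_mono[OF T(2)[OF a, of "k + K"] S(3)[of k]]]
      by (simp only: mult.assoc add.assoc)
  qed (simp_all add: S T)
qed

lemma bounded_seqop_seqop: "bounded_seqop (seqop d u v t)"
  unfolding seqop_def
  by (intro bounded_seqop_add bounded_seqop_cmul bounded_seqop_dseq bounded_seqop_times_n bounded_seqop_id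
      bounded_seqop_comp[OF bounded_seqop_shift_up])

lemma psum_seqop:
  assumes a: "rapid a" and w: "norm w \<le> 1"
  shows "psum (seqop d u v t a) w = 2 * \<i> * (u + v * w + t * w\<^sup>2) * psum (dseq a) w
     + \<i> * (of_nat d + 1) * (v + 2 * t * w) * psum a w"
proof -
  note r = rapid_add rapid_cmul rapid_dseq rapid_times_n rapid_shift_up a
  have "psum (seqop d u v t a) w = 2 * \<i> * u * psum (dseq a) w
     + (\<i> * v * (2 * (w * psum (dseq a) w) + (of_nat d + 1) * psum a w)
     + 2 * \<i> * t * (w * (w * psum (dseq a) w + (of_nat d + 1) * psum a w)))"
    unfolding seqop_def
    by (subst psum_add psum_cmul psum_times_n psum_shift_up; (intro r w)?)+ simp
  then show ?thesis by (simp add: algebra_simps power2_eq_square)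
qed

lemma vf_Hf:
  assumes a: "rapid a"
  shows "vf d (v - u - t) (2 * \<i> * (u - t)) (u + v + t) (Hf d a) = Hf d (seqop d u v t a)"
proof
  fix x
  define z where "z = complex_of_real x + \<i>"
  define w where "w = cay x"
  define F where "F = psum a w"
  define F' where "F' = psum (dseq a) w"
  define P where "P = z ^ Suc d"
  have z: "z \<noteq> 0" by (simp add: z_def)
  have P: "P \<noteq> 0" using z by (simp add: P_def)
  have x: "complex_of_real x = z - \<i>" by (simp add: z_def)
  have wz: "w * z = z - 2 * \<i>" using z by (simp add: w_def cay_def x)
  have Q: "v - u - t + 2 * \<i> * (u - t) * (z - \<i>) + (u + v + t) * (z - \<i>)\<^sup>2 = z\<^sup>2 * (u + v * w + t * w\<^sup>2)"
  proof -
    have "z\<^sup>2 * (u + v * w + t * w\<^sup>2) = u * z\<^sup>2 + v * z * (w * z) + t * (w * z)\<^sup>2"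
      by (simp add: algebra_simps power2_eq_square)
    also have "\<dots> = v - u - t + 2 * \<i> * (u - t) * (z - \<i>) + (u + v + t) * (z - \<i>)\<^sup>2"
      unfolding wz by (simp add: algebra_simps power2_eq_square)
    finally show ?thesis by simp
  qed
  \<comment> \<open>The term with 1/z from differentiating (x + i)^(-d-1) and half the derivative of
    the quadratic combine to a polynomial in w. This is where the weight (d+1)/2 in
    \<open>vf\<close> matters.\<close>
  have Q': "(2 * \<i> * (u - t) + 2 * (u + v + t) * (z - \<i>)) / 2 - z * (u + v * w + t * w\<^sup>2) = \<i> * (v + 2 * t * w)"
  proof -
    have "z * (u + v * w + t * w\<^sup>2) = u * z + v * (w * z) + t * w * (w * z)"
      by (simp add: algebra_simps power2_eq_square)
    also have "t * w * (w * z) = t * (w * z) - 2 * \<i> * t * w"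
      by (subst wz) (simp add: algebra_simps)
    finally have "z * (u + v * w + t * w\<^sup>2) = u * z + v * (z - 2 * \<i>) + t * (z - 2 * \<i>) - 2 * \<i> * t * w"
      by (simp only: wz) simp
    then show ?thesis by (simp add: algebra_simps add_divide_distrib diff_divide_distrib)
  qed
  have vd: "vector_derivative (Hf d a) (at x) = (2 * \<i> / z\<^sup>2 * F' - (of_nat d + 1) / z * F) / P"
    using vector_derivative_at[OF Hf_has_vector_derivative[OF a, of d x]]
    by (simp only: z_def w_def F_def F'_def P_def)
  have Hx: "Hf d a x = F / P" by (simp only: Hf_def z_def w_def F_def P_def)
  have "vf d (v - u - t) (2 * \<i> * (u - t)) (u + v + t) (Hf d a) x =
     (z\<^sup>2 * (u + v * w + t * w\<^sup>2)) * ((2 * \<i> / z\<^sup>2 * F' - (of_nat d + 1) / z * F) / P)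
     + (of_nat d + 1) * ((2 * \<i> * (u - t) + 2 * (u + v + t) * (z - \<i>)) / 2) * (F / P)"
    unfolding vf_def vd Hx of_real_power x Q by simp
  also have "\<dots> = (2 * \<i> * (u + v * w + t * w\<^sup>2) * F' + (of_nat d + 1) * F *
     ((2 * \<i> * (u - t) + 2 * (u + v + t) * (z - \<i>)) / 2 - z * (u + v * w + t * w\<^sup>2))) / P"
    (is "?L = ?R")
  proof -
    define q where "q = u + v * w + t * w\<^sup>2"
    define h where "h = (2 * \<i> * (u - t) + 2 * (u + v + t) * (z - \<i>)) / 2"
    have "z\<^sup>2 * q * ((2 * \<i> / z\<^sup>2 * F' - (of_nat d + 1) / z * F) / P)
        = (2 * \<i> * q * F' - (of_nat d + 1) * F * (z * q)) / P"
      using z P by (simp add: field_simps power2_eq_square)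
    then show ?thesis unfolding q_def[symmetric] h_def[symmetric]
      by (simp add: diff_divide_distrib add_divide_distrib algebra_simps)
  qed
  also have "\<dots> = Hf d (seqop d u v t a) x"
    unfolding Q' Hf_def psum_seqop[OF a, of "cay x", simplified]
    by (simp add: z_def w_def F_def F'_def P_def algebra_simps del: power_Suc)
  finally show "vf d (v - u - t) (2 * \<i> * (u - t)) (u + v + t) (Hf d a) x = Hf d (seqop d u v t a) x" .
qed

lemma vf_Hf':
  "\<exists>u v t. \<forall>a. rapid a \<longrightarrow> vf d \<alpha> \<beta> \<gamma> (Hf d a) = Hf d (seqop d u v t a)"
proof -
  \<comment> \<open>These are the coordinates of the quadratic in the basis (x + i)^2, 1 + x^2, (x -
    i)^2.\<close>
  define v u t where "v = (\<alpha> + \<gamma>) / 2" and "u = (\<gamma> - \<alpha>) / 4 - \<i> * \<beta> / 4" and "t = (\<gamma> - \<alpha>) / 4 + \<i> * \<beta> / 4"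
  have "v - u - t = \<alpha>" "u + v + t = \<gamma>" "2 * \<i> * (u - t) = \<beta>"
    by (simp_all add: v_def u_def t_def field_simps)
  then show ?thesis using vf_Hf[of _ d v u t] by metis
qed

text \<open>Plain differentiation is the vector field with coefficients 1, 0, 0. The Hardy functions
  are thus closed under it, as \<open>smooth_on_coinduct\<close> requires.\<close>

lemma Hf_vector_derivative:
  assumes "rapid a"
  shows "\<exists>b. rapid b \<and> (\<forall>x. (Hf d a has_vector_derivative Hf d b x) (at x))"
proof -
  obtain u v t where "vf d 1 0 0 (Hf d a) = Hf d (seqop d u v t a)"
    using vf_Hf'[of d 1 0 0] assms by blast
  then have "vector_derivative (Hf d a) (at x) = Hf d (seqop d u v t a) x" for x
    by (auto simp: vf_def fun_eq_iff)
  then show ?thesis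
    using Hf_has_vector_derivative[OF assms, of d] rapid_seqop[OF assms]
    by (metis vector_derivative_at)
qed

lemma smooth_on_Hf: "rapid a \<Longrightarrow> smooth_on UNIV (Hf d a)"
proof (rule smooth_on_coinduct[where R = "Hardy d"])
  fix h assume "h \<in> Hardy d"
  then obtain a where a: "rapid a" "h = Hf d a" by (auto simp: Hardy_def)
  from Hf_vector_derivative[OF a(1), of d] obtain b
    where "rapid b" "\<forall>x. (Hf d a has_vector_derivative Hf d b x) (at x)" by blast
  then show "\<exists>h'\<in>Hardy d. \<forall>x\<in>UNIV. (h has_vector_derivative h' x) (at x)"
    unfolding a(2) Hardy_def by (intro bexI[of _ "Hf d b"]) auto
qed (auto simp: Hardy_def)

text \<open>The inversion x -> -1/x is w -> -w in the Cayley coordinate, and (x + i)^(d+1) changes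
  by a constant and a power of x.\<close>

lemma partner_Hf:
  assumes a: "rapid a"
  shows "partner d (Hf d a) (\<lambda>x. inverse \<i> ^ Suc d * Hf d (\<lambda>n. (-1) ^ n * a n) x)"
  unfolding partner_def
proof (intro allI impI)
  fix x :: real assume x: "x \<noteq> 0"
  define y where "y = - 1 / x"
  have e1: "complex_of_real x * (complex_of_real y + \<i>) = \<i> * (of_real x + \<i>)"
    using x by (simp add: field_simps y_def)
  have e2: "cay y = - cay x"
  proof -
    have "complex_of_real x * (complex_of_real y - \<i>) = - \<i> * (of_real x - \<i>)"
      using x by (simp add: field_simps y_def)
    then have "cay y = (- \<i> * (of_real x - \<i>)) / (\<i> * (of_real x + \<i>))"
      unfolding cay_def e1[symmetric] using x by (metis mult_divide_mult_cancel_left of_real_eq_0_iff)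
    then show ?thesis by (simp add: cay_def)
  qed
  have "psum (\<lambda>n. (-1) ^ n * a n) (cay x) = psum a (- cay x)"
    unfolding psum_def by (rule arg_cong[of _ _ suminf]) (auto simp: fun_eq_iff power_minus')
  then have "inverse \<i> ^ Suc d * Hf d (\<lambda>n. (-1) ^ n * a n) x
      = psum a (- cay x) * inverse ((\<i> * (of_real x + \<i>)) ^ Suc d)"
    unfolding Hf_def by (simp only: divide_inverse power_mult_distrib inverse_mult_distrib power_inverse ac_simps)
  also have "\<dots> = inverse (complex_of_real x) ^ Suc d * Hf d a y"
    unfolding Hf_def e1[symmetric] e2
    by (simp only: divide_inverse power_mult_distrib inverse_mult_distrib power_inverse ac_simps)
  finally show "inverse \<i> ^ Suc d * Hf d (\<lambda>n. (-1) ^ n * a n) x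
      = inverse (complex_of_real x) ^ Suc d * Hf d a (- 1 / x)" by (simp only: y_def)
qed

lemma rapid_norm_eq: "rapid a \<Longrightarrow> (\<And>n. norm (b n) = norm (a n)) \<Longrightarrow> rapid b"
  by (simp add: rapid_def)

lemma Hf_I_space:
  assumes a: "rapid a" shows "Hf d a \<in> I_space d"
proof -
  have "rapid (\<lambda>n. (-1) ^ n * a n)"
    by (rule rapid_norm_eq[OF a]) (simp add: norm_mult norm_power)
  then have "smooth_on UNIV (\<lambda>x. inverse \<i> ^ Suc d * Hf d (\<lambda>n. (-1) ^ n * a n) x)"
    by (intro smooth_on_mult smooth_on_const smooth_on_Hf perfect_set_UNIV)
  then show ?thesis
    unfolding I_space_iff using smooth_on_Hf[OF a] partner_Hf[OF a] by blast
qed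

lemma Hf_add: "rapid a \<Longrightarrow> rapid b \<Longrightarrow> Hf d (\<lambda>n. a n + b n) = (\<lambda>x. Hf d a x + Hf d b x)"
  by (simp add: Hf_def fun_eq_iff psum_add add_divide_distrib)

lemma Hf_cmul: "rapid a \<Longrightarrow> Hf d (\<lambda>n. c * a n) = (\<lambda>x. c * Hf d a x)"
  by (simp add: Hf_def fun_eq_iff psum_cmul)

text \<open>Lifts the algebra of operators to coefficient sequences; through it all seminorms of
  Hardy functions are controlled by \<open>wnorm\<close>.\<close>

lemma U_ops_Hf:
  assumes "D \<in> U_ops d"
  shows "\<exists>T. bounded_seqop T \<and> (\<forall>a. rapid a \<longrightarrow> rapid (T a) \<and> D (Hf d a) = Hf d (T a))"
  using assms
proof induction
  case one
  show ?case using bounded_seqop_id by blast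
next
  case (gen X)
  obtain u v t where "\<And>a. rapid a \<Longrightarrow>
      vf d (X $ 1 $ 2) (- 2 * X $ 1 $ 1) (- X $ 2 $ 1) (Hf d a) = Hf d (seqop d u v t a)"
    using vf_Hf' by blast
  then have "rapid (seqop d u v t a) \<and> dpi d X (Hf d a) = Hf d (seqop d u v t a)" if "rapid a" for a
    using dpi_eq_vf[OF gen smooth_on_Hf, of a d] rapid_seqop that by simp
  then show ?case using bounded_seqop_seqop by blast
next
  case (mult D E)
  then obtain S T where
    "bounded_seqop S" "\<And>a. rapid a \<Longrightarrow> rapid (S a) \<and> D (Hf d a) = Hf d (S a)"
    "bounded_seqop T" "\<And>a. rapid a \<Longrightarrow> rapid (T a) \<and> E (Hf d a) = Hf d (T a)" by blast
  then show ?case using bounded_seqop_comp[of S T] by (intro exI[of _ "\<lambda>a. S (T a)"]) simp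
next
  case (add D E)
  then obtain S T where
    "bounded_seqop S" "\<And>a. rapid a \<Longrightarrow> rapid (S a) \<and> D (Hf d a) = Hf d (S a)"
    "bounded_seqop T" "\<And>a. rapid a \<Longrightarrow> rapid (T a) \<and> E (Hf d a) = Hf d (T a)" by blast
  then show ?case using bounded_seqop_add[of S T]
    by (intro exI[of _ "\<lambda>a n. S a n + T a n"])
       (simp add: rapid_add Hf_add)
next
  case (scale D c)
  then obtain T where
    "bounded_seqop T" "\<And>a. rapid a \<Longrightarrow> rapid (T a) \<and> D (Hf d a) = Hf d (T a)" by blast
  then show ?case using bounded_seqop_cmul[of T "of_real c"]
    by (intro exI[of _ "\<lambda>a n. of_real c * T a n"])
       (simp add: rapid_cmul Hf_cmul scaleR_conv_of_real)
qed

section \<open>Fourier series on the circle in the Cayley coordinate\<close>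

text \<open>The Cauchy distribution, which \<open>cay\<close> carries to normalised arc length on
  the unit circle.\<close>

definition circ :: "real measure" where
  "circ = density lborel (\<lambda>x. ennreal (1 / (pi * (1 + x\<^sup>2))))"

lemma one_plus_square_neq_0 [simp]: "1 + x\<^sup>2 \<noteq> (0::real)"
  using zero_le_power2[of x] by linarith

lemma ii_plus_of_real_neq_0 [simp]: "\<i> + complex_of_real x \<noteq> 0"
  using of_real_plus_ii_neq_0[of x] by (simp add: add.commute)

lemma one_plus_square_pos [simp]: "0 < 1 + (x::real)\<^sup>2"
  by (simp add: add_pos_nonneg)

lemma
  shows integrable_cauchy: "integrable lborel (\<lambda>x::real. 1 / (1 + x\<^sup>2))"
    and integral_cauchy: "(LINT x|lborel. 1 / (1 + x\<^sup>2)) = pi"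
proof -
  have bot: "(arctan \<longlongrightarrow> - (pi/2)) at_bot" and top: "(arctan \<longlongrightarrow> pi/2) at_top"
    by (rule tendsto_arctan_at_bot tendsto_arctan_at_top)+
  have D: "DERIV arctan x :> 1 / (1 + x\<^sup>2)" for x
    by (auto intro!: derivative_eq_intros simp: inverse_eq_divide)
  have c: "isCont (\<lambda>x. 1 / (1 + x\<^sup>2)) x" for x :: real
    by (intro continuous_intros) auto
  have n: "AE x in lborel. (- \<infinity>) < ereal x \<longrightarrow> ereal x < \<infinity> \<longrightarrow> 0 \<le> 1 / (1 + x\<^sup>2)"
    by simp
  have A: "((arctan \<circ> real_of_ereal) \<longlongrightarrow> - (pi/2)) (at_right (- \<infinity>))"
    "((arctan \<circ> real_of_ereal) \<longlongrightarrow> pi/2) (at_left \<infinity>)"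
    using bot top by (simp_all add: ereal_tendsto_simps)
  note * = interval_integral_FTC_nonneg[of "-\<infinity>" \<infinity> arctan "\<lambda>x. 1 / (1 + x\<^sup>2)", OF _ D c n A]
  show "integrable lborel (\<lambda>x::real. 1 / (1 + x\<^sup>2))"
    using *(1) by (simp add: set_integrable_def)
  show "(LINT x|lborel. 1 / (1 + x\<^sup>2)) = pi"
    using *(2) by (simp add: interval_lebesgue_integral_def set_lebesgue_integral_def)
qed

lemma space_circ [simp]: "space circ = UNIV" and sets_circ [simp, measurable_cong]: "sets circ = sets borel"
  by (simp_all add: circ_def)

lemma integrable_circ_iff:
  fixes f :: "real \<Rightarrow> 'a::{banach, second_countable_topology}"
  assumes "f \<in> borel_measurable borel"
  shows "integrable circ f \<longleftrightarrow> integrable lborel (\<lambda>x. (1 / (pi * (1 + x\<^sup>2))) *\<^sub>R f x)"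
  unfolding circ_def using assms by (subst integrable_density) (auto simp: add_nonneg_nonneg)

lemma integral_circ:
  fixes f :: "real \<Rightarrow> 'a::{banach, second_countable_topology}"
  assumes "f \<in> borel_measurable borel"
  shows "integral\<^sup>L circ f = (LINT x|lborel. (1 / (pi * (1 + x\<^sup>2))) *\<^sub>R f x)"
  unfolding circ_def using assms by (subst integral_density) (auto simp: add_nonneg_nonneg)

lemma prob_space_circ: "prob_space circ"
proof
  have i: "integrable lborel (\<lambda>x::real. (1 / pi) * (1 / (1 + x\<^sup>2)))"
    by (intro integrable_mult_right integrable_cauchy)
  have "emeasure circ (space circ) = (\<integral>\<^sup>+ x. ennreal ((1 / pi) * (1 / (1 + x\<^sup>2))) \<partial>lborel)"
    by (simp add: circ_def emeasure_density)
  also have "\<dots> = ennreal (LINT x|lborel. (1 / pi) * (1 / (1 + x\<^sup>2)))"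
    by (intro nn_integral_eq_integral i) (simp add: add_nonneg_nonneg)
  also have "(LINT x|lborel. (1 / pi) * (1 / (1 + x\<^sup>2))) = 1"
    by (subst integral_mult_right_zero) (simp add: integral_cauchy)
  finally show "emeasure circ (space circ) = 1" by simp
qed

interpretation circ: prob_space circ by (rule prob_space_circ)

lemma measure_circ_UNIV [simp]: "measure circ UNIV = 1"
  using circ.prob_space by simp

section \<open>Fourier coefficients and integration by parts\<close>

text \<open>Bounded Borel functions form an algebra inside the integrable functions of the
  probability measure \<open>circ\<close>, which settles integrability once and for all.\<close>

definition bmeas :: "(real \<Rightarrow> complex) \<Rightarrow> bool" where
  "bmeas f \<longleftrightarrow> f \<in> borel_measurable borel \<and> (\<exists>C. \<forall>x. norm (f x) \<le> C)"

lemma bmeas_measurable [measurable_dest]: "bmeas f \<Longrightarrow> f \<in> borel_measurable borel"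
  by (simp add: bmeas_def)

lemma bmeas_integrable: "bmeas f \<Longrightarrow> integrable circ f"
  unfolding bmeas_def by (auto intro!: circ.integrable_const_bound)

lemma bmeas_integrable_square:
  assumes "bmeas f" shows "integrable circ (\<lambda>x. (norm (f x))\<^sup>2)"
proof -
  obtain C where C: "\<And>x. norm (f x) \<le> C" using assms by (auto simp: bmeas_def)
  have "(norm (f x))\<^sup>2 \<le> C\<^sup>2" for x by (intro power_mono C) auto
  then show ?thesis using assms
    by (intro circ.integrable_const_bound[where B="C\<^sup>2"])
       (auto intro!: borel_measurable_power borel_measurable_norm bmeas_measurable)
qed

lemma bmeas_const: "bmeas (\<lambda>x. c)"
  unfolding bmeas_def by auto

lemma bmeas_mult: "bmeas f \<Longrightarrow> bmeas g \<Longrightarrow> bmeas (\<lambda>x. f x * g x)"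
proof -
  assume f: "bmeas f" and g: "bmeas g"
  then obtain C D where C: "\<And>x. norm (f x) \<le> C" and D: "\<And>x. norm (g x) \<le> D" by (auto simp: bmeas_def)
  have "norm (f x * g x) \<le> C * D" for x
    unfolding norm_mult by (intro mult_mono C D norm_ge_zero order_trans[OF norm_ge_zero C])
  with f g show ?thesis unfolding bmeas_def by (auto intro!: borel_measurable_times)
qed

lemma bmeas_add: "bmeas f \<Longrightarrow> bmeas g \<Longrightarrow> bmeas (\<lambda>x. f x + g x)"
proof -
  assume f: "bmeas f" and g: "bmeas g"
  then obtain C D where C: "\<And>x. norm (f x) \<le> C" and D: "\<And>x. norm (g x) \<le> D" by (auto simp: bmeas_def)
  have "norm (f x + g x) \<le> C + D" for x
    by (intro norm_triangle_mono C D)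
  with f g show ?thesis unfolding bmeas_def by (auto intro!: borel_measurable_add)
qed

lemma bmeas_cmul: "bmeas f \<Longrightarrow> bmeas (\<lambda>x. c * f x)"
  by (intro bmeas_mult bmeas_const)

lemma bmeas_diff: "bmeas f \<Longrightarrow> bmeas g \<Longrightarrow> bmeas (\<lambda>x. f x - g x)"
  using bmeas_add[of f "\<lambda>x. -1 * g x"] bmeas_cmul[of g "-1"] by simp

lemma cay_nonzero [simp]: "cay x \<noteq> 0"
  using norm_cay[of x] by force

lemma continuous_on_cay: "continuous_on UNIV cay"
  by (intro continuous_at_imp_continuous_on ballI has_vector_derivative_continuous[OF cay_has_vector_derivative])

lemma norm_cay_powi [simp]: "norm (cay x powi n) = 1"
  by (simp add: norm_power_int)

lemma bmeas_continuous:
  "continuous_on UNIV f \<Longrightarrow> (\<And>x. norm (f x) \<le> C) \<Longrightarrow> bmeas f"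
  unfolding bmeas_def using borel_measurable_continuous_onI by blast

lemma bmeas_cay_powi: "bmeas (\<lambda>x. cay x powi n)"
  by (rule bmeas_continuous[where C=1]) (auto intro!: continuous_on_power_int continuous_on_cay)

text \<open>The n-th Fourier coefficient in w; on the circle w^(-n) is the conjugate of w^n.\<close>

definition fc :: "int \<Rightarrow> (real \<Rightarrow> complex) \<Rightarrow> complex" where
  "fc n f = integral\<^sup>L circ (\<lambda>x. f x * cay x powi (- n))"

lemma fc_cmul: "fc n (\<lambda>x. c * f x) = c * fc n f"
  unfolding fc_def mult.assoc by (rule integral_mult_right_zero)

lemma fc_diff: "bmeas f \<Longrightarrow> bmeas g \<Longrightarrow> fc n (\<lambda>x. f x - g x) = fc n f - fc n g"
  unfolding fc_def left_diff_distrib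
  by (intro Bochner_Integration.integral_diff bmeas_integrable bmeas_mult bmeas_cay_powi)

lemma cay_tendsto: "(cay \<longlongrightarrow> 1) at_top" "(cay \<longlongrightarrow> 1) at_bot"
proof -
  \<comment> \<open>Separating real and imaginary parts leaves rational functions of a real
    variable, whose limits \<open>real_asymp\<close> finds.\<close>
  have eq: "cay x = 1 - 2 * \<i> * (of_real (x / (1 + x\<^sup>2)) - \<i> * of_real (1 / (1 + x\<^sup>2)))" for x
  proof -
    have "complex_of_real (1 + x\<^sup>2) = (of_real x + \<i>) * (of_real x - \<i>)"
      by (simp add: algebra_simps power2_eq_square)
    then have "of_real (x / (1 + x\<^sup>2)) - \<i> * of_real (1 / (1 + x\<^sup>2)) = (of_real x - \<i>) / ((of_real x + \<i>) * (of_real x - \<i>))"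
      by (simp only: of_real_divide of_real_1) (simp add: diff_divide_distrib)
    moreover have "complex_of_real x - \<i> \<noteq> 0" by (auto simp: complex_eq_iff)
    ultimately have "of_real (x / (1 + x\<^sup>2)) - \<i> * of_real (1 / (1 + x\<^sup>2)) = 1 / (of_real x + \<i>)"
      by simp
    then show ?thesis by (simp only:) (simp add: cay_def field_simps)
  qed
  have l: "((\<lambda>x::real. x / (1 + x\<^sup>2)) \<longlongrightarrow> 0) at_top" "((\<lambda>x::real. 1 / (1 + x\<^sup>2)) \<longlongrightarrow> 0) at_top"
    "((\<lambda>x::real. x / (1 + x\<^sup>2)) \<longlongrightarrow> 0) at_bot" "((\<lambda>x::real. 1 / (1 + x\<^sup>2)) \<longlongrightarrow> 0) at_bot"
    by real_asymp+
  have "((\<lambda>x. 1 - 2 * \<i> * (of_real (x / (1 + x\<^sup>2)) - \<i> * of_real (1 / (1 + x\<^sup>2)))) \<longlongrightarrow> 1 - 2 * \<i> * (of_real 0 - \<i> * of_real 0)) at_top"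
    "((\<lambda>x. 1 - 2 * \<i> * (of_real (x / (1 + x\<^sup>2)) - \<i> * of_real (1 / (1 + x\<^sup>2)))) \<longlongrightarrow> 1 - 2 * \<i> * (of_real 0 - \<i> * of_real 0)) at_bot"
    by (intro tendsto_intros l)+
  then show "(cay \<longlongrightarrow> 1) at_top" "(cay \<longlongrightarrow> 1) at_bot"
    unfolding eq[abs_def] by simp_all
qed

text \<open>The operator (1 + x^2) d/dx is twice the derivative in the angle of w, so the powers of
  w are its eigenfunctions.\<close>

lemma cay_powi_has_vector_derivative:
  "((\<lambda>x. cay x powi m) has_vector_derivative 2 * \<i> * of_int m / of_real (1 + x\<^sup>2) * cay x powi m) (at x)"
proof -
  let ?z = "complex_of_real x"
  have nz: "(?z - \<i>) / (?z + \<i>) \<noteq> 0" using cay_nonzero[of x] by (simp add: cay_def)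
  have "((\<lambda>z. (z - \<i>) / (z + \<i>)) has_field_derivative 2 * \<i> / (?z + \<i>)\<^sup>2) (at ?z)"
    by (rule derivative_eq_intros refl | simp)+ (simp add: field_simps power2_eq_square)
  from DERIV_power_int[OF this disjI2[OF nz], of m]
  have "((\<lambda>z. ((z - \<i>) / (z + \<i>)) powi m) has_field_derivative
      of_int m * ((?z - \<i>) / (?z + \<i>)) powi (m - 1) * (2 * \<i> / (?z + \<i>)\<^sup>2)) (at ?z)" by simp
  from has_vector_derivative_real_field[OF this]
  have *: "((\<lambda>x. cay x powi m) has_vector_derivative
      of_int m * cay x powi (m - 1) * (2 * \<i> / (?z + \<i>)\<^sup>2)) (at x)"
    by (simp add: cay_def)
  have "of_int m * cay x powi (m - 1) * (2 * \<i> / (?z + \<i>)\<^sup>2)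
     = 2 * \<i> * of_int m / (cay x * (?z + \<i>)\<^sup>2) * cay x powi m"
    by (simp add: power_int_diff)
  moreover have "cay x * (?z + \<i>)\<^sup>2 = of_real (1 + x\<^sup>2)"
  proof -
    have "cay x * (?z + \<i>)\<^sup>2 = (?z - \<i>) * (?z + \<i>)" by (simp add: cay_def power2_eq_square)
    also have "\<dots> = of_real (1 + x\<^sup>2)" by (simp add: algebra_simps power2_eq_square)
    finally show ?thesis .
  qed
  ultimately have "of_int m * cay x powi (m - 1) * (2 * \<i> / (?z + \<i>)\<^sup>2)
     = 2 * \<i> * of_int m / of_real (1 + x\<^sup>2) * cay x powi m"
    by (simp only:)
  with * show ?thesis by simp
qed

lemma integral_FTC_UNIV:
  fixes F f :: "real \<Rightarrow> complex"
  assumes "\<And>x. (F has_vector_derivative f x) (at x)" "continuous_on UNIV f" "integrable lborel f"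
    and "(F \<longlongrightarrow> A) at_bot" "(F \<longlongrightarrow> B) at_top"
  shows "(LINT x|lborel. f x) = B - A"
proof -
  have "isCont f x" for x using assms(2) by (simp add: continuous_on_eq_continuous_at)
  then have "(LBINT x=-\<infinity>..\<infinity>. f x) = B - A"
    using assms
    by (intro interval_integral_FTC_integrable) (auto simp: set_integrable_def ereal_tendsto_simps)
  then show ?thesis by (simp add: interval_lebesgue_integral_def set_lebesgue_integral_def)
qed

text \<open>Integration by parts on the circle. The boundary terms cancel because F has the same
  limit at both ends of the line and \<open>cay\<close> tends to 1 at both.\<close>

lemma fc_derivative:
  assumes F: "\<And>x. (F has_vector_derivative F' x) (at x)" and c: "continuous_on UNIV F'"
    and bF: "\<And>x. norm (F x) \<le> C" and b: "\<And>x. norm (of_real (1 + x\<^sup>2) * F' x) \<le> C'"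
    and lim: "(F \<longlongrightarrow> L) at_top" "(F \<longlongrightarrow> L) at_bot"
  shows "fc n (\<lambda>x. of_real (1 + x\<^sup>2) * F' x) = 2 * \<i> * of_int n * fc n F"
proof -
  have cF: "continuous_on UNIV F"
    by (intro continuous_at_imp_continuous_on ballI has_vector_derivative_continuous[OF F])
  have bm: "bmeas F" "bmeas (\<lambda>x. of_real (1 + x\<^sup>2) * F' x)"
    by (rule bmeas_continuous[OF _ bF] bmeas_continuous[OF _ b]; intro continuous_intros c cF)+
  \<comment> \<open>Divided by 1 + x^2 this is the exact derivative of F times w^(-n).\<close>
  define g where "g x = of_real (1 + x\<^sup>2) * F' x * cay x powi (-n) - 2 * \<i> * of_int n * (F x * cay x powi (-n))" for x
  have bg: "bmeas g" unfolding g_def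
    by (intro bmeas_diff bmeas_mult bmeas_const bmeas_cay_powi bm)
  have g_alt: "(1 / (1 + x\<^sup>2)) *\<^sub>R g x = F x * (2 * \<i> * of_int (-n) / of_real (1 + x\<^sup>2) * cay x powi (-n)) + F' x * cay x powi (-n)" for x
    by (simp add: g_def scaleR_conv_of_real field_simps del: of_real_add of_real_power)
  have "(LINT x|lborel. (1 / (1 + x\<^sup>2)) *\<^sub>R g x) = L * 1 powi (-n) - L * 1 powi (-n)"
  proof (rule integral_FTC_UNIV)
    show "((\<lambda>x. F x * cay x powi (-n)) has_vector_derivative (1 / (1 + x\<^sup>2)) *\<^sub>R g x) (at x)" for x
      unfolding g_alt by (intro has_vector_derivative_mult F cay_powi_has_vector_derivative)
    show "continuous_on UNIV (\<lambda>x. (1 / (1 + x\<^sup>2)) *\<^sub>R g x)"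
      unfolding g_def by (intro continuous_intros c cF continuous_on_power_int continuous_on_cay) auto
    show "integrable lborel (\<lambda>x. (1 / (1 + x\<^sup>2)) *\<^sub>R g x)"
      using bmeas_integrable[OF bg] integrable_circ_iff[OF bmeas_measurable[OF bg]]
        integrable_scaleR_right[where c=pi and f="\<lambda>x. (1 / (pi * (1 + x\<^sup>2))) *\<^sub>R g x" and M=lborel] by simp
  qed (intro tendsto_intros tendsto_power_int lim cay_tendsto; simp)+
  then have "integral\<^sup>L circ g = 0"
    using integral_scaleR_right[where c="1/pi" and M=lborel and f="\<lambda>x. (1 / (1 + x\<^sup>2)) *\<^sub>R g x"]
    by (simp add: integral_circ[OF bmeas_measurable[OF bg]])
  moreover have "integral\<^sup>L circ g = fc n (\<lambda>x. of_real (1 + x\<^sup>2) * F' x) - 2 * \<i> * of_int n * fc n F"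
    unfolding g_def fc_def integral_mult_right_zero[symmetric]
    by (intro Bochner_Integration.integral_diff bmeas_integrable bmeas_mult bmeas_const bmeas_cay_powi bm)
  ultimately show ?thesis by simp
qed

lemma fc_const: "fc n (\<lambda>x. c) = (if n = 0 then c else 0)"
proof (cases "n = 0")
  case False
  \<comment> \<open>A constant has derivative 0, so 2 i n times its n-th coefficient
    vanishes.\<close>
  have "fc n (\<lambda>x. of_real (1 + x\<^sup>2) * 0) = 2 * \<i> * of_int n * fc n (\<lambda>x. c)"
    by (rule fc_derivative[where C="norm c" and C'=0 and L=c]) auto
  then have "2 * \<i> * of_int n * fc n (\<lambda>x. c) = 0" by (simp add: fc_def)
  then show ?thesis using False by simp
qed (simp add: fc_def circ.prob_space)

lemma fc_shift: "fc n (\<lambda>x. cay x powi m * f x) = fc (n - m) f"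
proof -
  have "cay x powi m * f x * cay x powi - n = f x * cay x powi - (n - m)" for x
    by (simp add: power_int_diff power_int_minus divide_inverse ac_simps)
  then show ?thesis unfolding fc_def by (simp only:)
qed

lemma fc_cay_powi: "fc n (\<lambda>x. cay x powi m) = (if n = m then 1 else 0)"
  using fc_shift[of n m "\<lambda>x. 1"] by (simp add: fc_const)

section \<open>Bessel's inequality and pointwise Fourier inversion\<close>

lemma bessel_step:
  assumes "bmeas f"
  shows "integral\<^sup>L circ (\<lambda>x. (norm (f x - fc m f * cay x powi m))\<^sup>2)
    = integral\<^sup>L circ (\<lambda>x. (norm (f x))\<^sup>2) - (norm (fc m f))\<^sup>2"
proof -
  define c where "c = fc m f"
  have pt: "(norm (f x - c * cay x powi m))\<^sup>2
      = (norm (f x))\<^sup>2 - 2 * Re (cnj c * (f x * cay x powi (-m))) + (norm c)\<^sup>2" for x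
  proof -
    define W where "W = cay x powi m"
    have "W * cnj W = of_real ((norm W)\<^sup>2)" by (rule complex_norm_square[symmetric])
    then have "cnj W * W = 1" by (simp add: W_def mult.commute del: complex_cnj_power_int)
    then have W: "cay x powi (-m) = cnj W"
      by (metis W_def cay_nonzero mult_cancel_right power_int_not_zero power_int_minus left_inverse)
    have "complex_of_real ((norm (f x - c * W))\<^sup>2) = (f x - c * W) * cnj (f x - c * W)"
      by (rule complex_norm_square)
    also have "\<dots> = f x * cnj (f x) - (cnj c * (f x * cnj W) + cnj (cnj c * (f x * cnj W))) + c * cnj c * (cnj W * W)"
      by (simp add: algebra_simps)
    also have "\<dots> = of_real ((norm (f x))\<^sup>2 - 2 * Re (cnj c * (f x * cnj W)) + (norm c)\<^sup>2)"
      unfolding \<open>cnj W * W = 1\<close> complex_add_cnj by (simp only: complex_norm_square of_real_add of_real_diff mult_1_right)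
    finally show ?thesis unfolding W W_def[symmetric] of_real_eq_iff .
  qed
  have b2: "integrable circ (\<lambda>x. (norm (f x))\<^sup>2)" by (rule bmeas_integrable_square[OF assms])
  have i: "integrable circ (\<lambda>x. cnj c * (f x * cay x powi (-m)))"
    by (intro bmeas_integrable bmeas_mult bmeas_const bmeas_cay_powi assms)
  have "integral\<^sup>L circ (\<lambda>x. cnj c * (f x * cay x powi (-m))) = cnj c * c"
    by (subst integral_mult_right_zero) (simp add: c_def fc_def)
  then have "integral\<^sup>L circ (\<lambda>x. Re (cnj c * (f x * cay x powi (-m)))) = (norm c)\<^sup>2"
    using integral_Re[OF i] by (metis Re_complex_of_real complex_norm_square mult.commute)
  moreover define h where "h x = Re (cnj c * (f x * cay x powi (-m)))" for x
  ultimately have h: "integral\<^sup>L circ h = (norm c)\<^sup>2" "integrable circ h"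
    using integrable_Re[OF i] by (simp_all only: h_def[abs_def])
  show ?thesis
    unfolding c_def[symmetric] pt h_def[symmetric] using b2 h by simp
qed

text \<open>The three claims are carried together: subtracting one Fourier term leaves the other
  coefficients unchanged, so each use of \<open>bessel_step\<close> removes a coefficient of the
  original function.\<close>

lemma bessel:
  assumes f: "bmeas f" and "finite A"
  shows "bmeas (\<lambda>x. f x - (\<Sum>m\<in>A. fc m f * cay x powi m)) \<and>
    integral\<^sup>L circ (\<lambda>x. (norm (f x - (\<Sum>m\<in>A. fc m f * cay x powi m)))\<^sup>2)
    = integral\<^sup>L circ (\<lambda>x. (norm (f x))\<^sup>2) - (\<Sum>m\<in>A. (norm (fc m f))\<^sup>2) \<and>
    (\<forall>n. n \<notin> A \<longrightarrow> fc n (\<lambda>x. f x - (\<Sum>m\<in>A. fc m f * cay x powi m)) = fc n f)"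
  using assms(2)
proof induction
  case (insert m A)
  let ?R = "\<lambda>x. f x - (\<Sum>m\<in>A. fc m f * cay x powi m)"
  have eq: "f x - (\<Sum>m\<in>insert m A. fc m f * cay x powi m) = ?R x - fc m ?R * cay x powi m" for x
    using insert by simp
  have "bmeas (\<lambda>x. ?R x - fc m ?R * cay x powi m)"
    by (rule bmeas_diff[OF _ bmeas_cmul[OF bmeas_cay_powi]]) (use insert in blast)
  moreover have "fc n (\<lambda>x. ?R x - fc m ?R * cay x powi m) = fc n f" if "n \<notin> insert m A" for n
  proof -
    have "fc n (\<lambda>x. ?R x - fc m ?R * cay x powi m) = fc n ?R - fc n (\<lambda>x. fc m ?R * cay x powi m)"
      using insert by (intro fc_diff bmeas_cmul bmeas_cay_powi) blast
    then show ?thesis using insert that by (simp add: fc_cmul fc_cay_powi)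
  qed
  moreover have "integral\<^sup>L circ (\<lambda>x. (norm (?R x - fc m ?R * cay x powi m))\<^sup>2)
    = integral\<^sup>L circ (\<lambda>x. (norm (f x))\<^sup>2) - (\<Sum>m\<in>insert m A. (norm (fc m f))\<^sup>2)"
    using insert bessel_step[of ?R m] by auto
  ultimately show ?case unfolding eq by blast
qed (use f in auto)

lemma bessel_le:
  assumes "bmeas f" "finite A"
  shows "(\<Sum>m\<in>A. (norm (fc m f))\<^sup>2) \<le> integral\<^sup>L circ (\<lambda>x. (norm (f x))\<^sup>2)"
proof -
  have "0 \<le> integral\<^sup>L circ (\<lambda>x. (norm (f x - (\<Sum>m\<in>A. fc m f * cay x powi m)))\<^sup>2)" by simp
  then show ?thesis using bessel[OF assms] by simp
qed

text \<open>Riemann-Lebesgue: by Bessel the squared moduli are summable along any injective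
  enumeration. It is used towards both infinities.\<close>

lemma fc_tendsto_0:
  assumes f: "bmeas f" and h: "inj h"
  shows "(\<lambda>k::nat. fc (h k) f) \<longlonglongrightarrow> 0"
proof -
  have "summable (\<lambda>k. (norm (fc (h k) f))\<^sup>2)"
  proof (rule summableI_nonneg_bounded)
    fix n
    have "(\<Sum>k<n. (norm (fc (h k) f))\<^sup>2) = (\<Sum>m\<in>h ` {..<n}. (norm (fc m f))\<^sup>2)"
      by (subst sum.reindex) (auto intro: inj_on_subset[OF h])
    also have "\<dots> \<le> integral\<^sup>L circ (\<lambda>x. (norm (f x))\<^sup>2)"
      by (intro bessel_le f) auto
    finally show "(\<Sum>k<n. (norm (fc (h k) f))\<^sup>2) \<le> integral\<^sup>L circ (\<lambda>x. (norm (f x))\<^sup>2)" .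
  qed auto
  from summable_LIMSEQ_zero[OF this] have "(\<lambda>k. sqrt ((norm (fc (h k) f))\<^sup>2)) \<longlonglongrightarrow> sqrt 0"
    by (rule tendsto_real_sqrt)
  then show ?thesis by (simp add: tendsto_norm_zero_iff)
qed

text \<open>Pointwise Fourier inversion following Chernoff: dividing \<open>F - F x0\<close> by \<open>cay - cay x0\<close> turns the
  Fourier sum into a telescoping one.\<close>

lemma cay_diff: "norm (cay x - cay y) = 2 * \<bar>x - y\<bar> / (norm (of_real x + \<i>) * norm (of_real y + \<i>))"
proof -
  have "cay x - cay y = 2 * \<i> * of_real (x - y) / ((of_real x + \<i>) * (of_real y + \<i>))"
    by (simp add: cay_def field_simps)
  then show ?thesis by (simp add: norm_divide norm_mult del: of_real_diff)
qed

lemma fourier_inversion: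
  assumes F: "\<And>x. (F has_vector_derivative F' x) (at x)"
    and bF: "\<And>x. norm (F x) \<le> C" and b: "\<And>x. norm (F' x) \<le> C'"
    and neg: "\<And>n. n < 0 \<Longrightarrow> fc n F = 0"
  shows "(\<lambda>n. fc (int n) F * cay x0 ^ n) sums F x0"
proof -
  define w0 where "w0 = cay x0"
  have w0: "w0 \<noteq> 0" by (simp add: w0_def)
  \<comment> \<open>At \<open>x0\<close> division by zero gives 0, which is harmless since the
    identity \<open>eq\<close> below holds there as well.\<close>
  define q where "q x = (F x - F x0) / (cay x - w0)" for x
  define N where "N = norm (complex_of_real x0 + \<i>)"
  \<comment> \<open>Comes from \<open>cay_diff\<close> and |x + i| <= |x - x0| + N.\<close>
  define c where "c = 2 / ((1 + N) * N)"
  have N: "N > 0" by (simp add: N_def)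
  have C0: "0 \<le> C" "0 \<le> C'" using order_trans[OF norm_ge_zero bF] order_trans[OF norm_ge_zero b] by auto
  have cF: "continuous_on UNIV F"
    by (intro continuous_at_imp_continuous_on ballI has_vector_derivative_continuous[OF F])
  \<comment> \<open>Numerator and denominator of \<open>q\<close> are compared with the same
    quantity, |x - x0| cut off at 1. Near \<open>x0\<close> this bounds a difference quotient; far
    away the numerator is bounded and the denominator stays away from 0.\<close>
  have up: "norm (F x - F x0) \<le> (C' + 2 * C) * min 1 \<bar>x - x0\<bar>" for x
  proof -
    have "norm (F x - F x0) \<le> C' * norm (x - x0)"
    proof (rule differentiable_bound[of UNIV F "\<lambda>x t. t *\<^sub>R F' x"])
      show "(F has_derivative (\<lambda>t. t *\<^sub>R F' x)) (at x within UNIV)" for x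
        using F[of x] by (simp add: has_vector_derivative_def)
      show "onorm (\<lambda>t. t *\<^sub>R F' x) \<le> C'" for x
        by (intro onorm_le) (use b[of x] in \<open>simp add: mult.commute[of C'] mult_left_mono\<close>)
    qed auto
    moreover have "norm (F x - F x0) \<le> 2 * C"
      using norm_triangle_ineq4[of "F x" "F x0"] bF[of x] bF[of x0] by linarith
    ultimately have "norm (F x - F x0) \<le> (C' + 2 * C) * \<bar>x - x0\<bar>" if "\<bar>x - x0\<bar> \<le> 1"
      using C0 by (auto intro: order_trans[OF _ mult_right_mono])
    moreover have "norm (F x - F x0) \<le> C' + 2 * C"
      using \<open>norm (F x - F x0) \<le> 2 * C\<close> C0 by linarith
    ultimately show ?thesis by (auto simp: min_def)
  qed
  have low: "c * min 1 \<bar>x - x0\<bar> \<le> norm (cay x - w0)" for x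
  proof -
    have "norm (of_real x + \<i>) \<le> \<bar>x - x0\<bar> + N"
    proof -
      have "of_real x + \<i> = of_real (x - x0) + (of_real x0 + \<i>)" by simp
      then show ?thesis unfolding N_def by (metis norm_of_real norm_triangle_ineq)
    qed
    moreover have "(\<bar>x - x0\<bar> + N) * min 1 \<bar>x - x0\<bar> \<le> (1 + N) * \<bar>x - x0\<bar>"
    proof (cases "\<bar>x - x0\<bar> \<le> 1")
      case True
      then show ?thesis
        using mult_right_mono[of "\<bar>x - x0\<bar> + N" "1 + N" "\<bar>x - x0\<bar>"] by (simp add: min_def)
    next
      case False
      then show ?thesis
        using mult_left_mono[of 1 "\<bar>x - x0\<bar>" N] N by (simp add: min_def distrib_right)
    qed
    ultimately have "norm (of_real x + \<i>) * min 1 \<bar>x - x0\<bar> \<le> (1 + N) * \<bar>x - x0\<bar>"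
      using mult_right_mono[of "norm (of_real x + \<i>)" "\<bar>x - x0\<bar> + N" "min 1 \<bar>x - x0\<bar>"] by simp
    moreover have "norm (complex_of_real x + \<i>) > 0" by simp
    moreover have "2 / ((1 + N) * N) * m \<le> 2 * t / (Z * N)" if "Z * m \<le> (1 + N) * t" "Z > 0" for Z m t
    proof -
      have "m / (1 + N) \<le> t / Z" using that N by (simp add: divide_simps mult.commute)
      then have "2 / N * (m / (1 + N)) \<le> 2 / N * (t / Z)" using N by (intro mult_left_mono) auto
      then show ?thesis by (simp add: ac_simps)
    qed
    ultimately show ?thesis
      unfolding w0_def cay_diff N_def[symmetric] c_def by blast
  qed
  have c: "c > 0" using N by (simp add: c_def)
  have bq: "norm (q x) \<le> (C' + 2 * C) / c" for x
  proof (cases "x = x0")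
    case False
    then have "norm (cay x - w0) > 0" using low[of x] c by (smt (verit) mult_pos_pos)
    moreover have "norm (F x - F x0) * c \<le> (C' + 2 * C) * norm (cay x - w0)"
    proof -
      have "norm (F x - F x0) * c \<le> (C' + 2 * C) * min 1 \<bar>x - x0\<bar> * c"
        by (intro mult_right_mono up) (use c in auto)
      also have "\<dots> = (C' + 2 * C) * (c * min 1 \<bar>x - x0\<bar>)" by simp
      also have "\<dots> \<le> (C' + 2 * C) * norm (cay x - w0)"
        by (intro mult_left_mono low) (use C0 in auto)
      finally show ?thesis .
    qed
    ultimately show ?thesis using c by (simp add: q_def norm_divide field_simps)
  qed (use C0 c in \<open>simp add: q_def\<close>)
  have mF: "F \<in> borel_measurable borel" "cay \<in> borel_measurable borel"
    using cF continuous_on_cay by (auto intro: borel_measurable_continuous_onI)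
  have q: "bmeas q"
    unfolding bmeas_def
  proof
    show "q \<in> borel_measurable borel" unfolding q_def using mF by measurable
  qed (use bq in blast)
  have bmF: "bmeas F" by (rule bmeas_continuous[OF cF bF])
  have eq: "F x - F x0 = cay x powi 1 * q x - w0 * q x" for x
  proof (cases "x = x0")
    case False
    then have "cay x \<noteq> w0" using low[of x] c by (smt (verit) mult_pos_pos norm_zero right_minus_eq zero_less_abs_iff)
    then have "(cay x - w0) * q x = F x - F x0" by (simp add: q_def)
    then show ?thesis by (simp add: left_diff_distrib)
  qed (simp add: q_def w0_def)
  have bs: "bmeas (\<lambda>x. cay x powi 1 * q x)" "bmeas (\<lambda>x. w0 * q x)"
    by (intro bmeas_mult bmeas_cay_powi q bmeas_const)+
  have rec: "fc n F - (if n = 0 then F x0 else 0) = fc (n - 1) q - w0 * fc n q" for n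
  proof -
    have "fc n F - fc n (\<lambda>x. F x0) = fc n (\<lambda>x. cay x powi 1 * q x - w0 * q x)"
      unfolding eq[symmetric] by (rule fc_diff[symmetric, OF bmF bmeas_const])
    also have "\<dots> = fc (n - 1) q - w0 * fc n q"
      unfolding fc_diff[OF bs] fc_shift fc_cmul ..
    finally show ?thesis by (simp add: fc_const)
  qed
  \<comment> \<open>The factor w0^n turns the right side of \<open>rec\<close> into a difference of
    consecutive values of T.\<close>
  define T where "T n = w0 powi n * fc (n - 1) q" for n
  have T: "w0 powi n * (fc n F - (if n = 0 then F x0 else 0)) = T n - T (n + 1)" for n
    unfolding rec T_def using w0 by (simp add: power_int_add algebra_simps)
  have normT: "norm (T n) = norm (fc (n - 1) q)" for n
    by (simp add: T_def norm_mult w0_def)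
  \<comment> \<open>Vanishing negative coefficients make T constant for n <= 0. Its limit at minus
    infinity is 0, so \<open>T 0 = 0\<close> and the partial sums starting at 0 telescope without a
    remainder on the left.\<close>
  have Tneg: "T (- int k) = T 0" for k
  proof (induction k)
    case (Suc k)
    have "T (- int (Suc k)) - T (- int (Suc k) + 1) = 0"
      unfolding T[symmetric] using neg[of "- int (Suc k)"] by simp
    then show ?case using Suc by simp
  qed simp
  have "(\<lambda>k. fc (- int k - 1) q) \<longlonglongrightarrow> 0"
    by (rule fc_tendsto_0[OF q]) (auto simp: inj_def)
  from tendsto_norm_zero[OF this] have "(\<lambda>k::nat. norm (T 0)) \<longlonglongrightarrow> 0"
    by (simp add: normT[symmetric] Tneg)
  then have T0: "T 0 = 0" by (simp add: LIMSEQ_const_iff)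
  have part: "(\<Sum>n<N. fc (int n) F * w0 ^ n - (if n = 0 then F x0 else 0)) = - T (int N)" for N
  proof (induction N)
    case (Suc N)
    have "fc (int N) F * w0 ^ N - (if N = 0 then F x0 else 0) = T (int N) - T (int N + 1)"
      unfolding T[symmetric] by (simp add: algebra_simps)
    then show ?case using Suc by (simp add: add.commute)
  qed (simp add: T0)
  have "(\<lambda>k. fc (int k - 1) q) \<longlonglongrightarrow> 0"
    by (rule fc_tendsto_0[OF q]) (auto simp: inj_def)
  from tendsto_norm_zero[OF this] have "(\<lambda>N. - T (int N)) \<longlonglongrightarrow> 0"
    by (intro tendsto_norm_zero_cancel[of "\<lambda>N. - T (int N)"]) (simp add: normT)
  then have "(\<lambda>n. fc (int n) F * w0 ^ n - (if n = 0 then F x0 else 0)) sums 0"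
    unfolding sums_def part .
  from sums_add[OF this sums_single[of 0 "\<lambda>_. F x0"]]
  show ?thesis by (simp add: w0_def)
qed

section \<open>The topology of \<open>I\<^sub>d\<close>\<close>

definition l2 :: "(real \<Rightarrow> complex) \<Rightarrow> real" where
  "l2 f = sqrt (integral\<^sup>L circ (\<lambda>x. (norm (f x))\<^sup>2))"

lemma l2_nonneg: "0 \<le> l2 f"
  by (simp add: l2_def)

lemma l2_power2: "(l2 f)\<^sup>2 = integral\<^sup>L circ (\<lambda>x. (norm (f x))\<^sup>2)"
  by (simp add: l2_def)

text \<open>Minkowski from (u + v)^2 <= (A+B)/A u^2 + (A+B)/B v^2, whose optimal weights A and B are
  the two norms; the epsilon makes them positive.\<close>

lemma l2_triangle:
  assumes f: "bmeas f" and g: "bmeas g"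
  shows "l2 (\<lambda>x. f x + g x) \<le> l2 f + l2 g"
proof (rule field_le_epsilon)
  fix e :: real assume e: "0 < e"
  define A B where "A = l2 f + e / 2" and "B = l2 g + e / 2"
  have AB: "A > 0" "B > 0" "l2 f \<le> A" "l2 g \<le> B"
    using e l2_nonneg[of f] l2_nonneg[of g] by (simp_all add: A_def B_def add_nonneg_pos)
  have pt: "(norm (f x + g x))\<^sup>2 \<le> (A + B) / A * (norm (f x))\<^sup>2 + (A + B) / B * (norm (g x))\<^sup>2" for x
  proof -
    have *: "(u + v)\<^sup>2 \<le> (A + B) / A * u\<^sup>2 + (A + B) / B * v\<^sup>2" for u v :: real
    proof -
      have "(A + B) / A * u\<^sup>2 + (A + B) / B * v\<^sup>2 - (u + v)\<^sup>2 = (B * u - A * v)\<^sup>2 / (A * B)"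
        using AB by (simp add: field_simps power2_eq_square)
      also have "\<dots> \<ge> 0" using AB by simp
      finally show ?thesis by simp
    qed
    have "(norm (f x + g x))\<^sup>2 \<le> (norm (f x) + norm (g x))\<^sup>2"
      by (intro power_mono norm_triangle_ineq) simp
    with *[of "norm (f x)" "norm (g x)"] show ?thesis by linarith
  qed
  have "(l2 (\<lambda>x. f x + g x))\<^sup>2 \<le> integral\<^sup>L circ (\<lambda>x. (A + B) / A * (norm (f x))\<^sup>2 + (A + B) / B * (norm (g x))\<^sup>2)"
    unfolding l2_power2
    by (intro integral_mono bmeas_integrable_square bmeas_add f g pt Bochner_Integration.integrable_add
        integrable_mult_right)
  also have "\<dots> = (A + B) / A * (l2 f)\<^sup>2 + (A + B) / B * (l2 g)\<^sup>2"
    unfolding l2_power2 using bmeas_integrable_square[OF f] bmeas_integrable_square[OF g]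
    by (simp add: integral_mult_right_zero)
  also have "\<dots> \<le> (A + B) / A * A\<^sup>2 + (A + B) / B * B\<^sup>2"
    using AB by (intro add_mono mult_left_mono power_mono l2_nonneg) auto
  also have "\<dots> = (A + B)\<^sup>2" using AB by (simp add: power2_eq_square field_simps)
  finally have "(l2 (\<lambda>x. f x + g x))\<^sup>2 \<le> (A + B)\<^sup>2" .
  then have "l2 (\<lambda>x. f x + g x) \<le> A + B"
    by (rule power2_le_imp_le) (use AB in simp)
  then show "l2 (\<lambda>x. f x + g x) \<le> l2 f + l2 g + e" by (simp add: A_def B_def)
qed

lemma fc_le_l2: "bmeas f \<Longrightarrow> norm (fc n f) \<le> l2 f"
  using power2_le_imp_le[of "norm (fc n f)" "l2 f"] bessel_le[of f "{n}"]
  by (simp add: l2_power2 l2_nonneg)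

definition Ff :: "nat \<Rightarrow> (real \<Rightarrow> complex) \<Rightarrow> real \<Rightarrow> complex" where
  "Ff d \<phi> x = (of_real x + \<i>) ^ Suc d * \<phi> x"

lemma bmeas_Ff: assumes "\<phi> \<in> I_space d" shows "bmeas (Ff d \<phi>)"
proof -
  obtain C where "\<And>x. norm (Ff d \<phi> x) \<le> C" using I_space_bound[OF assms] unfolding Ff_def by blast
  moreover have "continuous_on UNIV (Ff d \<phi>)"
    unfolding Ff_def[abs_def] by (intro continuous_intros smooth_on_continuous I_space_smooth[OF assms])
  ultimately show ?thesis by (rule bmeas_continuous[rotated])
qed

text \<open>Since |x + i|^2 = 1 + x^2, the weight (1 + x^2)^d is |x + i|^(2d+2) times pi times the
  Cauchy density.\<close>

lemma I_seminorm_eq: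
  assumes "D \<phi> \<in> I_space d"
  shows "I_seminorm d D \<phi> = sqrt pi * l2 (Ff d (D \<phi>))"
proof -
  have "(1 + x\<^sup>2) ^ d * (norm (D \<phi> x))\<^sup>2 = pi * ((1 / (pi * (1 + x\<^sup>2))) *\<^sub>R (norm (Ff d (D \<phi>) x))\<^sup>2)" for x
  proof -
    have "(norm (Ff d (D \<phi>) x))\<^sup>2 = ((norm (complex_of_real x + \<i>))\<^sup>2) ^ Suc d * (norm (D \<phi> x))\<^sup>2"
      by (simp only: Ff_def norm_mult norm_power power_mult_distrib power_mult[symmetric] mult.commute[of 2])
    then have "(norm (Ff d (D \<phi>) x))\<^sup>2 = (1 + x\<^sup>2) * ((1 + x\<^sup>2) ^ d * (norm (D \<phi> x))\<^sup>2)"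
      by (simp only: norm_of_real_plus_ii power_Suc mult.assoc)
    then show ?thesis by simp
  qed
  then have "(LINT x|lborel. (1 + x\<^sup>2) ^ d * (norm (D \<phi> x))\<^sup>2)
      = (LINT x|lborel. pi * ((1 / (pi * (1 + x\<^sup>2))) *\<^sub>R (norm (Ff d (D \<phi>) x))\<^sup>2))"
    by (simp only:)
  also have "\<dots> = pi * (LINT x|lborel. (1 / (pi * (1 + x\<^sup>2))) *\<^sub>R (norm (Ff d (D \<phi>) x))\<^sup>2)"
    by (rule integral_mult_right_zero)
  also have "\<dots> = pi * integral\<^sup>L circ (\<lambda>x. (norm (Ff d (D \<phi>) x))\<^sup>2)"
    using bmeas_Ff[OF assms]
    by (subst integral_circ) (auto intro!: borel_measurable_power borel_measurable_norm bmeas_measurable)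
  finally have "I_seminorm d D \<phi> = sqrt (pi * integral\<^sup>L circ (\<lambda>x. (norm (Ff d (D \<phi>) x))\<^sup>2))"
    by (simp only: I_seminorm_def)
  then show ?thesis by (simp add: l2_def real_sqrt_mult)
qed

lemma I_seminorm_triangle:
  assumes D: "D \<in> U_ops d" and I: "\<phi> \<in> I_space d" "\<psi> \<in> I_space d" "\<eta> \<in> I_space d"
  shows "I_seminorm d D (\<lambda>x. \<phi> x - \<eta> x) \<le> I_seminorm d D (\<lambda>x. \<phi> x - \<psi> x) + I_seminorm d D (\<lambda>x. \<psi> x - \<eta> x)"
proof -
  note mem = U_ops_I_space[OF D] I_space_diff I
  have "Ff d (D (\<lambda>x. \<phi> x - \<eta> x)) = (\<lambda>x. Ff d (D (\<lambda>x. \<phi> x - \<psi> x)) x + Ff d (D (\<lambda>x. \<psi> x - \<eta> x)) x)"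
    by (simp add: Ff_def fun_eq_iff U_ops_diff[OF D] I algebra_simps)
  moreover have "l2 (\<lambda>x. Ff d (D (\<lambda>x. \<phi> x - \<psi> x)) x + Ff d (D (\<lambda>x. \<psi> x - \<eta> x)) x)
     \<le> l2 (Ff d (D (\<lambda>x. \<phi> x - \<psi> x))) + l2 (Ff d (D (\<lambda>x. \<psi> x - \<eta> x)))"
    by (intro l2_triangle bmeas_Ff mem)
  ultimately show ?thesis
    by (simp add: I_seminorm_eq mem flip: distrib_left)
qed

lemma Ff_Hf: "Ff d (Hf d a) x = psum a (cay x)"
  by (simp add: Ff_def Hf_def del: power_Suc)

text \<open>Continuity of \<open>Hf d\<close>: the L^2 norm on the circle is at most the supremum
  there, and the supremum is at most the sum of the moduli of the coefficients.\<close>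

lemma I_seminorm_Hf:
  assumes "D \<in> U_ops d"
  shows "\<exists>K C. 0 \<le> C \<and> (\<forall>a. rapid a \<longrightarrow> I_seminorm d D (Hf d a) \<le> C * wnorm K a)"
proof -
  obtain T where T: "bounded_seqop T" "\<And>a. rapid a \<Longrightarrow> rapid (T a) \<and> D (Hf d a) = Hf d (T a)"
    using U_ops_Hf[OF assms] by blast
  obtain C K where CK: "\<And>a. rapid a \<Longrightarrow> wnorm 0 (T a) \<le> C * wnorm K a" "0 \<le> C"
    using bounded_seqopE[OF T(1)] by (metis add_0)
  have "I_seminorm d D (Hf d a) \<le> sqrt pi * C * wnorm K a" if a: "rapid a" for a
  proof -
    define b where "b = T a"
    have b: "rapid b" "D (Hf d a) = Hf d b" "wnorm 0 b \<le> C * wnorm K a" using T(2) CK(1) a by (auto simp: b_def)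
    have "(l2 (Ff d (Hf d b)))\<^sup>2 \<le> integral\<^sup>L circ (\<lambda>x. (wnorm 0 b)\<^sup>2)"
      unfolding l2_power2
      by (intro integral_mono bmeas_integrable_square bmeas_Ff Hf_I_space b power_mono)
         (auto simp: Ff_Hf intro!: norm_psum_le b)
    then have "l2 (Ff d (Hf d b)) \<le> wnorm 0 b"
      using power2_le_imp_le[OF _ wnorm_nonneg[OF b(1)]] by simp
    with b(3) have "l2 (Ff d (Hf d b)) \<le> C * wnorm K a" by linarith
    then show ?thesis by (simp add: I_seminorm_eq b(1,2) Hf_I_space)
  qed
  then show ?thesis using CK(2) by (intro exI[of _ K] exI[of _ "sqrt pi * C"]) auto
qed

section \<open>The rotation generator and the description of the Hardy space by Fourier
  coefficients\<close>

text \<open>\<open>vf d 1 0 1\<close> generates the rotations. On the circle function it is twice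
  the angular derivative plus i (d+1), the latter coming from the factor (x + i)^(d+1).\<close>

lemma Ff_derivative:
  assumes \<phi>: "\<phi> \<in> I_space d"
  defines "F' \<equiv> \<lambda>x. (of_nat d + 1) * (of_real x + \<i>) ^ d * \<phi> x + (of_real x + \<i>) ^ Suc d * vector_derivative \<phi> (at x)"
  shows "(Ff d \<phi> has_vector_derivative F' x) (at x)"
    and "of_real (1 + x\<^sup>2) * F' x = Ff d (vf d 1 0 1 \<phi>) x - \<i> * (of_nat d + 1) * Ff d \<phi> x"
    and "continuous_on UNIV F'"
    and "\<exists>C. \<forall>x. norm (of_real (1 + x\<^sup>2) * F' x) \<le> C"
proof -
  have "((\<lambda>z. (z + \<i>) ^ Suc d) has_field_derivative (of_nat d + 1) * (of_real x + \<i>) ^ d) (at (complex_of_real x))"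
    by (auto intro!: derivative_eq_intros simp del: power_Suc)
  from has_vector_derivative_mult[OF has_vector_derivative_real_field[OF this] smooth_vector_derivative[OF I_space_smooth[OF \<phi>]]]
  show "(Ff d \<phi> has_vector_derivative F' x) (at x)"
    unfolding F'_def Ff_def[abs_def] by (simp only: add.commute)
  have eq: "of_real (1 + x\<^sup>2) * F' x = Ff d (vf d 1 0 1 \<phi>) x - \<i> * (of_nat d + 1) * Ff d \<phi> x" for x
  proof -
    define z where "z = complex_of_real x + \<i>"
    have x: "complex_of_real x = z - \<i>" by (simp add: z_def)
    have r: "complex_of_real (1 + x\<^sup>2) = z * (z - 2 * \<i>)" "1 + 0 * (z - \<i>) + 1 * (z - \<i>)\<^sup>2 = z * (z - 2 * \<i>)"
      unfolding of_real_add of_real_power x by (simp_all add: algebra_simps power2_eq_square)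
    have "z * (z - 2 * \<i>) * (E * P * p + z * P * V)
        = z * P * (z * (z - 2 * \<i>) * V + E / 2 * (0 + 2 * 1 * (z - \<i>)) * p) - \<i> * E * (z * P * p)" for E P p V
      by (simp add: algebra_simps)
    then show ?thesis
      unfolding F'_def Ff_def vf_def of_real_power r(1) x r(2) power_Suc by simp
  qed
  show "of_real (1 + x\<^sup>2) * F' x = Ff d (vf d 1 0 1 \<phi>) x - \<i> * (of_nat d + 1) * Ff d \<phi> x" by (rule eq)
  have "smooth_on UNIV (\<lambda>x. vector_derivative \<phi> (at x))"
    using smooth_on_nth_deriv[OF I_space_smooth[OF \<phi>], of 1] by simp
  then show "continuous_on UNIV F'"
    unfolding F'_def by (intro continuous_intros smooth_on_continuous I_space_smooth[OF \<phi>])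
  have "bmeas (\<lambda>x. Ff d (vf d 1 0 1 \<phi>) x - \<i> * (of_nat d + 1) * Ff d \<phi> x)"
    by (intro bmeas_diff bmeas_cmul bmeas_Ff vf_I_space \<phi>)
  then show "\<exists>C. \<forall>x. norm (of_real (1 + x\<^sup>2) * F' x) \<le> C"
    unfolding eq by (simp add: bmeas_def)
qed

lemma fc_vf:
  assumes \<phi>: "\<phi> \<in> I_space d"
  shows "fc n (Ff d (vf d 1 0 1 \<phi>)) = \<i> * (2 * of_int n + of_nat d + 1) * fc n (Ff d \<phi>)"
proof -
  note D = Ff_derivative[OF \<phi>]
  obtain C where C: "\<And>x. norm (Ff d \<phi> x) \<le> C" using bmeas_Ff[OF \<phi>] by (auto simp: bmeas_def)
  obtain C' where C': "\<And>x. norm (of_real (1 + x\<^sup>2) * ((of_nat d + 1) * (of_real x + \<i>) ^ d * \<phi> x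
       + (of_real x + \<i>) ^ Suc d * vector_derivative \<phi> (at x))) \<le> C'" using D(4) by blast
  obtain L where L: "(Ff d \<phi> \<longlongrightarrow> L) at_top" "(Ff d \<phi> \<longlongrightarrow> L) at_bot"
    using I_space_limits[OF \<phi>] unfolding Ff_def[abs_def] by blast
  have "fc n (\<lambda>x. Ff d (vf d 1 0 1 \<phi>) x - \<i> * (of_nat d + 1) * Ff d \<phi> x) = 2 * \<i> * of_int n * fc n (Ff d \<phi>)"
    using fc_derivative[OF D(1,3) C C' L, of n] unfolding D(2) .
  also have "fc n (\<lambda>x. Ff d (vf d 1 0 1 \<phi>) x - \<i> * (of_nat d + 1) * Ff d \<phi> x)
      = fc n (Ff d (vf d 1 0 1 \<phi>)) - \<i> * (of_nat d + 1) * fc n (Ff d \<phi>)"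
    by (subst fc_diff) (auto intro!: bmeas_cmul bmeas_Ff vf_I_space \<phi> simp: fc_cmul)
  finally show ?thesis by (simp add: algebra_simps)
qed

text \<open>Each use of the rotation generator, which preserves I_d, gains one power: for n >= 0 its
  eigenvalue has modulus 2n + d + 1 >= n + 1.\<close>

lemma fc_rapid:
  "\<phi> \<in> I_space d \<Longrightarrow> \<exists>C. \<forall>n. real (Suc n) ^ k * norm (fc (int n) (Ff d \<phi>)) \<le> C"
proof (induction k arbitrary: \<phi>)
  case 0
  then show ?case using fc_le_l2[OF bmeas_Ff] by auto
next
  case (Suc k)
  obtain C where C: "\<And>n. real (Suc n) ^ k * norm (fc (int n) (Ff d (vf d 1 0 1 \<phi>))) \<le> C"
    using Suc.IH[OF vf_I_space[OF Suc.prems]] by blast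
  have "real (Suc n) ^ Suc k * norm (fc (int n) (Ff d \<phi>)) \<le> C" for n
  proof -
    have "norm (2 * of_int (int n) + of_nat d + 1 :: complex) = real (2 * n + d + 1)"
    proof -
      have "2 * of_int (int n) + of_nat d + 1 = complex_of_nat (2 * n + d + 1)" by simp
      then show ?thesis by (simp only: norm_of_nat)
    qed
    then have "norm (fc (int n) (Ff d (vf d 1 0 1 \<phi>))) = real (2 * n + d + 1) * norm (fc (int n) (Ff d \<phi>))"
      by (simp only: fc_vf[OF Suc.prems] norm_mult norm_ii mult_1)
    moreover have "real (Suc n) * norm (fc (int n) (Ff d \<phi>)) \<le> real (2 * n + d + 1) * norm (fc (int n) (Ff d \<phi>))"
      by (intro mult_right_mono) auto
    ultimately have "real (Suc n) ^ k * (real (Suc n) * norm (fc (int n) (Ff d \<phi>))) \<le> C"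
      by (intro order_trans[OF mult_left_mono C[of n]]) auto
    then show ?thesis by (simp only: power_Suc ac_simps)
  qed
  then show ?case by blast
qed

text \<open>Absolute summability of \<open>a\<close> permits termwise integration, and
  orthonormality of the powers of w leaves one term.\<close>

lemma fc_psum:
  assumes a: "rapid a"
  shows "fc n (\<lambda>x. psum a (cay x)) = (if n < 0 then 0 else a (nat n))"
proof -
  let ?f = "\<lambda>i x. a i * (cay x powi int i * cay x powi - n)"
  have eq: "psum a (cay x) * cay x powi - n = (\<Sum>i. ?f i x)" for x
    using sums_mult2[OF psum_sums[OF a, of "cay x"], of "cay x powi - n"]
    by (simp add: sums_iff mult.assoc)
  have s: "summable (\<lambda>i. norm (a i))" using rapid_summable[OF a, of 0] by simp
  have nf: "norm (?f i x) = norm (a i)" for i x by (simp only: norm_mult norm_cay_powi mult_1_right)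
  have int: "integrable circ (?f i)" for i
    by (intro bmeas_integrable bmeas_mult bmeas_cay_powi bmeas_const)
  have "fc n (\<lambda>x. psum a (cay x)) = integral\<^sup>L circ (\<lambda>x. \<Sum>i. ?f i x)"
    by (simp only: fc_def eq)
  also have "\<dots> = (\<Sum>i. integral\<^sup>L circ (?f i))"
    by (rule integral_suminf[OF int]) (simp_all only: nf s AE_I2, simp add: s)
  also have "\<dots> = (\<Sum>i. if i = nat n \<and> 0 \<le> n then a i else 0)"
  proof (rule arg_cong[of _ _ suminf], rule ext)
    fix i
    have "integral\<^sup>L circ (?f i) = a i * fc n (\<lambda>x. cay x powi int i)"
      unfolding fc_def by (rule integral_mult_right_zero)
    also have "fc n (\<lambda>x. cay x powi int i) = (if n = int i then 1 else 0)" by (rule fc_cay_powi)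
    finally show "integral\<^sup>L circ (?f i) = (if i = nat n \<and> 0 \<le> n then a i else 0)"
      by (simp only:) auto
  qed
  also have "\<dots> = (if n < 0 then 0 else a (nat n))"
  proof (cases "n < 0")
    case False
    then show ?thesis using sums_unique[OF sums_single[of "nat n" a]] by simp
  qed simp
  finally show ?thesis .
qed

text \<open>One inclusion reads off the coefficients of a power series. For the other, the Fourier
  coefficients of \<open>Ff d \<phi>\<close> form the sequence and pointwise inversion recovers the
  function.\<close>

theorem Hardy_eq: "Hardy d = {\<phi> \<in> I_space d. \<forall>n<0. fc n (Ff d \<phi>) = 0}"
proof (intro equalityI subsetI)
  fix \<phi> assume "\<phi> \<in> Hardy d"
  then obtain a where a: "rapid a" "\<phi> = Hf d a" by (auto simp: Hardy_def)
  have "Ff d \<phi> = (\<lambda>x. psum a (cay x))" by (simp add: fun_eq_iff a Ff_Hf)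
  then show "\<phi> \<in> {\<phi> \<in> I_space d. \<forall>n<0. fc n (Ff d \<phi>) = 0}"
    using a by (simp add: fc_psum Hf_I_space)
next
  fix \<phi> assume "\<phi> \<in> {\<phi> \<in> I_space d. \<forall>n<0. fc n (Ff d \<phi>) = 0}"
  then have \<phi>: "\<phi> \<in> I_space d" and neg: "\<And>n. n < 0 \<Longrightarrow> fc n (Ff d \<phi>) = 0" by auto
  define a where "a n = fc (int n) (Ff d \<phi>)" for n
  have a: "rapid a" unfolding a_def by (intro rapidI_bounded fc_rapid \<phi>)
  note D = Ff_derivative[OF \<phi>]
  obtain C where C: "\<And>x. norm (Ff d \<phi> x) \<le> C" using bmeas_Ff[OF \<phi>] by (auto simp: bmeas_def)
  let ?F' = "\<lambda>x. (of_nat d + 1) * (of_real x + \<i>) ^ d * \<phi> x + (of_real x + \<i>) ^ Suc d * vector_derivative \<phi> (at x)"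
  obtain C' where C': "\<And>x. norm (of_real (1 + x\<^sup>2) * ?F' x) \<le> C'" using D(4) by blast
  \<comment> \<open>Inversion wants a bound on the derivative itself; as 1 + x^2 >= 1, the weighted
    bound gives it.\<close>
  have bF': "norm (?F' x) \<le> C'" for x
  proof -
    have "norm (?F' x) \<le> (1 + x\<^sup>2) * norm (?F' x)"
      by (simp add: distrib_right)
    also have "\<dots> = norm (of_real (1 + x\<^sup>2) * ?F' x)"
      unfolding norm_mult norm_of_real by (simp only: abs_of_pos[OF one_plus_square_pos])
    finally show ?thesis using C'[of x] by linarith
  qed
  have "\<phi> x = Hf d a x" for x
  proof -
    have "(\<lambda>n. fc (int n) (Ff d \<phi>) * cay x ^ n) sums Ff d \<phi> x"
      by (rule fourier_inversion[OF D(1) C bF' neg])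
    then have "psum a (cay x) = Ff d \<phi> x" by (simp add: psum_def a_def sums_iff)
    then show ?thesis by (simp add: Hf_def Ff_def del: power_Suc)
  qed
  then show "\<phi> \<in> Hardy d" unfolding Hardy_def using a by (auto simp: fun_eq_iff image_iff)
qed

section \<open>Open and closed sets of the Frechet topology\<close>

lemma I_seminorm_zero: "D \<in> U_ops d \<Longrightarrow> \<phi> \<in> I_space d \<Longrightarrow> I_seminorm d D (\<lambda>x. \<phi> x - \<phi> x) = 0"
  by (subst I_seminorm_eq) (simp_all only: U_ops_diff U_ops_I_space I_space_diff, simp add: Ff_def l2_def)

lemma openin_I_ball:
  assumes "\<phi> \<in> I_space d" "D \<in> U_ops d" "\<epsilon> > 0"
  shows "openin (I_topology d) {\<psi> \<in> I_space d. I_seminorm d D (\<lambda>x. \<psi> x - \<phi> x) < \<epsilon>}"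
  unfolding I_topology_def using assms by (intro topology_generated_by_Basis) blast

lemma topspace_I_topology: "topspace (I_topology d) = I_space d"
proof
  show "topspace (I_topology d) \<subseteq> I_space d"
    unfolding I_topology_def topology_generated_by_topspace by blast
  show "I_space d \<subseteq> topspace (I_topology d)"
  proof
    fix \<phi> assume "\<phi> \<in> I_space d"
    moreover from this have "\<phi> \<in> {\<psi> \<in> I_space d. I_seminorm d (\<lambda>\<phi>. \<phi>) (\<lambda>x. \<psi> x - \<phi> x) < 1}"
      using I_seminorm_zero[OF U_ops.one] by simp
    ultimately show "\<phi> \<in> topspace (I_topology d)"
      using openin_subset[OF openin_I_ball[OF _ U_ops.one, of \<phi> d 1]] by auto
  qed
qed

lemma closedin_Hardy: "closedin (I_topology d) (Hardy d)"
proof -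
  have "openin (I_topology d) (I_space d - Hardy d)"
  proof (subst openin_subopen, intro ballI)
    fix \<phi> assume "\<phi> \<in> I_space d - Hardy d"
    then have \<phi>: "\<phi> \<in> I_space d" and "\<exists>n<0. fc n (Ff d \<phi>) \<noteq> 0" by (auto simp: Hardy_eq)
    then obtain n where n: "n < 0" "fc n (Ff d \<phi>) \<noteq> 0" by blast
    \<comment> \<open>On a ball of this radius the n-th coefficient moves by less than its modulus
      and stays nonzero; sqrt pi is the factor in \<open>I_seminorm_eq\<close>.\<close>
    define e where "e = sqrt pi * norm (fc n (Ff d \<phi>))"
    have e: "e > 0" using n by (simp add: e_def)
    let ?B = "{\<psi> \<in> I_space d. I_seminorm d (\<lambda>\<phi>. \<phi>) (\<lambda>x. \<psi> x - \<phi> x) < e}"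
    have "\<psi> \<notin> Hardy d" if \<psi>: "\<psi> \<in> ?B" for \<psi>
    proof
      assume "\<psi> \<in> Hardy d"
      then have 0: "fc n (Ff d \<psi>) = 0" using n by (auto simp: Hardy_eq)
      have I: "\<psi> \<in> I_space d" "(\<lambda>x. \<psi> x - \<phi> x) \<in> I_space d" using \<psi> \<phi> by (auto intro: I_space_diff)
      have "fc n (\<lambda>x. Ff d \<psi> x - Ff d \<phi> x) = - fc n (Ff d \<phi>)"
        using fc_diff[OF bmeas_Ff bmeas_Ff, OF I(1) \<phi>, of n] 0 by simp
      moreover have "(\<lambda>x. Ff d \<psi> x - Ff d \<phi> x) = Ff d (\<lambda>x. \<psi> x - \<phi> x)"
        by (simp add: Ff_def fun_eq_iff algebra_simps)
      ultimately have "norm (fc n (Ff d \<phi>)) \<le> l2 (Ff d (\<lambda>x. \<psi> x - \<phi> x))"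
        using fc_le_l2[OF bmeas_Ff[OF I(2)], of n] by simp
      then have "e \<le> I_seminorm d (\<lambda>\<phi>. \<phi>) (\<lambda>x. \<psi> x - \<phi> x)"
        by (simp add: e_def I_seminorm_eq I(2))
      then show False using \<psi> by simp
    qed
    then show "\<exists>T. openin (I_topology d) T \<and> \<phi> \<in> T \<and> T \<subseteq> I_space d - Hardy d"
      using openin_I_ball[OF \<phi> U_ops.one e] \<phi> e I_seminorm_zero[OF U_ops.one \<phi>]
      by (intro exI[of _ ?B]) auto
  qed
  then show ?thesis by (simp add: closedin_def topspace_I_topology Hardy_eq)
qed

text \<open>By induction over the generation of the topology, the sequence is eventually inside each
  open set around its limit. A subbasic ball may have another centre, which the triangle inequality
  accounts for.\<close>

lemma closedin_I_sequentially:
  assumes C: "closedin (I_topology d) C" and f: "\<And>k. f k \<in> C" and \<phi>: "\<phi> \<in> I_space d"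
    and lim: "\<And>D. D \<in> U_ops d \<Longrightarrow> (\<lambda>k::nat. I_seminorm d D (\<lambda>x. f k x - \<phi> x)) \<longlonglongrightarrow> 0"
  shows "\<phi> \<in> C"
proof (rule ccontr)
  assume "\<phi> \<notin> C"
  have fI: "f k \<in> I_space d" for k
    using f closedin_subset[OF C] by (auto simp: topspace_I_topology)
  have "openin (I_topology d) (I_space d - C)"
    using C by (simp add: closedin_def topspace_I_topology)
  then have "generate_topology_on {{\<psi> \<in> I_space d. I_seminorm d D (\<lambda>x. \<psi> x - \<phi> x) < \<epsilon>} | \<phi> D \<epsilon>.
        \<phi> \<in> I_space d \<and> D \<in> U_ops d \<and> \<epsilon> > 0} (I_space d - C)"
    by (simp add: I_topology_def openin_topology_generated_by_iff)
  then have "\<phi> \<in> I_space d - C \<longrightarrow> (\<forall>\<^sub>F k in sequentially. f k \<in> I_space d - C)"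
  proof induction
    case (Int a b)
    then show ?case by (auto intro: eventually_conj)
  next
    case (UN K)
    then show ?case by (force elim: eventually_mono)
  next
    case (Basis s)
    then obtain \<eta> D \<epsilon> where s: "s = {\<psi> \<in> I_space d. I_seminorm d D (\<lambda>x. \<psi> x - \<eta> x) < \<epsilon>}"
      and *: "\<eta> \<in> I_space d" "D \<in> U_ops d" by blast
    show ?case
    proof
      assume "\<phi> \<in> s"
      then have "0 < \<epsilon> - I_seminorm d D (\<lambda>x. \<phi> x - \<eta> x)" by (simp add: s)
      from order_tendstoD(2)[OF lim[OF *(2)] this]
      show "\<forall>\<^sub>F k in sequentially. f k \<in> s"
      proof eventually_elim
        case (elim k)
        then show ?case using I_seminorm_triangle[OF *(2) fI \<phi> *(1), of k] fI[of k] by (simp add: s)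
      qed
    qed
  qed simp
  with \<open>\<phi> \<notin> C\<close> \<phi> have "\<forall>\<^sub>F k in sequentially. f k \<in> I_space d - C" by simp
  then show False using f by (simp add: eventually_False_sequentially)
qed

section \<open>Laguerre functions\<close>

lemma powser_unique:
  fixes a b :: "nat \<Rightarrow> complex"
  assumes "\<And>w. norm w < 1 \<Longrightarrow> (\<lambda>n. a n * w ^ n) sums f w" "\<And>w. norm w < 1 \<Longrightarrow> (\<lambda>n. b n * w ^ n) sums f w"
  shows "a = b"
proof -
  have ev: "\<forall>\<^sub>F w in nhds (0::complex). norm w < 1"
    using eventually_nhds_ball[of 1 "0::complex"] by simp
  have "f has_fps_expansion Abs_fps a" "f has_fps_expansion Abs_fps b"
    by (intro has_fps_expansionI eventually_mono[OF ev], simp add: assms)+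
  from fps_expansion_unique_complex[OF this] show ?thesis by (simp add: Abs_fps_inject)
qed

lemma powser_coeff_bound:
  fixes a :: "nat \<Rightarrow> complex"
  assumes f: "\<And>w. norm w < 1 \<Longrightarrow> (\<lambda>n. a n * w ^ n) sums f w"
    and r: "0 < r" "r < 1" and B: "\<And>w. norm w = r \<Longrightarrow> norm (f w) \<le> B"
  shows "norm (a n) \<le> B / r ^ n"
proof -
  have ev: "\<forall>\<^sub>F w in nhds (0::complex). norm w < 1"
    using eventually_nhds_ball[of 1 "0::complex"] by simp
  have "f has_fps_expansion Abs_fps a"
    by (intro has_fps_expansionI eventually_mono[OF ev]) (simp add: f)
  then have a: "a n = (deriv ^^ n) f 0 / fact n" using fps_nth_fps_expansion by fastforce
  have hol: "f holomorphic_on ball 0 1"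
    by (rule power_series_holomorphic[where a=a]) (simp add: f)
  have "norm ((deriv ^^ n) f 0) \<le> fact n * B / r ^ n"
    using r by (intro Cauchy_inequality holomorphic_on_subset[OF hol] holomorphic_on_imp_continuous_on B) auto
  then have "norm ((deriv ^^ n) f 0) / fact n \<le> fact n * B / r ^ n / fact n"
    by (rule divide_right_mono) simp
  then show ?thesis unfolding a by (simp add: norm_divide)
qed

text \<open>The binomial series for the exponent -(m+1); the signs of the generalised binomial
  coefficient and of (-w)^n cancel.\<close>

lemma negative_binomial_series:
  fixes w :: complex
  assumes "norm w < 1"
  shows "(\<lambda>n. of_nat ((n + m) choose m) * w ^ n) sums (1 / (1 - w) ^ Suc m)"
proof -
  have w: "1 - w \<noteq> 0" using assms by auto
  have "(\<lambda>n. (- of_nat (Suc m) gchoose n) * (- w) ^ n) sums (1 + - w) powr (- of_nat (Suc m))"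
    using assms by (intro gen_binomial_complex) simp
  moreover have "(- of_nat (Suc m) gchoose n) * (- w) ^ n = of_nat ((n + m) choose m) * w ^ n" for n
  proof -
    have "(of_nat (Suc m) + of_nat n - 1 :: complex) = of_nat (n + m)" by simp
    then have "(- of_nat (Suc m) gchoose n :: complex) = (-1) ^ n * of_nat ((n + m) choose n)"
      unfolding gbinomial_minus by (simp only: binomial_gbinomial)
    moreover have "(n + m) choose n = (n + m) choose m"
      using binomial_symmetric[of n "n + m"] by simp
    moreover have "(-1) ^ n * (- w) ^ n = w ^ n" by (simp flip: power_mult_distrib)
    ultimately show ?thesis by (metis mult.assoc mult.commute)
  qed
  moreover have "(1 + - w) powr (- of_nat (Suc m)) = 1 / (1 - w) ^ Suc m"
    using w by (simp add: powr_minus powr_nat' divide_inverse del: of_nat_Suc power_Suc)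
  ultimately show ?thesis by simp
qed

lemma shifted_binomial_series:
  fixes w :: complex
  assumes "norm w < 1"
  shows "(\<lambda>n. of_nat ((n + d) choose (d + k)) * w ^ n) sums (w ^ k / (1 - w) ^ Suc (d + k))"
proof -
  let ?f = "\<lambda>n. of_nat ((n + d) choose (d + k)) * w ^ n"
  have "(\<lambda>n. w ^ k * (of_nat ((n + (d + k)) choose (d + k)) * w ^ n)) sums (w ^ k * (1 / (1 - w) ^ Suc (d + k)))"
    by (intro sums_mult negative_binomial_series assms)
  moreover have "w ^ k * (of_nat ((n + (d + k)) choose (d + k)) * w ^ n) = ?f (n + k)" for n
    by (simp add: power_add ac_simps)
  ultimately have "(\<lambda>n. ?f (n + k)) sums (w ^ k / (1 - w) ^ Suc (d + k))" by simp
  then have "?f sums (w ^ k / (1 - w) ^ Suc (d + k) + (\<Sum>i<k. ?f i))" by (rule sums_iff_shift[THEN iffD1])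
  \<comment> \<open>For i < k the lower index d + k exceeds i + d, so these terms vanish.\<close>
  moreover have "(\<Sum>i<k. ?f i) = 0" by (intro sum.neutral) auto
  ultimately show ?thesis by (simp only: add_0_right)
qed

section \<open>Laguerre polynomials and their differential equation\<close>

text \<open>For k > n the binomial coefficient is 0, so this is the coefficient of x^k for every k
  and not only up to the degree.\<close>

definition lagc :: "nat \<Rightarrow> nat \<Rightarrow> nat \<Rightarrow> real" where
  "lagc d n k = (-1) ^ k / fact k * real ((n + d) choose (d + k))"

definition lpoly :: "nat \<Rightarrow> nat \<Rightarrow> real poly" where
  "lpoly d n = (\<Sum>k\<le>n. monom (lagc d n k) k)"

text \<open>\<open>lpoly d n\<close> is the generalised Laguerre polynomial \<open>L\<^sub>n\<^sup>(\<^sup>d\<^sup>)\<close>.\<close>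

definition lag :: "nat \<Rightarrow> nat \<Rightarrow> real \<Rightarrow> real" where
  "lag d n y = exp (- y) * poly (lpoly d n) (2 * y)"

lemma coeff_lpoly: "coeff (lpoly d n) k = lagc d n k"
  by (auto simp: lpoly_def coeff_sum lagc_def)

lemma poly_lpoly: "poly (lpoly d n) x = (\<Sum>k\<le>n. lagc d n k * x ^ k)"
  by (simp add: lpoly_def poly_sum poly_monom)

lemma lagc_Suc: "real (Suc k) * lagc d n (Suc k) = - ((-1) ^ k / fact k * real ((n + d) choose Suc (d + k)))"
proof -
  have "real (Suc k) * (- a / (real (Suc k) * fact k) * b) = - (a / fact k * b)" for a b
    by (simp del: of_nat_Suc)
  then show ?thesis unfolding lagc_def fact_Suc power_Suc by simp
qed

text \<open>By the hockey-stick identity. This form keeps the parameter d, so derivatives of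
  Laguerre functions are combinations of those of index at most n with the same d.\<close>

lemma pderiv_lpoly: "pderiv (lpoly d n) = - (\<Sum>j<n. lpoly d j)"
proof (rule poly_eqI)
  fix k
  have hockey: "(\<Sum>j<n. (j + d) choose (d + k)) = (n + d) choose Suc (d + k)"
    by (induction n) (simp_all add: add.commute)
  have "coeff (pderiv (lpoly d n)) k = - ((-1) ^ k / fact k * real ((n + d) choose Suc (d + k)))"
    by (simp only: coeff_pderiv coeff_lpoly lagc_Suc)
  also have "\<dots> = coeff (- (\<Sum>j<n. lpoly d j)) k"
    unfolding hockey[symmetric] by (simp add: coeff_sum coeff_lpoly lagc_def sum_distrib_left)
  finally show "coeff (pderiv (lpoly d n)) k = coeff (- (\<Sum>j<n. lpoly d j)) k" .
qed

text \<open>Laguerre's equation x L'' + (d + 1 - x) L' + n L = 0. On coefficients it is a two-term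
  recursion, an instance of the absorption identities for binomial coefficients.\<close>

lemma lpoly_ode:
  "pCons 0 (pderiv (pderiv (lpoly d n))) + smult (real d + 1) (pderiv (lpoly d n))
    - pCons 0 (pderiv (lpoly d n)) + smult (real n) (lpoly d n) = 0"
proof (rule poly_eqI)
  fix k
  have abs: "real (d + k + 1) * real ((n + d) choose (d + k + 1)) = (real n - real k) * real ((n + d) choose (d + k))"
  proof (cases "k \<le> n")
    case True
    have "(d + k + 1) * ((n + d) choose (d + k + 1)) = (n - k) * ((n + d) choose (d + k))"
      using binomial_absorption[of "d + k" "n + d"] binomial_absorb_comp[of "n + d" "d + k"] True
      by simp
    then have "real ((d + k + 1) * ((n + d) choose (d + k + 1))) = real ((n - k) * ((n + d) choose (d + k)))"
      by (simp only:)
    then show ?thesis using True by (simp only: of_nat_mult of_nat_diff)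
  qed (simp add: binomial_eq_0)
  have c: "real (k + 1) * lagc d n (k + 1) = - ((-1) ^ k / fact k * real ((n + d) choose (d + k + 1)))"
    using lagc_Suc[of k d n] by (simp only: Suc_eq_plus1 add.assoc)
  have "real (k + 1) * (real d + 1 + real k) * lagc d n (k + 1) = (real k - real n) * lagc d n k"
  proof -
    have "real (k + 1) * (real d + 1 + real k) * lagc d n (k + 1) = (real (k + 1) * lagc d n (k + 1)) * real (d + k + 1)"
      by (simp add: algebra_simps)
    also have "\<dots> = - ((-1) ^ k / fact k * (real (d + k + 1) * real ((n + d) choose (d + k + 1))))"
      unfolding c by (simp only: mult_minus_left ac_simps)
    also have "\<dots> = (real k - real n) * lagc d n k"
      unfolding abs lagc_def by (simp add: algebra_simps diff_divide_distrib)
    finally show ?thesis .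
  qed
  then show "coeff (pCons 0 (pderiv (pderiv (lpoly d n))) + smult (real d + 1) (pderiv (lpoly d n))
    - pCons 0 (pderiv (lpoly d n)) + smult (real n) (lpoly d n)) k = coeff 0 k"
    by (cases k) (simp_all add: coeff_pderiv coeff_lpoly algebra_simps)
qed

text \<open>The k-th derivative of \<open>lag d n\<close>, written through
  \<open>pderiv_lpoly\<close> in terms of smaller indices. In this form a bound on the functions
  passes to all derivatives.\<close>

primrec lagd :: "nat \<Rightarrow> nat \<Rightarrow> nat \<Rightarrow> real \<Rightarrow> real" where
  "lagd d 0 n y = lag d n y"
| "lagd d (Suc k) n y = - lagd d k n y - 2 * (\<Sum>j<n. lagd d k j y)"

lemma DERIV_lag:
  "(lag d n has_real_derivative exp (- y) * (2 * poly (pderiv (lpoly d n)) (2 * y) - poly (lpoly d n) (2 * y))) (at y)"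
  unfolding lag_def[abs_def]
  by (rule derivative_eq_intros poly_DERIV refl | simp)+ (simp add: algebra_simps)

lemma lagd_1: "lagd d (Suc 0) n y = exp (- y) * (2 * poly (pderiv (lpoly d n)) (2 * y) - poly (lpoly d n) (2 * y))"
  by (simp add: lag_def pderiv_lpoly poly_sum sum_distrib_left algebra_simps sum_negf)

lemma DERIV_lagd: "(lagd d k n has_real_derivative lagd d (Suc k) n y) (at y)"
proof (induction k arbitrary: n)
  case 0
  have "lagd d 0 n = lag d n" by (simp add: fun_eq_iff)
  then show ?case using DERIV_lag[of d n y] by (simp only: lagd_1)
next
  case (Suc k)
  have "((\<lambda>y. - lagd d k n y - 2 * (\<Sum>j<n. lagd d k j y)) has_real_derivative
      - lagd d (Suc k) n y - 2 * (\<Sum>j<n. lagd d (Suc k) j y)) (at y)"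
    by (intro DERIV_diff DERIV_minus DERIV_cmult DERIV_sum Suc.IH)
  then show ?case by simp
qed

text \<open>Laguerre's equation rewritten for e^(-y) L(2y): an eigenfunction of y D^2 + (d+1) D - y
  with eigenvalue -(2n + d + 1). The decay of Laguerre coefficients rests on this.\<close>

lemma lagd_ode:
  "y * lagd d 2 n y + (real d + 1) * lagd d 1 n y - y * lag d n y = - (2 * real n + real d + 1) * lag d n y"
proof -
  define L L' L'' where "L = poly (lpoly d n) (2 * y)" and "L' = poly (pderiv (lpoly d n)) (2 * y)"
    and "L'' = poly (pderiv (pderiv (lpoly d n))) (2 * y)"
  have 1: "lagd d 1 n = (\<lambda>y. exp (- y) * (2 * poly (pderiv (lpoly d n)) (2 * y) - poly (lpoly d n) (2 * y)))"
    by (rule ext) (simp only: One_nat_def lagd_1)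
  have "(lagd d 1 n has_real_derivative exp (- y) * (4 * L'' - 4 * L' + L)) (at y)"
    unfolding 1 L_def L'_def L''_def
    by (rule derivative_eq_intros poly_DERIV refl | simp)+ (simp add: algebra_simps)
  from DERIV_unique[OF DERIV_lagd[of d 1 n y] this]
  have 2: "lagd d 2 n y = exp (- y) * (4 * L'' - 4 * L' + L)" by (simp add: numeral_2_eq_2)
  have 3: "2 * y * L'' + (real d + 1) * L' - 2 * y * L' + real n * L = 0"
    using arg_cong[OF lpoly_ode[of d n], of "\<lambda>p. poly p (2 * y)"]
    by (simp add: L_def L'_def L''_def)
  have "y * lagd d 2 n y + (real d + 1) * lagd d 1 n y - y * lag d n y + (2 * real n + real d + 1) * lag d n y
     = 2 * exp (- y) * (2 * y * L'' + (real d + 1) * L' - 2 * y * L' + real n * L)"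
    unfolding 2 unfolding 1 lag_def L_def[symmetric] L'_def[symmetric] by (simp add: algebra_simps)
  then show ?thesis unfolding 3 by (simp only: mult_minus_left eq_neg_iff_add_eq_0 mult_zero_right)
qed

section \<open>The generating function and bounds on Laguerre functions\<close>

definition lagG :: "nat \<Rightarrow> real \<Rightarrow> complex \<Rightarrow> complex" where
  "lagG d y w = exp (- of_real y * ((1 + w) / (1 - w))) / (1 - w) ^ Suc d"

text \<open>The factor exp(-2 y w / (1 - w)) is expanded in powers of w / (1 - w), and each of these
  by a binomial series. The double series converges absolutely, so it may be summed over k first,
  which produces the Laguerre function.\<close>

lemma lag_generating_function:
  assumes w: "norm w < 1"
  shows "(\<lambda>n. of_real (lag d n y) * w ^ n) sums lagG d y w"
proof -
  define r where "r = norm w"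
  have r: "0 \<le> r" "r < 1" using w by (simp_all add: r_def)
  have w1: "1 - w \<noteq> 0" using w by auto
  define c where "c k = exp (- y) * ((- 2 * y) ^ k / fact k)" for k
  define f where "f = (\<lambda>(k, n). of_real (c k) * (of_nat ((n + d) choose (d + k)) * w ^ n))"
  have nf: "norm (f (k, n)) = \<bar>c k\<bar> * (real ((n + d) choose (d + k)) * r ^ n)" for k n
    by (simp add: f_def norm_mult norm_power r_def)
  have rowr: "(\<lambda>n. real ((n + d) choose (d + k)) * r ^ n) sums (r ^ k / (1 - r) ^ Suc (d + k))" for k
  proof -
    have "(\<lambda>n. of_nat ((n + d) choose (d + k)) * complex_of_real r ^ n) sums (of_real r ^ k / (1 - of_real r) ^ Suc (d + k))"
      by (rule shifted_binomial_series) (use r in simp)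
    then have "(\<lambda>n. complex_of_real (real ((n + d) choose (d + k)) * r ^ n)) sums complex_of_real (r ^ k / (1 - r) ^ Suc (d + k))"
      by simp
    then show ?thesis by (simp only: sums_of_real_iff)
  qed
  have rown: "(\<lambda>n. norm (f (k, n))) sums (\<bar>c k\<bar> * (r ^ k / (1 - r) ^ Suc (d + k)))" for k
    unfolding nf by (intro sums_mult rowr)
  have rowhs: "((\<lambda>n. norm (f (k, n))) has_sum (\<bar>c k\<bar> * (r ^ k / (1 - r) ^ Suc (d + k)))) UNIV" for k
    using rown[of k] by (intro norm_summable_imp_has_sum) (auto simp: sums_iff)
  have crow: "((\<lambda>n. f (k, n)) has_sum (of_real (c k) * (w ^ k / (1 - w) ^ Suc (d + k)))) UNIV" for k
    unfolding f_def case_prod_conv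
    by (rule norm_summable_imp_has_sum)
       (use rown[of k] in \<open>simp add: sums_iff f_def\<close>, intro sums_mult shifted_binomial_series w)
  have expc: "\<bar>c k\<bar> * (r ^ k / (1 - r) ^ Suc (d + k)) = exp (- y) / (1 - r) ^ Suc d * ((\<bar>2 * y\<bar> * (r / (1 - r))) ^ k /\<^sub>R fact k)" for k
  proof -
    have wk: "r ^ k / (1 - r) ^ Suc (d + k) = (r / (1 - r)) ^ k / (1 - r) ^ Suc d"
      by (simp add: power_divide power_add)
    show ?thesis unfolding wk power_mult_distrib
      by (simp add: c_def abs_mult power_abs divide_inverse)
  qed
  have "summable (\<lambda>k. \<bar>c k\<bar> * (r ^ k / (1 - r) ^ Suc (d + k)))"
    unfolding expc by (intro summable_mult summable_exp_generic)
  then have "(\<lambda>k. \<bar>c k\<bar> * (r ^ k / (1 - r) ^ Suc (d + k))) summable_on UNIV"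
    using r by (intro norm_summable_imp_summable_on) (simp add: abs_mult)
  then have "(\<lambda>x. norm (f x)) summable_on (UNIV \<times> UNIV)"
    by (intro summable_on_SigmaI[where g="\<lambda>k. \<bar>c k\<bar> * (r ^ k / (1 - r) ^ Suc (d + k))"] rowhs) auto
  then have fs: "f summable_on (UNIV \<times> UNIV)" by (rule abs_summable_summable)
  then obtain S where S: "(f has_sum S) (UNIV \<times> UNIV)" by (auto simp: summable_on_def)
  have "((\<lambda>k. of_real (c k) * (w ^ k / (1 - w) ^ Suc (d + k))) has_sum S) UNIV"
    by (rule has_sum_SigmaD[OF S]) (rule crow)
  then have S1: "(\<lambda>k. of_real (c k) * (w ^ k / (1 - w) ^ Suc (d + k))) sums S"
    by (rule has_sum_imp_sums)
  have expw: "of_real (c k) * (w ^ k / (1 - w) ^ Suc (d + k))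
      = of_real (exp (- y)) / (1 - w) ^ Suc d * ((of_real (- 2 * y) * (w / (1 - w))) ^ k /\<^sub>R fact k)" for k
  proof -
    have wk: "w ^ k / (1 - w) ^ Suc (d + k) = (w / (1 - w)) ^ k / (1 - w) ^ Suc d"
      by (simp add: power_divide power_add)
    show ?thesis unfolding wk power_mult_distrib
      by (simp add: c_def scaleR_conv_of_real divide_inverse)
  qed
  have "(\<lambda>k. of_real (c k) * (w ^ k / (1 - w) ^ Suc (d + k))) sums
      (of_real (exp (- y)) / (1 - w) ^ Suc d * exp (of_real (- 2 * y) * (w / (1 - w))))"
    unfolding expw by (intro sums_mult exp_converges)
  with S1 have "S = of_real (exp (- y)) / (1 - w) ^ Suc d * exp (of_real (- 2 * y) * (w / (1 - w)))"
    by (rule sums_unique2)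
  also have "\<dots> = lagG d y w"
  proof -
    \<comment> \<open>This splits the factor e^(-y) off the exponential.\<close>
    have "(1 + w) / (1 - w) = 1 + 2 * (w / (1 - w))" using w1 by (simp add: field_simps)
    then have "- of_real y * ((1 + w) / (1 - w)) = of_real (- y) + of_real (- 2 * y) * (w / (1 - w))"
      by (simp only:) (simp add: algebra_simps)
    then show ?thesis unfolding lagG_def by (simp only: exp_add exp_of_real) simp
  qed
  finally have S2: "S = lagG d y w" .
  have S3: "((\<lambda>(n, k). f (k, n)) has_sum S) (UNIV \<times> UNIV)"
    using S by (subst (asm) has_sum_swap)
  have cs: "((\<lambda>k. f (k, n)) has_sum (of_real (lag d n y) * w ^ n)) UNIV" for n
  proof -
    have "((\<lambda>k. f (k, n)) has_sum (\<Sum>k\<le>n. f (k, n))) {..n}"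
      by (rule has_sum_finite) simp
    moreover have "(\<Sum>k\<le>n. f (k, n)) = of_real (lag d n y) * w ^ n"
    proof -
      have ck: "c k = exp (- y) * ((-1) ^ k / fact k * (2 * y) ^ k)" for k
        using power_minus[of "2 * y" k] by (simp add: c_def)
      have "f (k, n) = of_real (exp (- y) * (lagc d n k * (2 * y) ^ k)) * w ^ n" for k
        by (simp add: f_def ck lagc_def)
      then show ?thesis
        by (simp only: lag_def poly_lpoly sum_distrib_left of_real_sum sum_distrib_right)
    qed
    ultimately have "((\<lambda>k. f (k, n)) has_sum (of_real (lag d n y) * w ^ n)) {..n}" by simp
    then show ?thesis
      by (rule iffD1[OF has_sum_cong_neutral, rotated 3]) (auto simp: f_def)
  qed
  have "((\<lambda>n. of_real (lag d n y) * w ^ n) has_sum S) UNIV"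
    by (rule has_sum_SigmaD[OF S3]) (simp add: cs)
  then show ?thesis unfolding S2 by (rule has_sum_imp_sums)
qed

text \<open>The real part of (1 + w)/(1 - w) is the Poisson kernel (1 - |w|^2) / |1 - w|^2,
  nonnegative in the closed disc away from 1.\<close>

lemma norm_lagG_le:
  assumes y: "0 \<le> y" and w: "norm w \<le> 1" "w \<noteq> 1"
  shows "norm (lagG d y w) \<le> exp (- y * ((1 - (norm w)\<^sup>2) / (norm (1 - w))\<^sup>2)) / norm (1 - w) ^ Suc d"
proof -
  have "Re ((1 + w) / (1 - w)) = (1 - (norm w)\<^sup>2) / (norm (1 - w))\<^sup>2"
    by (simp add: Re_divide cmod_power2) (simp add: power2_eq_square algebra_simps)
  then have "norm (exp (- complex_of_real y * ((1 + w) / (1 - w)))) = exp (- y * ((1 - (norm w)\<^sup>2) / (norm (1 - w))\<^sup>2))"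
  proof -
    have "Re (- complex_of_real y * z) = - y * Re z" for z by simp
    then show ?thesis
      unfolding norm_exp_eq_Re \<open>Re ((1 + w) / (1 - w)) = (1 - (norm w)\<^sup>2) / (norm (1 - w))\<^sup>2\<close>[symmetric]
      by (simp only:)
  qed
  then show ?thesis by (simp add: lagG_def norm_divide norm_power del: power_Suc)
qed

text \<open>Cauchy's estimate for the generating function on the circle of radius r = 1 - 1/(n+2).
  There r^(-n) is at most e, hence the 3, and the Poisson kernel is at least (1 - r)/2, which leaves
  exponential decay in y at rate 1/(2(n+2)).\<close>

lemma lag_bound:
  assumes y: "0 \<le> y"
  shows "\<bar>lag d n y\<bar> \<le> 3 * real (n + 2) ^ Suc d * exp (- y / (2 * real (n + 2)))"
proof -
  define r where "r = real (n + 1) / real (n + 2)"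
  have r: "0 < r" "r < 1" by (simp_all add: r_def)
  have r1: "1 - r = 1 / real (n + 2)" by (simp add: r_def field_simps)
  define B where "B = exp (- y * ((1 - r) / 2)) / (1 - r) ^ Suc d"
  have "norm (complex_of_real (lag d n y)) \<le> B / r ^ n"
  proof (rule powser_coeff_bound[OF lag_generating_function r])
    fix w :: complex assume wr: "norm w = r"
    have w1: "w \<noteq> 1" using wr r by auto
    have lo: "1 - r \<le> norm (1 - w)" using norm_triangle_ineq2[of 1 w] wr by simp
    have up: "norm (1 - w) \<le> 1 + r" using norm_triangle_ineq4[of 1 w] wr by simp
    have "(1 - r) / 2 \<le> (1 - r\<^sup>2) / (norm (1 - w))\<^sup>2"
    proof -
      have "(1 - r) / 2 * (norm (1 - w))\<^sup>2 \<le> (1 - r) / 2 * (1 + r)\<^sup>2"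
        using up r by (intro mult_left_mono power_mono) auto
      also have "\<dots> = (1 - r\<^sup>2) * ((1 + r) / 2)" by (simp add: power2_eq_square field_simps)
      also have "\<dots> \<le> (1 - r\<^sup>2) * 1"
        using r by (intro mult_left_mono) (auto simp: power_le_one)
      finally show ?thesis using w1 by (simp add: pos_le_divide_eq)
    qed
    then have "exp (- y * ((1 - r\<^sup>2) / (norm (1 - w))\<^sup>2)) \<le> exp (- y * ((1 - r) / 2))"
      unfolding exp_le_cancel_iff mult_minus_left neg_le_iff_le by (rule mult_left_mono[OF _ y])
    moreover have "norm (lagG d y w) \<le> exp (- y * ((1 - r\<^sup>2) / (norm (1 - w))\<^sup>2)) / norm (1 - w) ^ Suc d"
      using norm_lagG_le[OF y, of w d] w1 wr r by simp
    ultimately show "norm (lagG d y w) \<le> B"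
      unfolding B_def using lo r
      by (elim order_trans) (intro frac_le power_mono, auto)
  qed
  also have "B / r ^ n = (1 / r) ^ n * real (n + 2) ^ Suc d * exp (- y / (2 * real (n + 2)))"
    unfolding B_def r1 by (simp add: power_divide field_simps)
  also have "\<dots> \<le> 3 * real (n + 2) ^ Suc d * exp (- y / (2 * real (n + 2)))"
  proof (intro mult_right_mono)
    have "1 / r = 1 + 1 / real (n + 1)" by (simp add: r_def field_simps)
    also have "\<dots> \<le> exp (1 / real (n + 1))" by (rule exp_ge_add_one_self)
    finally have "(1 / r) ^ n \<le> exp (1 / real (n + 1)) ^ n" using r by (intro power_mono) auto
    also have "\<dots> = exp (real n / real (n + 1))" by (simp add: exp_of_nat_mult[symmetric])
    also have "\<dots> \<le> exp 1" by simp
    also have "\<dots> \<le> 3" using exp_le by simp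
    finally show "(1 / r) ^ n \<le> 3" .
  qed auto
  finally show ?thesis by simp
qed

text \<open>The bound \<open>b n\<close> for order k increases with n, so one step of the recursion
  for \<open>lagd\<close> costs only the factor 2 n + 1.\<close>

lemma lagd_bound:
  assumes y: "0 \<le> y"
  shows "\<bar>lagd d k n y\<bar> \<le> (2 * real n + 1) ^ k * (3 * real (n + 2) ^ Suc d * exp (- y / (2 * real (n + 2))))"
proof (induction k arbitrary: n)
  case (Suc k)
  define b where "b n = (2 * real n + 1) ^ k * (3 * real (n + 2) ^ Suc d * exp (- y / (2 * real (n + 2))))" for n
  have mono: "b j \<le> b n" if "j < n" for j
    unfolding b_def using that y
    by (intro mult_mono power_mono) (auto intro!: divide_left_mono)
  have "\<bar>lagd d (Suc k) n y\<bar> \<le> \<bar>lagd d k n y\<bar> + 2 * (\<Sum>j<n. \<bar>lagd d k j y\<bar>)"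
    using sum_abs[of "\<lambda>j. lagd d k j y" "{..<n}"] unfolding lagd.simps by linarith
  also have "\<dots> \<le> b n + 2 * (\<Sum>j<n. b n)"
    by (intro add_mono mult_left_mono sum_mono order_trans[OF Suc.IH[folded b_def] mono] Suc.IH[folded b_def]) auto
  also have "\<dots> = (2 * real n + 1) * b n" by (simp add: algebra_simps)
  finally show ?case by (simp only: b_def power_Suc mult.assoc)
qed (use lag_bound[OF y] in simp)

section \<open>Integrals over the half line\<close>

definition hInt :: "(real \<Rightarrow> complex) \<Rightarrow> complex" where
  "hInt f = (LINT y|lborel. indicator {0..} y *\<^sub>R f y)"

text \<open>A class of integrands closed under sums, with integrable majorants, whose members vanish
  at infinity as integration by parts needs.\<close>

definition qd :: "(real \<Rightarrow> complex) \<Rightarrow> bool" where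
  "qd f \<longleftrightarrow> continuous_on {0..} f \<and> (\<exists>C. \<forall>y\<ge>0. (1 + y\<^sup>2) * norm (f y) \<le> C)"

lemma qdI: "continuous_on {0..} f \<Longrightarrow> (\<And>y. 0 \<le> y \<Longrightarrow> (1 + y\<^sup>2) * norm (f y) \<le> C) \<Longrightarrow> qd f"
  unfolding qd_def by blast

lemma hInt_measurable: "continuous_on {0..} f \<Longrightarrow> (\<lambda>y. indicator {0..} y *\<^sub>R f y) \<in> borel_measurable borel" for f :: "real \<Rightarrow> complex"
  by (rule borel_measurable_continuous_on_indicator) auto

lemma hInt_bound:
  assumes f: "continuous_on {0..} f" and C: "\<And>y. 0 \<le> y \<Longrightarrow> (1 + y\<^sup>2) * norm (f y) \<le> C"
  shows "integrable lborel (\<lambda>y. indicator {0..} y *\<^sub>R f y)"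
    and "norm (hInt f) \<le> C * pi"
    and "(LINT y|lborel. norm (indicator {0..} y *\<^sub>R f y)) \<le> C * pi"
proof -
  have C0: "0 \<le> C" using C[of 0] order_trans[OF norm_ge_zero, of "f 0" C] by simp
  \<comment> \<open>The majorant is integrated over the whole line, hence the constant pi.\<close>
  have i: "integrable lborel (\<lambda>y::real. C * (1 / (1 + y\<^sup>2)))"
    by (intro integrable_mult_right integrable_cauchy)
  have le: "norm (indicator {0..} y *\<^sub>R f y) \<le> C * (1 / (1 + y\<^sup>2))" for y
    using C[of y] C0 by (auto simp: indicator_def field_simps)
  show int: "integrable lborel (\<lambda>y. indicator {0..} y *\<^sub>R f y)"
    by (rule Bochner_Integration.integrable_bound[OF i])
       (use hInt_measurable[OF f] le C0 in \<open>auto intro!: AE_I2 order_trans[OF le]\<close>)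
  have "(LINT y|lborel. norm (indicator {0..} y *\<^sub>R f y)) \<le> (LINT y|lborel. C * (1 / (1 + y\<^sup>2)))"
    by (intro integral_mono integrable_norm int i le)
  also have "\<dots> = C * pi" by (simp only: integral_mult_right_zero integral_cauchy)
  finally show "(LINT y|lborel. norm (indicator {0..} y *\<^sub>R f y)) \<le> C * pi" .
  then show "norm (hInt f) \<le> C * pi"
    unfolding hInt_def using integral_norm_bound[of lborel "\<lambda>y. indicator {0..} y *\<^sub>R f y"] by linarith
qed

lemma qd_integrable: "qd f \<Longrightarrow> integrable lborel (\<lambda>y. indicator {0..} y *\<^sub>R f y)"
  unfolding qd_def using hInt_bound(1) by blast

lemma qd_continuous: "qd f \<Longrightarrow> continuous_on {0..} f"
  unfolding qd_def by blast

lemma qd_mult_bounded: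
  assumes f: "qd f" and g: "continuous_on {0..} g" and B: "\<And>y. 0 \<le> y \<Longrightarrow> norm (g y) \<le> B"
  shows "qd (\<lambda>y. f y * g y)"
proof -
  obtain C where C: "\<And>y. 0 \<le> y \<Longrightarrow> (1 + y\<^sup>2) * norm (f y) \<le> C" using f by (auto simp: qd_def)
  show ?thesis
  proof (rule qdI)
    fix y :: real assume y: "0 \<le> y"
    have "(1 + y\<^sup>2) * norm (f y) * norm (g y) \<le> C * B"
      using C[OF y] B[OF y] by (intro mult_mono) (auto intro: order_trans[OF _ C[OF y]])
    then show "(1 + y\<^sup>2) * norm (f y * g y) \<le> C * B" by (simp add: norm_mult mult.assoc)
  qed (intro continuous_intros g qd_continuous f)
qed

lemma qd_cmul: "qd f \<Longrightarrow> qd (\<lambda>y. c * f y)"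
  using qd_mult_bounded[of f "\<lambda>y. c" "norm c"] by (simp add: mult.commute)

lemma qd_add: "qd f \<Longrightarrow> qd g \<Longrightarrow> qd (\<lambda>y. f y + g y)"
proof -
  assume f: "qd f" and g: "qd g"
  then obtain C D where C: "\<And>y. 0 \<le> y \<Longrightarrow> (1 + y\<^sup>2) * norm (f y) \<le> C"
    and D: "\<And>y. 0 \<le> y \<Longrightarrow> (1 + y\<^sup>2) * norm (g y) \<le> D" by (auto simp: qd_def)
  show ?thesis
  proof (rule qdI)
    fix y :: real assume y: "0 \<le> y"
    have "(1 + y\<^sup>2) * norm (f y + g y) \<le> (1 + y\<^sup>2) * (norm (f y) + norm (g y))"
      by (intro mult_left_mono norm_triangle_ineq) (simp add: add_nonneg_nonneg)
    then show "(1 + y\<^sup>2) * norm (f y + g y) \<le> C + D" using C[OF y] D[OF y] by (simp add: distrib_left)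
  qed (intro continuous_intros f g qd_continuous)
qed

lemma hInt_add: "qd f \<Longrightarrow> qd g \<Longrightarrow> hInt (\<lambda>y. f y + g y) = hInt f + hInt g"
  unfolding hInt_def scaleR_add_right by (intro Bochner_Integration.integral_add qd_integrable)

lemma hInt_cmul: "hInt (\<lambda>y. c * f y) = c * hInt f"
  unfolding hInt_def mult_scaleR_right[symmetric] by (rule integral_mult_right_zero)

lemma hInt_cong: "(\<And>y. 0 \<le> y \<Longrightarrow> f y = g y) \<Longrightarrow> hInt f = hInt g"
  unfolding hInt_def by (intro Bochner_Integration.integral_cong) (auto simp: indicator_def)

lemma qd_tendsto: "qd F \<Longrightarrow> (F \<longlongrightarrow> 0) at_top"
proof -
  assume "qd F"
  then obtain C where C: "\<And>y. 0 \<le> y \<Longrightarrow> (1 + y\<^sup>2) * norm (F y) \<le> C" by (auto simp: qd_def)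
  have "((\<lambda>y::real. C * (1 / (1 + y\<^sup>2))) \<longlongrightarrow> C * 0) at_top"
    by (intro tendsto_mult tendsto_const) real_asymp
  moreover have "\<forall>\<^sub>F y in at_top. norm (F y) \<le> C * (1 / (1 + y\<^sup>2))"
    using eventually_ge_at_top[of 0] by eventually_elim (use C in \<open>simp add: field_simps\<close>)
  ultimately show ?thesis by (intro Lim_null_comparison[of F]) simp_all
qed

lemma hInt_FTC:
  assumes F: "qd F" and f: "qd f"
    and D: "\<And>y. 0 \<le> y \<Longrightarrow> (F has_vector_derivative f y) (at y within {0..})"
  shows "hInt f = - F 0"
proof -
  have "((\<lambda>b. LINT y:{0..b}|lborel. f y) \<longlongrightarrow> (LINT y:{0..}|lborel. f y)) at_top"
    by (rule tendsto_set_lebesgue_integral_at_top) (use qd_integrable[OF f] in \<open>auto simp: set_integrable_def\<close>)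
  moreover have *: "(LINT y:{0..b}|lborel. f y) = F b - F 0" if "0 \<le> b" for b
    unfolding set_lebesgue_integral_def using that
    by (intro integral_FTC_Icc has_vector_derivative_within_subset[OF D] continuous_on_subset[OF qd_continuous[OF f]]) auto
  have "\<forall>\<^sub>F b in at_top. (LINT y:{0..b}|lborel. f y) = F b - F 0"
    using eventually_ge_at_top[of 0] by (rule eventually_mono) (rule *)
  ultimately have "((\<lambda>b. F b - F 0) \<longlongrightarrow> hInt f) at_top"
    unfolding hInt_def set_lebesgue_integral_def[symmetric] by (rule Lim_transform_eventually)
  moreover have "((\<lambda>b. F b - F 0) \<longlongrightarrow> 0 - F 0) at_top"
    by (intro tendsto_intros qd_tendsto F)
  ultimately have "hInt f = 0 - F 0" by (rule tendsto_unique[rotated]) simp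
  then show ?thesis by simp
qed

text \<open>A single term of the exponential series of \<open>s * y\<close> is at most its
  sum.\<close>

lemma power_times_exp_le:
  fixes y s :: real
  assumes "0 \<le> y" "0 < s" shows "y ^ k * exp (- s * y) \<le> fact k / s ^ k"
proof -
  have "(s * y) ^ k /\<^sub>R fact k \<le> (\<Sum>n. (s * y) ^ n /\<^sub>R fact n)"
    using sum_le_suminf[OF summable_exp_generic[of "s * y"], of "{k}"] assms by simp
  then have "(s * y) ^ k / fact k \<le> exp (s * y)" by (simp add: exp_def divide_inverse mult.commute)
  then have "s ^ k * y ^ k \<le> exp (s * y) * fact k"
    by (simp add: pos_divide_le_eq power_mult_distrib)
  then show ?thesis using assms by (simp add: exp_minus field_simps)
qed

lemma qd_power_exp:
  assumes "Re s > 0" shows "qd (\<lambda>y. of_real y ^ m * exp (- s * of_real y))"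
proof (rule qdI)
  fix y :: real assume y: "0 \<le> y"
  have "(1 + y\<^sup>2) * norm (of_real y ^ m * exp (- s * of_real y))
     = y ^ m * exp (- Re s * y) + y ^ (m + 2) * exp (- Re s * y)"
    using y by (simp add: norm_mult norm_power norm_exp_eq_Re algebra_simps power_add power2_eq_square)
  also have "\<dots> \<le> fact m / Re s ^ m + fact (m + 2) / Re s ^ (m + 2)"
    by (intro add_mono power_times_exp_le y assms)
  finally show "(1 + y\<^sup>2) * norm (of_real y ^ m * exp (- s * of_real y)) \<le> fact m / Re s ^ m + fact (m + 2) / Re s ^ (m + 2)" .
qed (intro continuous_intros)

lemma of_real_power_has_vector_derivative:
  "((\<lambda>y. complex_of_real y ^ Suc m) has_vector_derivative of_nat (Suc m) * of_real y ^ m) (at y within S)"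
proof -
  have "((\<lambda>z. z ^ Suc m) has_field_derivative of_nat (Suc m) * of_real y ^ m) (at (complex_of_real y))"
    by (auto intro!: derivative_eq_intros simp del: power_Suc)
  from has_vector_derivative_at_within[OF has_vector_derivative_real_field[OF this]] show ?thesis .
qed

text \<open>Integration by parts: s times the integral with exponent m + 1 is m + 1 times the one
  with exponent m, the boundary term at 0 being zero.\<close>

lemma laplace_power:
  assumes s: "Re s > 0"
  shows "hInt (\<lambda>y. of_real y ^ m * exp (- s * of_real y)) = fact m / s ^ Suc m"
proof -
  have s0: "s \<noteq> 0" using s by auto
  have De: "((\<lambda>y. exp (- s * of_real y)) has_vector_derivative - s * exp (- s * of_real y)) (at y within {0..})" for y
  proof -
    have "((\<lambda>z. exp (- s * z)) has_field_derivative - s * exp (- s * of_real y)) (at (of_real y))"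
      by (auto intro!: derivative_eq_intros)
    from has_vector_derivative_real_field[OF this] show ?thesis by (rule has_vector_derivative_at_within)
  qed
  show ?thesis
  proof (induction m)
    case 0
    have "hInt (\<lambda>y. - s * (of_real y ^ 0 * exp (- s * of_real y))) = - (of_real 0 ^ 0 * exp (- s * of_real 0))"
      by (intro hInt_FTC qd_power_exp qd_cmul s) (use De in simp)
    then show ?case using s0 unfolding hInt_cmul by (simp add: field_simps)
  next
    case (Suc m)
    let ?e = "\<lambda>m y. of_real y ^ m * exp (- s * of_real y)"
    have D: "(?e (Suc m) has_vector_derivative (of_nat (Suc m) * ?e m y + - s * ?e (Suc m) y)) (at y within {0..})" for y
    proof -
      from has_vector_derivative_mult[OF of_real_power_has_vector_derivative De[of y]]
      show ?thesis by (rule has_vector_derivative_eq_rhs) (simp add: algebra_simps)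
    qed
    have "hInt (\<lambda>y. of_nat (Suc m) * ?e m y + - s * ?e (Suc m) y) = - ?e (Suc m) 0"
      by (rule hInt_FTC[OF _ _ D]) (intro qd_add qd_cmul qd_power_exp s)+
    then have "of_nat (Suc m) * hInt (?e m) - s * hInt (?e (Suc m)) = 0"
      by (subst (asm) hInt_add) (auto simp only: hInt_cmul intro!: qd_cmul qd_power_exp s, simp)
    then have "s * hInt (?e (Suc m)) = of_nat (Suc m) * (fact m / s ^ Suc m)"
      by (simp only: Suc.IH right_minus_eq)
    then show ?case using s0 by (simp add: field_simps)
  qed
qed

section \<open>Schwartz functions on the half line\<close>

text \<open>The condition on the factor \<open>f1\<close> in \<open>S_space d {0..}\<close>.\<close>

definition schwartz :: "(real \<Rightarrow> complex) \<Rightarrow> bool" where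
  "schwartz f \<longleftrightarrow> smooth_on {0..} f \<and> rapidly_decreasing_on {0..} f"

definition Dh :: "(real \<Rightarrow> complex) \<Rightarrow> real \<Rightarrow> complex" where
  "Dh = nth_deriv_on {0..} 1"

lemma rapidly_decreasing_on_iff:
  "rapidly_decreasing_on S f \<longleftrightarrow> (\<forall>m n. \<exists>C. \<forall>x\<in>S. norm (of_real x ^ m * nth_deriv_on S n f x) \<le> C)"
  by (simp add: rapidly_decreasing_on_def bounded_iff scaleR_conv_of_real)

lemma schwartz_bound:
  "schwartz f \<Longrightarrow> \<exists>C. \<forall>y\<ge>0. norm (of_real y ^ m * nth_deriv_on {0..} n f y) \<le> C"
  unfolding schwartz_def rapidly_decreasing_on_iff Ball_def atLeast_iff by blast

lemma Dh_has_vector_derivative: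
  "schwartz f \<Longrightarrow> 0 \<le> y \<Longrightarrow> (f has_vector_derivative Dh f y) (at y within {0..})"
  using smooth_onD[of "{0..}" f y 0] by (simp add: schwartz_def Dh_def)

lemma schwartz_Dh: "schwartz f \<Longrightarrow> schwartz (Dh f)"
  unfolding schwartz_def rapidly_decreasing_on_iff Dh_def nth_deriv_on_add
  using smooth_on_nth_deriv by blast

lemma schwartz_continuous: "schwartz f \<Longrightarrow> continuous_on {0..} f"
  unfolding continuous_on_eq_continuous_within
  using has_vector_derivative_continuous[OF Dh_has_vector_derivative] by simp

text \<open>Closure properties are checked on an explicit formula for the n-th derivative; the tower
  supplies smoothness and transfers the decay estimates at once.\<close>

lemma schwartz_family:
  assumes g: "\<And>n y. 0 \<le> y \<Longrightarrow> (g n has_vector_derivative g (Suc n) y) (at y within {0..})"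
    and b: "\<And>m n. \<exists>C. \<forall>y\<ge>0. norm (of_real y ^ m * g n y) \<le> C"
  shows "schwartz (g 0)"
proof -
  have "nth_deriv_on {0..} n (g 0) y = g n y" if "y \<in> {0..}" for n y
    using nth_deriv_on_family[where g=g and S="{0..}"] g that by simp
  then have "rapidly_decreasing_on {0..} (g 0)"
    unfolding rapidly_decreasing_on_iff using b by (simp add: Ball_def)
  moreover have "smooth_on {0..} (g 0)"
    using smooth_on_family[where g=g and S="{0..}"] g by simp
  ultimately show ?thesis by (simp add: schwartz_def)
qed

lemma schwartz_add:
  assumes "schwartz f" "schwartz g" shows "schwartz (\<lambda>y. f y + g y)"
proof -
  let ?h = "\<lambda>n y. nth_deriv_on {0..} n f y + nth_deriv_on {0..} n g y"
  have "schwartz (?h 0)"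
  proof (rule schwartz_family[where g="?h"])
    show "(?h n has_vector_derivative ?h (Suc n) y) (at y within {0..})" if "0 \<le> y" for n y
      using assms that by (intro has_vector_derivative_add smooth_onD) (auto simp: schwartz_def)
    fix m n
    obtain C D where "\<forall>y\<ge>0. norm (of_real y ^ m * nth_deriv_on {0..} n f y) \<le> C"
      "\<forall>y\<ge>0. norm (of_real y ^ m * nth_deriv_on {0..} n g y) \<le> D"
      using schwartz_bound[OF assms(1)] schwartz_bound[OF assms(2)] by metis
    then show "\<exists>C. \<forall>y\<ge>0. norm (of_real y ^ m * ?h n y) \<le> C"
      unfolding distrib_left by (intro exI[of _ "C + D"]) (auto intro!: norm_triangle_mono)
  qed
  then show ?thesis by simp
qed

lemma schwartz_cmul:
  assumes "schwartz f" shows "schwartz (\<lambda>y. c * f y)"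
proof -
  let ?h = "\<lambda>n y. c * nth_deriv_on {0..} n f y"
  have "schwartz (?h 0)"
  proof (rule schwartz_family[where g="?h"])
    show "(?h n has_vector_derivative ?h (Suc n) y) (at y within {0..})" if "0 \<le> y" for n y
      using assms that by (intro has_vector_derivative_mult_right smooth_onD) (auto simp: schwartz_def)
    fix m n
    obtain C where C: "\<And>y. 0 \<le> y \<Longrightarrow> norm (of_real y ^ m * nth_deriv_on {0..} n f y) \<le> C"
      using schwartz_bound[OF assms] by metis
    have "norm (of_real y ^ m * ?h n y) \<le> norm c * C" if "0 \<le> y" for y
      using mult_left_mono[OF C[OF that], of "norm c"] by (simp add: norm_mult ac_simps)
    then show "\<exists>C. \<forall>y\<ge>0. norm (of_real y ^ m * ?h n y) \<le> C" by blast
  qed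
  then show ?thesis by simp
qed

lemma of_real_has_vector_derivative: "(complex_of_real has_vector_derivative 1) (at y within S)"
  by (auto intro!: derivative_eq_intros simp: has_vector_derivative_def scaleR_conv_of_real)

lemma schwartz_times_y:
  assumes f: "schwartz f" shows "schwartz (\<lambda>y. of_real y * f y)"
proof -
  let ?d = "\<lambda>n. nth_deriv_on {0..} n f"
  \<comment> \<open>Leibniz for y f. At n = 0 the index \<open>n - 1\<close> is 0, but then the
    factor n is 0 as well.\<close>
  let ?h = "\<lambda>n y. of_real y * ?d n y + of_nat n * ?d (n - 1) y"
  have "schwartz (?h 0)"
  proof (rule schwartz_family[where g="?h"])
    fix n and y :: real assume y: "0 \<le> y"
    have d: "(?d n has_vector_derivative ?d (Suc n) y) (at y within {0..})" for n
      using smooth_onD[of "{0..}" f y n] f y by (simp add: schwartz_def)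
    have "((\<lambda>y. of_real y * ?d n y) has_vector_derivative (of_real y * ?d (Suc n) y + 1 * ?d n y)) (at y within {0..})"
      by (intro has_vector_derivative_mult d of_real_has_vector_derivative)
    moreover have "((\<lambda>y. of_nat n * ?d (n - 1) y) has_vector_derivative of_nat n * ?d n y) (at y within {0..})"
      using has_vector_derivative_mult_right[OF d, of "of_nat n" "n - 1"] by (cases n) simp_all
    ultimately show "(?h n has_vector_derivative ?h (Suc n) y) (at y within {0..})"
      by (rule has_vector_derivative_eq_rhs[OF has_vector_derivative_add]) (simp add: algebra_simps)
  next
    fix m n
    obtain C D where CD: "\<And>y. 0 \<le> y \<Longrightarrow> norm (of_real y ^ Suc m * ?d n y) \<le> C"
      "\<And>y. 0 \<le> y \<Longrightarrow> norm (of_real y ^ m * ?d (n - 1) y) \<le> D"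
      using schwartz_bound[OF f] by metis
    have "norm (of_real y ^ m * ?h n y) \<le> C + real n * D" if "0 \<le> y" for y
    proof -
      have "of_real y ^ m * ?h n y = of_real y ^ Suc m * ?d n y + of_nat n * (of_real y ^ m * ?d (n - 1) y)"
        by (simp add: algebra_simps)
      moreover have "norm (of_nat n * (of_real y ^ m * ?d (n - 1) y)) \<le> real n * D"
        unfolding norm_mult[of "of_nat n"] using CD(2)[OF that] by (simp add: mult_left_mono)
      ultimately show ?thesis using CD(1)[OF that] by (simp only: norm_triangle_mono)
    qed
    then show "\<exists>C. \<forall>y\<ge>0. norm (of_real y ^ m * ?h n y) \<le> C" by blast
  qed
  then show ?thesis by simp
qed

lemma schwartz_qd: assumes "schwartz f" shows "qd (\<lambda>y. of_real y ^ m * f y)"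
proof -
  obtain C D where CD: "\<And>y. 0 \<le> y \<Longrightarrow> norm (of_real y ^ m * nth_deriv_on {0..} 0 f y) \<le> C"
      "\<And>y. 0 \<le> y \<Longrightarrow> norm (of_real y ^ (m + 2) * nth_deriv_on {0..} 0 f y) \<le> D"
    using schwartz_bound[OF assms] by metis
  show ?thesis
  proof (rule qdI)
    fix y :: real assume y: "0 \<le> y"
    have "(1 + y\<^sup>2) * norm (of_real y ^ m * f y) = norm (of_real y ^ m * f y) + norm (of_real y ^ (m + 2) * f y)"
      using y by (simp add: norm_mult norm_power power_add power2_eq_square algebra_simps)
    then show "(1 + y\<^sup>2) * norm (of_real y ^ m * f y) \<le> C + D"
      using CD(1)[OF y] CD(2)[OF y] by simp
  qed (intro continuous_intros schwartz_continuous assms)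
qed

lemma lagd_bound':
  "0 \<le> y \<Longrightarrow> \<bar>lagd d k n y\<bar> \<le> (2 * real n + 1) ^ k * (3 * real (n + 2) ^ Suc d)"
  by (rule order_trans[OF lagd_bound]) (auto intro!: mult_left_mono mult_left_le)

lemma continuous_on_lagd: "continuous_on S (lagd d k n)"
  by (intro continuous_at_imp_continuous_on ballI DERIV_isCont[OF DERIV_lagd])

lemma qd_schwartz_lagd:
  "schwartz f \<Longrightarrow> qd (\<lambda>y. of_real y ^ m * f y * of_real (lagd d k n y))"
  by (rule qd_mult_bounded[OF schwartz_qd])
     (auto intro!: continuous_intros continuous_on_lagd order_trans[OF lagd_bound'])

section \<open>Rapid decrease of Laguerre coefficients\<close>

definition la :: "nat \<Rightarrow> (real \<Rightarrow> complex) \<Rightarrow> nat \<Rightarrow> complex" where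
  "la d f n = hInt (\<lambda>y. of_real y ^ d * f y * of_real (lag d n y))"

text \<open>In divergence form y^(-d) (y^(d+1) f')' - y f, hence symmetric for the weight y^d. Its
  effect on Laguerre functions is \<open>lagd_ode\<close>.\<close>

definition lagop :: "nat \<Rightarrow> (real \<Rightarrow> complex) \<Rightarrow> real \<Rightarrow> complex" where
  "lagop d f y = of_real y * Dh (Dh f) y + ((of_nat d + 1) * Dh f y + -1 * (of_real y * f y))"

lemma schwartz_lagop: "schwartz f \<Longrightarrow> schwartz (lagop d f)"
  unfolding lagop_def[abs_def]
  by (intro schwartz_add schwartz_times_y schwartz_cmul schwartz_Dh)

lemma la_bound:
  assumes f: "schwartz f" shows "\<exists>C\<ge>0. \<forall>n. norm (la d f n) \<le> C * real (n + 2) ^ Suc d"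
proof -
  obtain C where C: "\<And>y. 0 \<le> y \<Longrightarrow> (1 + y\<^sup>2) * norm (of_real y ^ d * f y) \<le> C"
    using schwartz_qd[OF f, of d] by (auto simp: qd_def)
  have C0: "0 \<le> C" using order_trans[OF _ C[of 0]] by simp
  have "norm (la d f n) \<le> (C * (3 * real (n + 2) ^ Suc d)) * pi" for n
    unfolding la_def
  proof (rule hInt_bound(2))
    show "continuous_on {0..} (\<lambda>y. of_real y ^ d * f y * of_real (lag d n y))"
      using qd_continuous[OF qd_schwartz_lagd[OF f, of d d 0 n]] by simp
    fix y :: real assume y: "0 \<le> y"
    have "(1 + y\<^sup>2) * norm (of_real y ^ d * f y) * \<bar>lag d n y\<bar> \<le> C * (3 * real (n + 2) ^ Suc d)"
      using C[OF y] lagd_bound'[OF y, of d 0 n] C0 by (intro mult_mono) auto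
    then show "(1 + y\<^sup>2) * norm (of_real y ^ d * f y * of_real (lag d n y)) \<le> C * (3 * real (n + 2) ^ Suc d)"
      by (simp add: norm_mult mult.assoc)
  qed
  then show ?thesis using C0 by (intro exI[of _ "C * 3 * pi"]) (simp add: ac_simps)
qed

text \<open>Green's identity: the two pairings differ by the integral of the derivative of y^(d+1)
  (f' l - f l'), which vanishes at 0 by the power of y and at infinity by decay. The eigenvalue
  comes from \<open>lagd_ode\<close>.\<close>

lemma la_lagop:
  assumes f: "schwartz f"
  shows "la d (lagop d f) n = - of_nat (2 * n + d + 1) * la d f n"
proof -
  define l0 l1 l2 :: "real \<Rightarrow> complex" where "l0 y = of_real (lagd d 0 n y)" and "l1 y = of_real (lagd d 1 n y)"
    and "l2 y = of_real (lagd d 2 n y)" for y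
  have l0: "l0 y = of_real (lag d n y)" for y by (simp add: l0_def)
  have Dl: "(l0 has_vector_derivative l1 y) (at y within {0..})" "(l1 has_vector_derivative l2 y) (at y within {0..})" for y
  proof -
    have D: "((\<lambda>y. complex_of_real (lagd d k n y)) has_vector_derivative of_real (lagd d (Suc k) n y)) (at y within {0..})" for k
      using DERIV_lagd[of d k n y] has_vector_derivative_at_within has_vector_derivative_of_real
      unfolding has_real_derivative_iff_has_vector_derivative by blast
    show "(l0 has_vector_derivative l1 y) (at y within {0..})" "(l1 has_vector_derivative l2 y) (at y within {0..})"
      using D[of 0] D[of 1] by (simp_all only: l0_def[abs_def] l1_def[abs_def] l2_def numeral_2_eq_2 One_nat_def)
  qed
  have ode: "of_real y * l2 y + (of_nat d + 1) * l1 y - of_real y * l0 y = - of_nat (2 * n + d + 1) * l0 y" for y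
    using arg_cong[OF lagd_ode[of y d n], of complex_of_real] by (simp add: l0_def l1_def l2_def)
  define F where "F y = of_real y ^ Suc d * (Dh f y * l0 y - f y * l1 y)" for y
  define g where "g y = of_real y ^ d * lagop d f y * l0 y + of_nat (2 * n + d + 1) * (of_real y ^ d * f y * l0 y)" for y
  have D: "(F has_vector_derivative g y) (at y within {0..})" if y: "0 \<le> y" for y
  proof -
    have "((\<lambda>y. Dh f y * l0 y - f y * l1 y) has_vector_derivative
        (Dh f y * l1 y + Dh (Dh f) y * l0 y) - (f y * l2 y + Dh f y * l1 y)) (at y within {0..})"
      using y by (intro has_vector_derivative_diff has_vector_derivative_mult Dl Dh_has_vector_derivative f schwartz_Dh)
    from has_vector_derivative_mult[OF of_real_power_has_vector_derivative this]
    have "(F has_vector_derivative of_real y ^ Suc d * ((Dh f y * l1 y + Dh (Dh f) y * l0 y) - (f y * l2 y + Dh f y * l1 y))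
       + of_nat (Suc d) * of_real y ^ d * (Dh f y * l0 y - f y * l1 y)) (at y within {0..})"
      by (simp only: F_def[abs_def])
    moreover have "of_real y ^ Suc d * ((Dh f y * l1 y + Dh (Dh f) y * l0 y) - (f y * l2 y + Dh f y * l1 y))
       + of_nat (Suc d) * of_real y ^ d * (Dh f y * l0 y - f y * l1 y)
       = of_real y ^ d * lagop d f y * l0 y - of_real y ^ d * f y * (of_real y * l2 y + (of_nat d + 1) * l1 y - of_real y * l0 y)"
      by (simp add: lagop_def algebra_simps)
    then have "of_real y ^ Suc d * ((Dh f y * l1 y + Dh (Dh f) y * l0 y) - (f y * l2 y + Dh f y * l1 y))
       + of_nat (Suc d) * of_real y ^ d * (Dh f y * l0 y - f y * l1 y) = g y"
      unfolding ode g_def by (simp only: mult_minus_left mult_minus_right diff_minus_eq_add ac_simps)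
    ultimately show ?thesis by simp
  qed
  have q: "qd (\<lambda>y. of_real y ^ d * lagop d f y * l0 y)" "qd (\<lambda>y. of_real y ^ d * f y * l0 y)"
    unfolding l0_def by (intro qd_schwartz_lagd schwartz_lagop f)+
  have qF: "qd F"
  proof -
    have "qd (\<lambda>y. of_real y ^ Suc d * Dh f y * l0 y + -1 * (of_real y ^ Suc d * f y * l1 y))"
      unfolding l0_def l1_def by (intro qd_add qd_cmul qd_schwartz_lagd schwartz_Dh f)
    then show ?thesis unfolding F_def[abs_def] by (simp add: algebra_simps)
  qed
  have "hInt g = - F 0"
    unfolding g_def[abs_def] by (rule hInt_FTC[OF qF _ D[unfolded g_def]]) (intro qd_add qd_cmul q)
  then have "hInt g = 0" by (simp add: F_def)
  moreover have "hInt g = la d (lagop d f) n + of_nat (2 * n + d + 1) * la d f n"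
    unfolding g_def[abs_def] la_def l0[symmetric] hInt_cmul[symmetric] by (intro hInt_add qd_cmul q)
  ultimately show ?thesis by (simp only: mult_minus_left eq_neg_iff_add_eq_0)
qed

lemma rapid_la:
  assumes "schwartz f" shows "rapid (la d f)"
proof (rule rapidI_bounded)
  have bd: "\<exists>C\<ge>0. \<forall>n. real (Suc n) ^ k * norm (la d f n) \<le> C * real (n + 2) ^ Suc d" if "schwartz f" for k f
    using that
  proof (induction k arbitrary: f)
    case 0
    then show ?case using la_bound by simp
  next
    case (Suc k)
    obtain C where C: "C \<ge> 0" "\<And>n. real (Suc n) ^ k * norm (la d (lagop d f) n) \<le> C * real (n + 2) ^ Suc d"
      using Suc.IH[OF schwartz_lagop[OF Suc.prems]] by blast
    have "real (Suc n) ^ Suc k * norm (la d f n) \<le> C * real (n + 2) ^ Suc d" for n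
    proof -
      have "norm (la d (lagop d f) n) = real (2 * n + d + 1) * norm (la d f n)"
        unfolding la_lagop[OF Suc.prems] norm_mult norm_minus_cancel norm_of_nat ..
      moreover have "real (Suc n) * norm (la d f n) \<le> real (2 * n + d + 1) * norm (la d f n)"
        by (intro mult_right_mono) auto
      ultimately have "real (Suc n) ^ k * (real (Suc n) * norm (la d f n)) \<le> C * real (n + 2) ^ Suc d"
        by (intro order_trans[OF mult_left_mono C(2)[of n]]) auto
      then show ?thesis by (simp only: power_Suc ac_simps)
    qed
    with C(1) show ?case by blast
  qed
  fix k
  \<comment> \<open>Each use of \<open>lagop\<close> gains a factor n; d + 1 further uses absorb the
    polynomial growth in \<open>la_bound\<close>.\<close>
  obtain C where C: "C \<ge> 0" "\<And>n. real (Suc n) ^ (k + Suc d) * norm (la d f n) \<le> C * real (n + 2) ^ Suc d"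
    using bd[OF assms] by blast
  have "real (Suc n) ^ k * norm (la d f n) \<le> C * 2 ^ Suc d" for n
  proof -
    have "real (n + 2) ^ Suc d \<le> (2 * real (Suc n)) ^ Suc d" by (intro power_mono) auto
    then have "C * real (n + 2) ^ Suc d \<le> C * (2 ^ Suc d * real (Suc n) ^ Suc d)"
      unfolding power_mult_distrib by (intro mult_left_mono C(1))
    with C(2)[of n] have "real (Suc n) ^ Suc d * (real (Suc n) ^ k * norm (la d f n)) \<le> real (Suc n) ^ Suc d * (C * 2 ^ Suc d)"
      by (simp only: power_add ac_simps)
    then show ?thesis by (rule mult_left_le_imp_le) simp
  qed
  then show "\<exists>C. \<forall>n. real (Suc n) ^ k * norm (la d f n) \<le> C" by blast
qed

section \<open>\<open>I\<^sub>d\<^sup>+\<close> as a Hardy space\<close>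

lemma continuous_on_lag: "continuous_on S (lag d n)"
  by (intro continuous_at_imp_continuous_on ballI DERIV_isCont[OF DERIV_lag])

lemma summable_poly_geometric:
  fixes r :: real
  assumes r: "0 \<le> r" "r < 1" shows "summable (\<lambda>n. real (n + 2) ^ m * r ^ n)"
proof -
  \<comment> \<open>A base between r and 1, positive even for r = 0 so that its logarithm exists. It
    is split into two equal factors exp (-t): one absorbs the polynomial, the other remains as a
    geometric series.\<close>
  define s where "s = (r + 1) / 2"
  have s: "0 < s" "s < 1" "r \<le> s" using r by (auto simp: s_def)
  define t where "t = - ln s / 2"
  have t: "t > 0" using s by (simp add: t_def)
  have st: "s = exp (- t) * exp (- t)" using s by (simp add: t_def flip: exp_add)
  have le: "real (n + 2) ^ m * r ^ n \<le> exp (2 * t) * (fact m / t ^ m) * exp (- t) ^ n" for n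
  proof -
    have "real (n + 2) ^ m * exp (- t * real (n + 2)) \<le> fact m / t ^ m"
      by (rule power_times_exp_le) (use t in auto)
    moreover have "exp (- t) ^ n = exp (2 * t) * exp (- t * real (n + 2))"
      by (simp add: algebra_simps flip: exp_of_nat_mult exp_add)
    ultimately have "real (n + 2) ^ m * exp (- t) ^ n \<le> exp (2 * t) * (fact m / t ^ m)"
      by (subst mult.commute) (simp only: mult.assoc mult.commute[of "exp (- t * real (n + 2))"] mult_left_mono exp_ge_zero)
    then have le1: "real (n + 2) ^ m * exp (- t) ^ n * exp (- t) ^ n \<le> exp (2 * t) * (fact m / t ^ m) * exp (- t) ^ n"
      by (intro mult_right_mono) auto
    have sn: "s ^ n = exp (- t) ^ n * exp (- t) ^ n" by (subst st) (rule power_mult_distrib)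
    have "real (n + 2) ^ m * r ^ n \<le> real (n + 2) ^ m * s ^ n"
      using r s by (intro mult_left_mono power_mono) auto
    then have "real (n + 2) ^ m * r ^ n \<le> real (n + 2) ^ m * exp (- t) ^ n * exp (- t) ^ n"
      by (simp only: sn mult.assoc)
    then show ?thesis using le1 by (rule order_trans)
  qed
  have "summable (\<lambda>n. exp (2 * t) * (fact m / t ^ m) * exp (- t) ^ n)"
    by (intro summable_mult summable_geometric) (use t in simp)
  then show ?thesis
    by (rule summable_comparison_test') (use le r in auto)
qed

lemma sums_hInt:
  assumes c: "\<And>n. continuous_on {0..} (f n)"
    and le: "\<And>n y. 0 \<le> y \<Longrightarrow> (1 + y\<^sup>2) * norm (f n y) \<le> M n" and M: "summable M"
  shows "(\<lambda>n. hInt (f n)) sums hInt (\<lambda>y. \<Sum>n. f n y)"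
proof -
  have le': "norm (f n y) \<le> M n" if "0 \<le> y" for n y
  proof -
    have "norm (f n y) \<le> (1 + y\<^sup>2) * norm (f n y)" by (simp add: distrib_right)
    then show ?thesis using le[OF that] by (rule order_trans)
  qed
  have s: "summable (\<lambda>n. norm (indicator {0..} y *\<^sub>R f n y))" for y
    by (rule summable_comparison_test'[OF M, of 0])
       (use le'[of y] order_trans[OF norm_ge_zero le'[of 0]] in \<open>auto simp: indicator_def\<close>)
  have si: "summable (\<lambda>n. LINT y|lborel. norm (indicator {0..} y *\<^sub>R f n y))"
    by (rule summable_comparison_test'[OF summable_mult2[OF M, of pi], of 0])
       (use hInt_bound(3)[OF c le] in \<open>simp add: abs_of_nonneg\<close>)
  have "(\<lambda>n. hInt (f n)) sums (LINT y|lborel. (\<Sum>n. indicator {0..} y *\<^sub>R f n y))"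
    unfolding hInt_def
    by (rule sums_integral[OF hInt_bound(1)[OF c le] _ si]) (assumption | rule AE_I2, rule s)+
  moreover have "(\<Sum>n. indicator {0..} y *\<^sub>R f n y) = indicator {0..} y *\<^sub>R (\<Sum>n. f n y)" for y :: real
    by (cases "0 \<le> y") auto
  ultimately show ?thesis by (simp only: hInt_def)
qed

text \<open>Termwise integration of the generating series, allowed inside the disc because Laguerre
  functions grow polynomially in n, uniformly in y.\<close>

lemma sums_la:
  assumes f: "schwartz f" and w: "norm w < 1"
  shows "(\<lambda>n. la d f n * w ^ n) sums hInt (\<lambda>y. of_real y ^ d * f y * lagG d y w)"
proof -
  let ?f = "\<lambda>n y. w ^ n * (of_real y ^ d * f y * of_real (lag d n y))"
  obtain C where C: "\<And>y. 0 \<le> y \<Longrightarrow> (1 + y\<^sup>2) * norm (of_real y ^ d * f y) \<le> C"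
    using schwartz_qd[OF f, of d] by (auto simp: qd_def)
  have C0: "0 \<le> C" using order_trans[OF _ C[of 0]] by simp
  have "(\<lambda>n. hInt (?f n)) sums hInt (\<lambda>y. \<Sum>n. ?f n y)"
  proof (rule sums_hInt)
    show "continuous_on {0..} (?f n)" for n
      by (intro continuous_intros continuous_on_lag schwartz_continuous f)
    show "summable (\<lambda>n. C * 3 * (real (n + 2) ^ Suc d * norm w ^ n))"
      by (intro summable_mult summable_poly_geometric w) simp
    fix n and y :: real assume y: "0 \<le> y"
    have "(1 + y\<^sup>2) * norm (of_real y ^ d * f y) * \<bar>lag d n y\<bar> \<le> C * (3 * real (n + 2) ^ Suc d)"
      using C[OF y] lagd_bound'[OF y, of d 0 n] C0 by (intro mult_mono) auto
    from mult_left_mono[OF this, of "norm w ^ n"]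
    show "(1 + y\<^sup>2) * norm (?f n y) \<le> C * 3 * (real (n + 2) ^ Suc d * norm w ^ n)"
      by (simp add: norm_mult norm_power ac_simps del: power_Suc)
  qed
  moreover have "hInt (?f n) = la d f n * w ^ n" for n
    unfolding hInt_cmul la_def by (rule mult.commute)
  moreover have "(\<Sum>n. ?f n y) = of_real y ^ d * f y * lagG d y w" for y
    using sums_mult[OF lag_generating_function[OF w, of d y], of "of_real y ^ d * f y"]
    by (simp add: sums_iff ac_simps)
  ultimately show ?thesis by simp
qed

lemma hInt_dominated:
  assumes g: "qd g" and s: "\<And>k. continuous_on {0..} (s k)"
    and le: "\<And>k y. 0 \<le> y \<Longrightarrow> norm (s k y) \<le> norm (g y)"
    and lim: "\<And>y. 0 \<le> y \<Longrightarrow> (\<lambda>k. s k y) \<longlonglongrightarrow> f y" and f: "continuous_on {0..} f"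
  shows "(\<lambda>k. hInt (s k)) \<longlonglongrightarrow> hInt f"
  unfolding hInt_def
proof (rule integral_dominated_convergence[where w="\<lambda>y. norm (indicator {0..} y *\<^sub>R g y)"])
  show "integrable lborel (\<lambda>y. norm (indicator {0..} y *\<^sub>R g y))"
    by (intro integrable_norm qd_integrable g)
  show "AE y in lborel. (\<lambda>k. indicator {0..} y *\<^sub>R s k y) \<longlonglongrightarrow> indicator {0..} y *\<^sub>R f y"
    by (intro AE_I2) (auto simp: indicator_def lim)
  show "AE y in lborel. norm (indicator {0..} y *\<^sub>R s k y) \<le> norm (indicator {0..} y *\<^sub>R g y)" for k
    by (intro AE_I2) (auto simp: indicator_def le)
qed (use hInt_measurable s f in auto)

lemma
  shows one_minus_cay: "1 - cay z = 2 * \<i> / (of_real z + \<i>)"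
    and one_plus_cay: "1 + cay z = 2 * of_real z / (of_real z + \<i>)"
  by (simp_all add: cay_def field_simps)

text \<open>At w = \<open>cay z\<close> the quotient (1 + w)/(1 - w) is -i z, so the generating
  function turns into the Fourier kernel.\<close>

lemma lagG_cay: "lagG d y (cay z) = exp (\<i> * of_real y * of_real z) * ((of_real z + \<i>) / (2 * \<i>)) ^ Suc d"
proof -
  have "(1 + cay z) / (1 - cay z) = of_real z / \<i>"
    unfolding one_minus_cay one_plus_cay by simp
  also have "\<dots> = - \<i> * of_real z" by simp
  finally have "- complex_of_real y * ((1 + cay z) / (1 - cay z)) = \<i> * of_real y * of_real z" by simp
  then have "lagG d y (cay z) = exp (\<i> * of_real y * of_real z) / (1 - cay z) ^ Suc d"
    unfolding lagG_def by (simp only:)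
  then show ?thesis
    unfolding one_minus_cay by (simp only: power_divide divide_divide_eq_right times_divide_eq_right)
qed

text \<open>Points on the radius to w, strictly inside the disc when |w| <= 1, since the factor
  (k+1)/(k+2) is below 1.\<close>

definition radial :: "complex \<Rightarrow> nat \<Rightarrow> complex" where
  "radial w k = of_real (real (Suc k) / real (k + 2)) * w"

lemma norm_radial: "norm w \<le> 1 \<Longrightarrow> norm (radial w k) < 1"
proof -
  assume "norm w \<le> 1"
  then have "norm (radial w k) \<le> real (Suc k) / real (k + 2) * 1"
    unfolding radial_def norm_mult norm_of_real by (intro mult_mono) auto
  also have "\<dots> < 1" by simp
  finally show ?thesis .
qed

lemma radial_tendsto: "radial w \<longlonglongrightarrow> w"
proof -
  have "(\<lambda>k. real (Suc k) / real (k + 2)) \<longlonglongrightarrow> 1" by real_asymp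
  from tendsto_mult[OF tendsto_of_real[OF this] tendsto_const[of w]]
  show ?thesis by (simp add: radial_def[abs_def])
qed

lemma continuous_radial:
  assumes "continuous_on (cball 0 1) f" "norm w \<le> 1"
  shows "(\<lambda>k. f (radial w k)) \<longlonglongrightarrow> f w"
  by (rule continuous_on_tendsto_compose[OF assms(1) radial_tendsto])
     (use norm_radial[OF assms(2)] assms(2) in \<open>auto intro!: always_eventually less_imp_le\<close>)

text \<open>\<open>sums_la\<close> holds only inside the disc, so both of its sides are followed
  along the radius to \<open>cay z\<close>: the series by continuity on the closed disc, the
  integral by dominated convergence.\<close>

lemma schwartz_imp_Hf:
  assumes f: "schwartz f"
  shows "hInt (\<lambda>y. of_real y ^ d * f y * exp (\<i> * of_real y * of_real z)) = Hf d (\<lambda>n. (2 * \<i>) ^ Suc d * la d f n) z"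
proof -
  define w where "w = radial (cay z)"
  have nw: "norm (w k) < 1" for k unfolding w_def by (rule norm_radial) simp
  have wlim: "w \<longlonglongrightarrow> cay z" unfolding w_def by (rule radial_tendsto)
  have c1: "1 - cay z \<noteq> 0" unfolding one_minus_cay by simp
  have w1: "1 - w k \<noteq> 0" for k using nw[of k] by auto
  have "(\<lambda>k. psum (la d f) (w k)) \<longlonglongrightarrow> psum (la d f) (cay z)"
    unfolding w_def by (rule continuous_radial[OF continuous_on_psum[OF rapid_la[OF f]]]) simp
  moreover have "psum (la d f) (w k) = hInt (\<lambda>y. of_real y ^ d * f y * lagG d y (w k))" for k
    using sums_la[OF f nw, of d k] by (simp add: psum_def sums_iff)
  moreover have "(\<lambda>k. hInt (\<lambda>y. of_real y ^ d * f y * lagG d y (w k))) \<longlonglongrightarrow> hInt (\<lambda>y. of_real y ^ d * f y * lagG d y (cay z))"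
  proof -
    \<comment> \<open>The exponential factor of the generating function is at most 1 in the disc,
      and \<open>1 - w k\<close> stays away from 0 because \<open>cay z\<close> is not 1. This gives
      a majorant independent of k.\<close>
    have "(\<lambda>k. 1 / norm (1 - w k) ^ Suc d) \<longlonglongrightarrow> 1 / norm (1 - cay z) ^ Suc d"
      using c1 by (intro tendsto_intros wlim) auto
    then have "Bseq (\<lambda>k. 1 / norm (1 - w k) ^ Suc d)" by (intro convergent_imp_Bseq convergentI)
    then obtain M where M: "M > 0" "\<And>k. norm (1 / norm (1 - w k) ^ Suc d) \<le> M" by (auto elim: BseqE)
    have G: "norm (lagG d y (w k)) \<le> M" if "0 \<le> y" for y k
    proof -
      have "norm (lagG d y (w k)) \<le> exp (- y * ((1 - (norm (w k))\<^sup>2) / (norm (1 - w k))\<^sup>2)) / norm (1 - w k) ^ Suc d"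
        by (rule norm_lagG_le[OF that]) (use nw[of k] in auto)
      also have "\<dots> \<le> 1 / norm (1 - w k) ^ Suc d"
        using that nw[of k] by (intro divide_right_mono) (auto simp: power_le_one)
      also have "\<dots> \<le> M" using M(2)[of k] by (simp del: power_Suc)
      finally show ?thesis .
    qed
    have cG: "continuous_on {0..} (\<lambda>y. lagG d y w)" if "1 - w \<noteq> 0" for w
      unfolding lagG_def using that by (intro continuous_intros) auto
    show ?thesis
    proof (rule hInt_dominated[where g="\<lambda>y. of_real M * (of_real y ^ d * f y)"])
      show "qd (\<lambda>y. of_real M * (of_real y ^ d * f y))" by (intro qd_cmul schwartz_qd f)
      show "norm (of_real y ^ d * f y * lagG d y (w k)) \<le> norm (of_real M * (of_real y ^ d * f y))" if "0 \<le> y" for k y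
        using mult_left_mono[OF G[OF that, of k], of "norm (of_real y ^ d * f y)"] M(1)
        by (simp add: norm_mult ac_simps)
      show "(\<lambda>k. of_real y ^ d * f y * lagG d y (w k)) \<longlonglongrightarrow> of_real y ^ d * f y * lagG d y (cay z)" for y
        unfolding lagG_def using c1 by (intro tendsto_intros wlim) auto
    qed (intro continuous_intros cG w1 c1 schwartz_continuous f)+
  qed
  ultimately have "psum (la d f) (cay z) = hInt (\<lambda>y. of_real y ^ d * f y * lagG d y (cay z))"
    by (intro LIMSEQ_unique[of "\<lambda>k. psum (la d f) (w k)"]) simp_all
  also have "\<dots> = hInt (\<lambda>y. ((of_real z + \<i>) / (2 * \<i>)) ^ Suc d * (of_real y ^ d * f y * exp (\<i> * of_real y * of_real z)))"
    unfolding lagG_cay by (intro hInt_cong) (simp only: ac_simps)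
  also have "\<dots> = ((of_real z + \<i>) / (2 * \<i>)) ^ Suc d * hInt (\<lambda>y. of_real y ^ d * f y * exp (\<i> * of_real y * of_real z))"
    by (rule hInt_cmul)
  finally have "psum (la d f) (cay z) = (of_real z + \<i>) ^ Suc d / (2 * \<i>) ^ Suc d * hInt (\<lambda>y. of_real y ^ d * f y * exp (\<i> * of_real y * of_real z))"
    by (simp only: power_divide)
  then show ?thesis
    unfolding Hf_def by (subst psum_cmul[OF rapid_la[OF f]]) (simp_all del: power_Suc)
qed

section \<open>From power series to Schwartz functions\<close>

lemma qd_sum: "finite A \<Longrightarrow> (\<And>k. k \<in> A \<Longrightarrow> qd (f k)) \<Longrightarrow> qd (\<lambda>y. \<Sum>k\<in>A. f k y)
    \<and> hInt (\<lambda>y. \<Sum>k\<in>A. f k y) = (\<Sum>k\<in>A. hInt (f k))"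
proof (induction A rule: finite_induct)
  case empty
  have "qd (\<lambda>y. 0)" by (rule qdI[where C=0]) auto
  then show ?case by (simp add: hInt_def)
next
  case (insert k A)
  then show ?case by (simp add: qd_add hInt_add)
qed

text \<open>With s = 1 - i z each power of y gives a Laplace integral, and the sum over k is the
  binomial expansion of (1 - 2/s)^n, where 1 - 2/s is \<open>cay z\<close>.\<close>

lemma laplace_lag:
  "hInt (\<lambda>y. of_real y ^ d * of_real (lag d n y) * exp (\<i> * of_real y * of_real z))
    = fact (n + d) / fact n * \<i> ^ Suc d * cay z ^ n / (of_real z + \<i>) ^ Suc d"
proof -
  define s where "s = 1 - \<i> * of_real z"
  have s: "Re s > 0" by (simp add: s_def)
  have s0: "s \<noteq> 0" using s by auto
  have si: "s = - \<i> * (of_real z + \<i>)" by (simp add: s_def algebra_simps)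
  have eq: "of_real y ^ d * of_real (lag d n y) * exp (\<i> * of_real y * of_real z)
     = (\<Sum>k\<le>n. of_real (lagc d n k) * 2 ^ k * (of_real y ^ (d + k) * exp (- s * of_real y)))" for y
  proof -
    have "- s * of_real y = of_real (- y) + \<i> * of_real y * of_real z"
      by (simp add: s_def algebra_simps)
    then have "exp (- s * of_real y) = of_real (exp (- y)) * exp (\<i> * of_real y * of_real z)"
      by (simp only: exp_add exp_of_real)
    then show ?thesis
      by (simp add: lag_def poly_lpoly sum_distrib_left sum_distrib_right power_mult_distrib power_add ac_simps)
  qed
  have "hInt (\<lambda>y. of_real y ^ d * of_real (lag d n y) * exp (\<i> * of_real y * of_real z))
     = (\<Sum>k\<le>n. of_real (lagc d n k) * 2 ^ k * (fact (d + k) / s ^ Suc (d + k)))"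
    unfolding eq laplace_power[OF s, symmetric] hInt_cmul[symmetric]
    by (rule qd_sum[THEN conjunct2]) (rule finite_atMost, intro qd_cmul qd_power_exp s)
  also have "\<dots> = (\<Sum>k\<le>n. fact (n + d) / fact n / s ^ Suc d * (of_nat (n choose k) * (- 2 / s) ^ k * 1 ^ (n - k)))"
  proof (rule sum.cong[OF refl])
    fix k assume "k \<in> {..n}"
    then have k: "k \<le> n" by simp
    have "of_real (lagc d n k) * fact (d + k) = (-1) ^ k * (of_nat ((n + d) choose (d + k)) * fact (d + k) / fact k :: complex)"
      by (simp add: lagc_def)
    \<comment> \<open>The factorial from the Laplace integral turns the shifted binomial coefficient
      into n choose k, times a factor free of k.\<close>
    also have "of_nat ((n + d) choose (d + k)) * fact (d + k) / fact k = (fact (n + d) / fact n * of_nat (n choose k) :: complex)"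
      using k by (simp add: binomial_fact)
    finally have lf: "of_real (lagc d n k) * fact (d + k) = (-1) ^ k * (fact (n + d) / fact n * of_nat (n choose k) :: complex)" .
    have "of_real (lagc d n k) * 2 ^ k * (fact (d + k) / s ^ Suc (d + k))
       = ((-1) ^ k * (fact (n + d) / fact n * of_nat (n choose k))) * 2 ^ k / s ^ Suc (d + k)"
    proof -
      have "L * t * (F / S) = (L * F) * t / S" for L t F S :: complex by (simp add: divide_inverse ac_simps)
      then show ?thesis by (simp only: lf)
    qed
    also have "\<dots> = fact (n + d) / fact n / s ^ Suc d * (of_nat (n choose k) * (- 2 / s) ^ k * 1 ^ (n - k))"
    proof -
      have "(- 2 / s) ^ k = ((-1) * (2 / s)) ^ k" by simp
      then have "(- 2 / s) ^ k = (-1) ^ k * 2 ^ k / s ^ k"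
        by (simp only: power_mult_distrib power_divide times_divide_eq_right)
      then show ?thesis by (simp add: power_add ac_simps)
    qed
    finally show "of_real (lagc d n k) * 2 ^ k * (fact (d + k) / s ^ Suc (d + k))
       = fact (n + d) / fact n / s ^ Suc d * (of_nat (n choose k) * (- 2 / s) ^ k * 1 ^ (n - k))" .
  qed
  also have "\<dots> = fact (n + d) / fact n / s ^ Suc d * (- 2 / s + 1) ^ n"
    by (simp only: binomial_ring sum_distrib_left)
  also have "- 2 / s + 1 = cay z"
  proof -
    have "- 2 / s + 1 = (s - 2) / s" using s0 by (simp add: field_simps)
    also have "s - 2 = - \<i> * (of_real z - \<i>)" by (simp add: s_def algebra_simps)
    finally show ?thesis unfolding si cay_def by simp
  qed
  also have "fact (n + d) / fact n / s ^ Suc d * cay z ^ n = fact (n + d) / fact n * \<i> ^ Suc d * cay z ^ n / (of_real z + \<i>) ^ Suc d"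
  proof -
    have "\<i> ^ Suc d * (- \<i>) ^ Suc d = 1" by (simp only: power_mult_distrib[symmetric]) simp
    then have "1 / (- \<i>) ^ Suc d = \<i> ^ Suc d" by (metis div_by_1 nonzero_eq_divide_eq one_neq_zero mult_zero_right)
    show ?thesis
    proof -
      have "X / (J * Z) * C = X * (1 / J) * C / Z" for X J Z C :: complex by (simp add: divide_inverse ac_simps)
      then show ?thesis
        unfolding si power_mult_distrib by (simp only: \<open>1 / (- \<i>) ^ Suc d = \<i> ^ Suc d\<close>)
    qed
  qed
  finally show ?thesis .
qed

text \<open>At the exponential rate 1/(2(n+2)) of \<open>lagd_bound\<close> each power of y costs
  one power of n, so every weighted derivative stays polynomial in n.\<close>

lemma lagd_weighted_bound:
  assumes y: "0 \<le> y"
  shows "y ^ m * \<bar>lagd d k n y\<bar> \<le> 2 ^ k * 3 * 2 ^ Suc d * fact m * 4 ^ m * real (Suc n) ^ (k + Suc d + m)"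
proof -
  have "y ^ m * \<bar>lagd d k n y\<bar> \<le> y ^ m * ((2 * real n + 1) ^ k * (3 * real (n + 2) ^ Suc d * exp (- y / (2 * real (n + 2)))))"
    by (intro mult_left_mono lagd_bound y) (use y in simp)
  also have "\<dots> = (2 * real n + 1) ^ k * (3 * real (n + 2) ^ Suc d * (y ^ m * exp (- (1 / (2 * real (n + 2))) * y)))"
    by (simp add: ac_simps)
  also have "\<dots> = (2 * real n + 1) ^ k * (3 * (real (n + 2) ^ Suc d * (y ^ m * exp (- (1 / (2 * real (n + 2))) * y))))"
    by (simp only: mult.assoc)
  also have "\<dots> \<le> (2 * real (Suc n)) ^ k * (3 * ((2 * real (Suc n)) ^ Suc d * (fact m * (4 * real (Suc n)) ^ m)))"
  proof -
    have "y ^ m * exp (- (1 / (2 * real (n + 2))) * y) \<le> fact m / (1 / (2 * real (n + 2))) ^ m"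
      by (rule power_times_exp_le[OF y]) simp
    also have "\<dots> = fact m * (2 * real (n + 2)) ^ m" by (simp add: power_divide)
    also have "\<dots> \<le> fact m * (4 * real (Suc n)) ^ m"
      by (intro mult_left_mono power_mono) auto
    finally have e1: "y ^ m * exp (- (1 / (2 * real (n + 2))) * y) \<le> fact m * (4 * real (Suc n)) ^ m" .
    have e2: "(2 * real n + 1) ^ k \<le> (2 * real (Suc n)) ^ k" by (intro power_mono) auto
    have e3: "real (n + 2) ^ Suc d \<le> (2 * real (Suc n)) ^ Suc d" by (intro power_mono) auto
    show ?thesis
      by (rule mult_mono[OF e2 mult_left_mono[OF mult_mono[OF e3 e1]]]) (use y in auto)
  qed
  also have "\<dots> = 2 ^ k * 3 * 2 ^ Suc d * fact m * 4 ^ m * real (Suc n) ^ (k + Suc d + m)"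
    unfolding power_mult_distrib power_add by (simp only: ac_simps)
  finally show ?thesis .
qed

lemma has_vector_derivative_series_M:
  fixes f :: "nat \<Rightarrow> real \<Rightarrow> complex"
  assumes S: "convex S" and D: "\<And>n y. y \<in> S \<Longrightarrow> (f n has_vector_derivative f' n y) (at y within S)"
    and M: "\<And>n y. y \<in> S \<Longrightarrow> norm (f' n y) \<le> M n" "summable M"
    and s: "\<And>y. y \<in> S \<Longrightarrow> summable (\<lambda>n. f n y)" and x: "x \<in> S"
  shows "((\<lambda>y. \<Sum>n. f n y) has_vector_derivative (\<Sum>n. f' n x)) (at x within S)"
proof -
  have ul: "uniform_limit S (\<lambda>n y. \<Sum>i<n. f' i y) (\<lambda>y. \<Sum>i. f' i y) sequentially"
    by (rule Weierstrass_m_test[OF M])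
  have "\<exists>g. \<forall>y\<in>S. (\<lambda>n. f n y) sums g y \<and> (g has_derivative (\<lambda>h. h *\<^sub>R (\<Sum>i. f' i y))) (at y within S)"
  proof (rule has_derivative_series[where f=f and f'="\<lambda>n y h. h *\<^sub>R f' n y" and
        g'="\<lambda>y h. h *\<^sub>R (\<Sum>i. f' i y)", OF S _ _ x summable_sums[OF s[OF x]]])
    show "(f n has_derivative (\<lambda>h. h *\<^sub>R f' n y)) (at y within S)" if "y \<in> S" for n y
      using D[OF that] by (simp add: has_vector_derivative_def)
    fix e :: real assume "e > 0"
    from uniform_limitD[OF ul this]
    show "\<forall>\<^sub>F n in sequentially. \<forall>y\<in>S. \<forall>h. norm ((\<Sum>i<n. h *\<^sub>R f' i y) - h *\<^sub>R (\<Sum>i. f' i y)) \<le> e * norm h"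
    proof eventually_elim
      case (elim n)
      show ?case
      proof (intro ballI allI)
        fix y h assume "y \<in> S"
        have "(\<Sum>i<n. h *\<^sub>R f' i y) - h *\<^sub>R (\<Sum>i. f' i y) = h *\<^sub>R ((\<Sum>i<n. f' i y) - (\<Sum>i. f' i y))"
          by (simp add: scaleR_right_diff_distrib scaleR_sum_right)
        then show "norm ((\<Sum>i<n. h *\<^sub>R f' i y) - h *\<^sub>R (\<Sum>i. f' i y)) \<le> e * norm h"
          using elim \<open>y \<in> S\<close> by (simp add: dist_norm mult.commute[of e] mult_left_mono less_imp_le)
      qed
    qed
  qed
  then obtain g where g: "\<And>y. y \<in> S \<Longrightarrow> (\<lambda>n. f n y) sums g y"
    "\<And>y. y \<in> S \<Longrightarrow> (g has_derivative (\<lambda>h. h *\<^sub>R (\<Sum>i. f' i y))) (at y within S)" by blast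
  have "(g has_vector_derivative (\<Sum>i. f' i x)) (at x within S)"
    using g(2)[OF x] by (simp add: has_vector_derivative_def)
  then show ?thesis
    by (rule has_vector_derivative_transform[OF x, rotated]) (use g(1) in \<open>simp add: sums_iff\<close>)
qed

text \<open>The rapid decrease of \<open>b\<close> absorbs the polynomial bounds on weighted
  derivatives of Laguerre functions. All differentiated series converge uniformly, and the
  \<open>g k\<close> form the tower of derivatives.\<close>

lemma laguerre_series:
  fixes d :: nat and b :: "nat \<Rightarrow> complex"
  assumes b: "rapid b"
  defines "g \<equiv> \<lambda>k y. \<Sum>n. b n * of_real (lagd d k n y)"
  shows "schwartz (g 0)"
    and "(\<lambda>n. b n * hInt (\<lambda>y. of_real y ^ d * of_real (lag d n y) * exp (\<i> * of_real y * of_real z)))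
      sums hInt (\<lambda>y. of_real y ^ d * g 0 y * exp (\<i> * of_real y * of_real z))"
proof -
  define K where "K k m = 2 ^ k * 3 * 2 ^ Suc d * fact m * (4::real) ^ m" for k m :: nat
  define M where "M k m n = K k m * (real (Suc n) ^ (k + Suc d + m) * norm (b n))" for k m n
  have M: "summable (M k m)" for k m
    unfolding M_def by (intro summable_mult rapid_summable b)
  have le: "norm (of_real y ^ m * (b n * of_real (lagd d k n y))) \<le> M k m n" if "0 \<le> y" for k m n y
    using mult_right_mono[OF lagd_weighted_bound[OF that, of m d k n], of "norm (b n)"] that
    by (simp only: M_def K_def norm_mult norm_power norm_of_real abs_of_nonneg power_abs ac_simps norm_ge_zero)
  have s: "summable (\<lambda>n. of_real y ^ m * (b n * of_real (lagd d k n y)))" if "0 \<le> y" for k m y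
    by (rule summable_comparison_test'[OF M[of k m], of 0]) (rule le[OF that])
  have s0: "summable (\<lambda>n. b n * of_real (lagd d k n y))" if "0 \<le> y" for k y
    using s[OF that, of 0 k] by simp
  show "schwartz (g 0)"
  proof (rule schwartz_family)
    fix k and y :: real assume y: "0 \<le> y"
    show "(g k has_vector_derivative g (Suc k) y) (at y within {0..})"
      unfolding g_def
    proof (rule has_vector_derivative_series_M[where M="M (Suc k) 0"])
      show "((\<lambda>y. b n * of_real (lagd d k n y)) has_vector_derivative b n * of_real (lagd d (Suc k) n y)) (at y within {0..})" for n y
        using DERIV_lagd[of d k n y] has_vector_derivative_at_within has_vector_derivative_of_real has_vector_derivative_mult_right
        unfolding has_real_derivative_iff_has_vector_derivative by blast
      show "norm (b n * of_real (lagd d (Suc k) n y)) \<le> M (Suc k) 0 n" if "y \<in> {0..}" for n y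
        using le[of y 0 n "Suc k"] that by simp
    qed (use y s0 M in auto)
  next
    fix m k
    have "norm (of_real y ^ m * g k y) \<le> (\<Sum>n. M k m n)" if "0 \<le> y" for y
    proof -
      have "of_real y ^ m * g k y = (\<Sum>n. of_real y ^ m * (b n * of_real (lagd d k n y)))"
        unfolding g_def by (rule suminf_mult[symmetric, OF s0[OF that]])
      then show ?thesis
        using norm_suminf_le[OF le[OF that] M] by simp
    qed
    then show "\<exists>C. \<forall>y\<ge>0. norm (of_real y ^ m * g k y) \<le> C" by blast
  qed
  let ?e = "\<lambda>y. exp (\<i> * of_real y * of_real z)"
  let ?f = "\<lambda>n y. b n * (of_real y ^ d * of_real (lag d n y) * ?e y)"
  have "(\<lambda>n. hInt (?f n)) sums hInt (\<lambda>y. \<Sum>n. ?f n y)"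
  proof (rule sums_hInt)
    show "continuous_on {0..} (?f n)" for n
      by (intro continuous_intros continuous_on_lag)
    show "summable (\<lambda>n. M 0 d n + M 0 (d + 2) n)" by (intro summable_add M)
    fix n and y :: real assume y: "0 \<le> y"
    have "(1 + y\<^sup>2) * norm (?f n y) = norm (of_real y ^ d * (b n * of_real (lagd d 0 n y))) + norm (of_real y ^ (d + 2) * (b n * of_real (lagd d 0 n y)))"
      using y by (simp add: norm_mult norm_power norm_exp_eq_Re power_add power2_eq_square algebra_simps)
    also have "\<dots> \<le> M 0 d n + M 0 (d + 2) n" by (intro add_mono le y)
    finally show "(1 + y\<^sup>2) * norm (?f n y) \<le> M 0 d n + M 0 (d + 2) n" .
  qed
  moreover have "hInt (\<lambda>y. \<Sum>n. ?f n y) = hInt (\<lambda>y. of_real y ^ d * g 0 y * ?e y)"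
  proof (rule hInt_cong)
    fix y :: real assume y: "0 \<le> y"
    have "(\<lambda>n. of_real y ^ d * ?e y * (b n * of_real (lagd d 0 n y))) sums (of_real y ^ d * ?e y * g 0 y)"
      unfolding g_def by (intro sums_mult summable_sums s0 y)
    then show "(\<Sum>n. ?f n y) = of_real y ^ d * g 0 y * ?e y"
      by (simp add: sums_iff ac_simps)
  qed
  ultimately show "(\<lambda>n. b n * hInt (\<lambda>y. of_real y ^ d * of_real (lag d n y) * ?e y)) sums hInt (\<lambda>y. of_real y ^ d * g 0 y * ?e y)"
    by (simp only: hInt_cmul)
qed

lemma Hf_imp_schwartz:
  assumes a: "rapid a"
  shows "\<exists>f. schwartz f \<and> (\<forall>z. hInt (\<lambda>y. of_real y ^ d * f y * exp (\<i> * of_real y * of_real z)) = Hf d a z)"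
proof -
  \<comment> \<open>Cancels the factor i^(d+1) (n+d)!/n! of \<open>laplace_lag\<close>. The
    multiplier has modulus at most 1, so \<open>b\<close> is again rapidly decreasing.\<close>
  define b where "b n = (- \<i>) ^ Suc d * (fact n / fact (n + d)) * a n" for n
  have b: "rapid b"
  proof (rule rapid_comparison(1)[OF a, of _ 1 0])
    fix n
    have "fact n / fact (n + d) \<le> (1::real)" by (simp add: fact_mono)
    then have "norm ((- \<i>) ^ Suc d * (fact n / fact (n + d) :: complex)) \<le> 1"
      by (simp add: norm_mult norm_power norm_divide)
    then show "norm (b n) \<le> 1 * real (Suc n) ^ 0 * norm (a n)"
      unfolding b_def norm_mult[of "_ * _" "a n"] by (simp add: mult_left_le_one_le)
  qed
  define f where "f y = (\<Sum>n. b n * of_real (lagd d 0 n y))" for y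
  have f: "schwartz f" unfolding f_def[abs_def] by (rule laguerre_series(1)[OF b])
  have "hInt (\<lambda>y. of_real y ^ d * f y * exp (\<i> * of_real y * of_real z)) = Hf d a z" for z
  proof -
    have "b n * (fact (n + d) / fact n * \<i> ^ Suc d * cay z ^ n / (of_real z + \<i>) ^ Suc d) = a n * cay z ^ n / (of_real z + \<i>) ^ Suc d" for n
    proof -
      have "(- \<i>) ^ Suc d * \<i> ^ Suc d = 1" by (simp only: power_mult_distrib[symmetric]) simp
      moreover have "fact n / fact (n + d) * (fact (n + d) / fact n) = (1::complex)" by simp
      moreover have "p * q1 * an * (q2 * j * c / Z) = (p * j) * (q1 * q2) * (an * c / Z)" for p q1 an q2 j c Z :: complex
        by (simp add: divide_inverse ac_simps)
      then have "b n * (fact (n + d) / fact n * \<i> ^ Suc d * cay z ^ n / (of_real z + \<i>) ^ Suc d)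
         = ((- \<i>) ^ Suc d * \<i> ^ Suc d) * (fact n / fact (n + d) * (fact (n + d) / fact n)) * (a n * cay z ^ n / (of_real z + \<i>) ^ Suc d)"
        unfolding b_def .
      ultimately show ?thesis by (simp only: mult_1)
    qed
    then have "(\<lambda>n. a n * cay z ^ n / (of_real z + \<i>) ^ Suc d) sums hInt (\<lambda>y. of_real y ^ d * f y * exp (\<i> * of_real y * of_real z))"
      using laguerre_series(2)[OF b, of d z] unfolding laplace_lag f_def by simp
    moreover have "(\<lambda>n. a n * cay z ^ n / (of_real z + \<i>) ^ Suc d) sums Hf d a z"
      unfolding Hf_def by (intro sums_divide psum_sums a) simp
    ultimately show ?thesis by (rule sums_unique2)
  qed
  with f show ?thesis by blast
qed

section \<open>Identification with the definition of I_d^+\<close>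

lemma T_op_plus:
  assumes "d > 0"
  shows "T_op d (\<lambda>x. if x \<in> {0..} then (\<bar>x\<bar> powr ((real d + 1) / 2)) *\<^sub>R f x else 0) z
    = of_real ((2 * pi) powr (- 1 / 2)) * hInt (\<lambda>y. of_real y ^ d * f y * exp (\<i> * of_real y * of_real z))"
proof -
  have "(\<bar>y\<bar> powr ((real d - 1) / 2)) *\<^sub>R (if y \<in> {0..} then (\<bar>y\<bar> powr ((real d + 1) / 2)) *\<^sub>R f y else 0) * exp (\<i> * y * z)
     = indicator {0..} y *\<^sub>R (of_real y ^ d * f y * exp (\<i> * of_real y * of_real z))" for y
  proof (cases "y > 0")
    case True
    \<comment> \<open>The exponents (d-1)/2 of the operator and (d+1)/2 of the space add up to
      d.\<close>
    have "y powr ((real d - 1) / 2) * y powr ((real d + 1) / 2) = y ^ d"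
      using True by (simp add: powr_add[symmetric] powr_realpow[symmetric] field_simps)
    then have "y powr ((real d - 1) / 2) *\<^sub>R (y powr ((real d + 1) / 2) *\<^sub>R f y) = of_real y ^ d * f y"
      by (simp only: scaleR_scaleR) (simp add: scaleR_conv_of_real)
    then show ?thesis using True by simp
  next
    case False
    \<comment> \<open>At y = 0 the left side vanishes because \<open>0 powr a\<close> is 0, the
      right side because d > 0.\<close>
    then show ?thesis using assms by (cases "y = 0") auto
  qed
  then show ?thesis
    unfolding T_op_def hInt_def by (simp only: scaleR_conv_of_real)
qed

text \<open>Combines \<open>schwartz_imp_Hf\<close> and \<open>Hf_imp_schwartz\<close>; the
  normalising constant of the transform is absorbed into the coefficients.\<close>

theorem I_plus_eq_Hardy:
  assumes "d > 0" shows "I_plus d = Hardy d"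
proof -
  define c where "c = complex_of_real ((2 * pi) powr (- 1 / 2))"
  have c: "c \<noteq> 0" by (simp add: c_def)
  show ?thesis
  proof (intro equalityI subsetI)
    fix \<phi> assume "\<phi> \<in> I_plus d"
    then obtain f where f: "schwartz f"
      "\<phi> = T_op d (\<lambda>x. if x \<in> {0..} then (\<bar>x\<bar> powr ((real d + 1) / 2)) *\<^sub>R f x else 0)"
      unfolding I_plus_def S_space_def schwartz_def by blast
    have "\<phi> z = Hf d (\<lambda>n. c * ((2 * \<i>) ^ Suc d * la d f n)) z" for z
      unfolding f(2) T_op_plus[OF assms] schwartz_imp_Hf[OF f(1)] c_def[symmetric] Hf_def
      by (subst psum_cmul[of _ _ c]) (auto intro!: rapid_cmul rapid_la f simp del: power_Suc)
    then show "\<phi> \<in> Hardy d"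
      unfolding Hardy_def by (intro image_eqI[of _ _ "\<lambda>n. c * ((2 * \<i>) ^ Suc d * la d f n)"])
        (auto intro!: rapid_cmul rapid_la f)
  next
    fix \<phi> assume "\<phi> \<in> Hardy d"
    then obtain a where a: "rapid a" "\<phi> = Hf d a" by (auto simp: Hardy_def)
    obtain f where f: "schwartz f" "\<And>z. hInt (\<lambda>y. of_real y ^ d * f y * exp (\<i> * of_real y * of_real z)) = Hf d (\<lambda>n. inverse c * a n) z"
      using Hf_imp_schwartz[OF rapid_cmul[OF a(1), of "inverse c"], of d] by blast
    have "\<phi> z = T_op d (\<lambda>x. if x \<in> {0..} then (\<bar>x\<bar> powr ((real d + 1) / 2)) *\<^sub>R f x else 0) z" for z
      unfolding T_op_plus[OF assms] f(2) a(2) c_def[symmetric] Hf_def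
      by (subst psum_cmul[OF a(1)]) (use c in auto)
    then have "\<phi> = T_op d (\<lambda>x. if x \<in> {0..} then (\<bar>x\<bar> powr ((real d + 1) / 2)) *\<^sub>R f x else 0)" by blast
    moreover have "(\<lambda>x. if x \<in> {0..} then (\<bar>x\<bar> powr ((real d + 1) / 2)) *\<^sub>R f x else 0) \<in> S_space d {0..}"
      unfolding S_space_def using f(1)[unfolded schwartz_def] by blast
    ultimately show "\<phi> \<in> I_plus d" unfolding I_plus_def by blast
  qed
qed

section \<open>The group action on the disc\<close>

lemma powser_coeff_bound_disc:
  fixes c :: "nat \<Rightarrow> complex"
  assumes f: "\<And>w. norm w < 1 \<Longrightarrow> (\<lambda>n. c n * w ^ n) sums f w"
    and B: "\<And>w. norm w < 1 \<Longrightarrow> norm (f w) \<le> B"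
  shows "norm (c n) \<le> B"
proof (cases "n = 0")
  case True
  have "f 0 = c 0" using sums_unique2[OF f[of 0] powser_sums_zero] by simp
  then show ?thesis using B[of 0] True by simp
next
  case False
  show ?thesis
  proof (rule field_le_mult_one_interval)
    fix z :: real assume z: "0 < z" "z < 1"
    \<comment> \<open>With r^n = z Cauchy's estimate on the circle of radius r reads z |c n| <= B,
      for every z < 1. This needs n > 0, so n = 0 is a separate case.\<close>
    define r where "r = root n z"
    have r: "0 < r" "r < 1" "r ^ n = z" using z False by (auto simp: r_def)
    have "norm (c n) \<le> B / r ^ n"
      by (rule powser_coeff_bound[OF f r(1,2)]) (use r B in auto)
    then show "z * norm (c n) \<le> B" using z by (simp add: r(3) field_simps)
  qed
qed

text \<open>Up to normalisation \<open>mobA g\<close> and \<open>mobB g\<close> are the entries of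
  the SU(1,1) matrix conjugate to g. In this scaling |A|^2 - |B|^2 is 4 instead of 1, which accounts
  for the factors 4 and 2 i below.\<close>

definition mobA :: "real^2^2 \<Rightarrow> complex" where
  "mobA g = Complex (g $ 1 $ 2 - g $ 2 $ 1) (g $ 2 $ 2 + g $ 1 $ 1)"

definition mobB :: "real^2^2 \<Rightarrow> complex" where
  "mobB g = Complex (- (g $ 1 $ 2 + g $ 2 $ 1)) (g $ 2 $ 2 - g $ 1 $ 1)"

text \<open>The Cayley transform turns the Moebius action of \<open>g\<close> on the line into the automorphism \<open>mob g\<close> of the unit disc.\<close>

definition mobd :: "real^2^2 \<Rightarrow> complex \<Rightarrow> complex" where
  "mobd g w = mobA g + mobB g * w"

definition mob :: "real^2^2 \<Rightarrow> complex \<Rightarrow> complex" where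
  "mob g w = - (cnj (mobB g) + cnj (mobA g) * w) / mobd g w"

lemma SL2_det: "g \<in> SL2 \<Longrightarrow> g $ 1 $ 1 * g $ 2 $ 2 - g $ 1 $ 2 * g $ 2 $ 1 = 1"
  by (simp add: SL2_def det_2)

lemma mobA_mobB: "g \<in> SL2 \<Longrightarrow> (norm (mobA g))\<^sup>2 - (norm (mobB g))\<^sup>2 = 4"
  unfolding mobA_def mobB_def cmod_power2 complex.sel
  using SL2_det[of g] by (simp add: power2_eq_square algebra_simps)

lemma norm_mobB_less: "g \<in> SL2 \<Longrightarrow> norm (mobB g) < norm (mobA g)"
  using mobA_mobB[of g] power_less_imp_less_base[of "norm (mobB g)" 2 "norm (mobA g)"] by simp

lemma norm_mobd_ge:
  assumes "norm w \<le> 1"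
  shows "norm (mobA g) - norm (mobB g) \<le> norm (mobd g w)"
proof -
  have "norm (mobA g) - norm (mobB g * w) \<le> norm (mobd g w)"
    unfolding mobd_def using norm_triangle_ineq2[of "mobA g" "- (mobB g * w)"] by simp
  moreover have "norm (mobB g * w) \<le> norm (mobB g)"
    using assms by (simp add: norm_mult mult_left_le)
  ultimately show ?thesis by linarith
qed

lemma mobd_nonzero: "g \<in> SL2 \<Longrightarrow> norm w \<le> 1 \<Longrightarrow> mobd g w \<noteq> 0"
  using norm_mobd_ge[of w g] norm_mobB_less[of g] by auto

lemma norm_mob:
  assumes g: "g \<in> SL2" and w: "norm w \<le> 1"
  shows "norm (mob g w) \<le> 1" and "norm w < 1 \<Longrightarrow> norm (mob g w) < 1"
proof -
  let ?N = "cnj (mobB g) + cnj (mobA g) * w"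
  have d: "norm (mobd g w) > 0" using mobd_nonzero[OF assms] by simp
  \<comment> \<open>The sign of this difference is that of 1 - |w|, so the closed and the open disc
    are both preserved.\<close>
  have eq: "(norm (mobd g w))\<^sup>2 - (norm ?N)\<^sup>2 = 4 * (1 - (norm w)\<^sup>2)"
  proof -
    have "(norm (mobd g w))\<^sup>2 - (norm ?N)\<^sup>2 = ((norm (mobA g))\<^sup>2 - (norm (mobB g))\<^sup>2) * (1 - (norm w)\<^sup>2)"
      by (simp add: mobd_def cmod_power2) (simp add: power2_eq_square algebra_simps)
    then show ?thesis by (simp add: mobA_mobB[OF g])
  qed
  have "0 \<le> (norm (mobd g w))\<^sup>2 - (norm ?N)\<^sup>2"
    unfolding eq using power_le_one[OF norm_ge_zero w, of 2] by simp
  then have "(norm ?N)\<^sup>2 \<le> (norm (mobd g w))\<^sup>2" by (simp only: diff_ge_0_iff_ge)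
  then have "norm ?N \<le> norm (mobd g w)" by (rule power2_le_imp_le) simp
  then show "norm (mob g w) \<le> 1" using d by (simp add: mob_def norm_divide norm_minus_cancel[of ?N, simplified] divide_le_eq del: minus_add_distrib)
  assume "norm w < 1"
  then have "(norm w)\<^sup>2 < 1" by (simp add: power_less_one_iff abs_square_less_1)
  then have "0 < (norm (mobd g w))\<^sup>2 - (norm ?N)\<^sup>2" unfolding eq by simp
  then have "(norm ?N)\<^sup>2 < (norm (mobd g w))\<^sup>2" by (simp only: diff_gt_0_iff_gt)
  then have "norm ?N < norm (mobd g w)" by (rule power2_less_imp_less) simp
  then show "norm (mob g w) < 1" using d by (simp add: mob_def norm_divide norm_minus_cancel[of ?N, simplified] divide_less_eq del: minus_add_distrib)
qed

section \<open>Coefficients of a transformed power series\<close>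

text \<open>The exponent is a parameter because differentiation raises it; the representation uses
  \<open>Suc d\<close>.\<close>

definition mobF :: "real^2^2 \<Rightarrow> nat \<Rightarrow> (nat \<Rightarrow> complex) \<Rightarrow> complex \<Rightarrow> complex" where
  "mobF g m a w = psum a (mob g w) / mobd g w ^ m"

text \<open>The automorphism has derivative -4 over the square of the denominator, so the family of
  all \<open>mobF\<close> is closed under differentiation, with larger exponents.\<close>

lemma mobF_has_derivative:
  assumes g: "g \<in> SL2" and a: "rapid a" and w: "norm w < 1"
  shows "(mobF g m a has_field_derivative
    (- of_nat m * mobB g * mobF g (m + 1) a w + -4 * mobF g (m + 2) (dseq a) w)) (at w)"
proof -
  have d: "mobd g w \<noteq> 0" using mobd_nonzero[OF g] w by simp
  have m1: "norm (mob g w) < 1" using norm_mob(2)[OF g] w by simp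
  have "(psum a has_field_derivative psum (dseq a) (mob g w)) (at (mob g w))"
  proof -
    have "at (mob g w) within cball 0 1 = at (mob g w)"
      by (rule at_within_open_subset[of _ "ball 0 1"]) (use m1 in auto)
    then show ?thesis using psum_has_derivative[OF a, of "mob g w"] m1 by simp
  qed
  moreover have Dd: "(mobd g has_field_derivative mobB g) (at w)"
    unfolding mobd_def[abs_def] by (auto intro!: derivative_eq_intros)
  have "(mob g has_field_derivative -4 / (mobd g w)\<^sup>2) (at w)"
  proof -
    have "cnj (mobA g) * mobd g w - (cnj (mobB g) + cnj (mobA g) * w) * mobB g = 4"
    proof -
      have "cnj (mobA g) * mobd g w - (cnj (mobB g) + cnj (mobA g) * w) * mobB g
          = mobA g * cnj (mobA g) - mobB g * cnj (mobB g)"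
        by (simp add: mobd_def algebra_simps)
      also have "\<dots> = of_real ((norm (mobA g))\<^sup>2 - (norm (mobB g))\<^sup>2)"
        unfolding of_real_diff complex_norm_square ..
      finally show ?thesis by (simp add: mobA_mobB[OF g])
    qed
    then have e: "- cnj (mobA g) * mobd g w - - (cnj (mobB g) + cnj (mobA g) * w) * mobB g = -4"
      by (simp add: algebra_simps)
    have "((\<lambda>w. - (cnj (mobB g) + cnj (mobA g) * w)) has_field_derivative - cnj (mobA g)) (at w)"
      by (auto intro!: derivative_eq_intros)
    from DERIV_divide[OF this Dd d] show ?thesis
      unfolding mob_def[abs_def] power2_eq_square e .
  qed
  ultimately have Dp: "((\<lambda>w. psum a (mob g w)) has_field_derivative psum (dseq a) (mob g w) * (-4 / (mobd g w)\<^sup>2)) (at w)"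
    by (rule DERIV_chain2)
  have Dm: "((\<lambda>w. mobd g w ^ m) has_field_derivative of_nat m * (mobB g * mobd g w ^ (m - 1))) (at w)"
    using DERIV_power[OF Dd, of m] by simp
  have "mobd g w ^ m \<noteq> 0" using d by simp
  from DERIV_divide[OF Dp Dm this]
  show ?thesis
    unfolding mobF_def[abs_def]
  proof (rule DERIV_cong)
    have "(P' * (-4 / D\<^sup>2) * D ^ m - P * (of_nat m * (B * D ^ (m - 1)))) / (D ^ m * D ^ m)
       = - of_nat m * B * (P / D ^ (m + 1)) + -4 * (P' / D ^ (m + 2))" if "D \<noteq> 0" for P P' D B :: complex
    proof (cases m)
      case (Suc k)
      then show ?thesis using that by (simp add: field_simps power2_eq_square del: of_nat_Suc)
    qed (use that in \<open>simp add: field_simps power2_eq_square\<close>)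
    from this[OF d, of "psum (dseq a) (mob g w)" "psum a (mob g w)" "mobB g"]
    show "(psum (dseq a) (mob g w) * (-4 / (mobd g w)\<^sup>2) * mobd g w ^ m -
       psum a (mob g w) * (of_nat m * (mobB g * mobd g w ^ (m - 1)))) / (mobd g w ^ m * mobd g w ^ m)
       = - of_nat m * mobB g * (psum a (mob g w) / mobd g w ^ (m + 1)) + -4 * (psum (dseq a) (mob g w) / mobd g w ^ (m + 2))" .
  qed
qed

definition mobc :: "real^2^2 \<Rightarrow> nat \<Rightarrow> (nat \<Rightarrow> complex) \<Rightarrow> nat \<Rightarrow> complex" where
  "mobc g m a n = (deriv ^^ n) (mobF g m a) 0 / fact n"

lemma mobF_holomorphic: "g \<in> SL2 \<Longrightarrow> rapid a \<Longrightarrow> mobF g m a holomorphic_on ball 0 1"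
  unfolding holomorphic_on_open[OF open_ball] by (intro ballI exI, rule mobF_has_derivative) auto

lemma sums_mobc: "g \<in> SL2 \<Longrightarrow> rapid a \<Longrightarrow> norm w < 1 \<Longrightarrow> (\<lambda>n. mobc g m a n * w ^ n) sums mobF g m a w"
  using holomorphic_power_series[OF mobF_holomorphic, of g a w m] by (simp add: mobc_def)

lemma mobc_Suc:
  assumes g: "g \<in> SL2" and a: "rapid a"
  shows "of_nat (Suc n) * mobc g m a (Suc n) = - of_nat m * mobB g * mobc g (m + 1) a n + -4 * mobc g (m + 2) (dseq a) n"
proof -
  let ?F1 = "mobF g (m + 1) a" and ?F2 = "mobF g (m + 2) (dseq a)"
  have h: "?F1 holomorphic_on ball 0 1" "?F2 holomorphic_on ball 0 1"
    by (intro mobF_holomorphic g a rapid_dseq)+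
  have "(deriv ^^ n) (deriv (mobF g m a)) 0 = (deriv ^^ n) (\<lambda>w. - of_nat m * mobB g * ?F1 w + -4 * ?F2 w) 0"
  proof (rule higher_deriv_transform_within_open[where S="ball 0 1"])
    show "deriv (mobF g m a) holomorphic_on ball 0 1"
      by (intro holomorphic_deriv mobF_holomorphic g a) auto
    show "(\<lambda>w. - of_nat m * mobB g * ?F1 w + -4 * ?F2 w) holomorphic_on ball 0 1"
      by (intro holomorphic_intros h)
    show "deriv (mobF g m a) w = - of_nat m * mobB g * ?F1 w + -4 * ?F2 w" if "w \<in> ball 0 1" for w
      by (rule DERIV_imp_deriv[OF mobF_has_derivative[OF g a]]) (use that in simp)
  qed auto
  also have "\<dots> = (deriv ^^ n) (\<lambda>w. - of_nat m * mobB g * ?F1 w) 0 + (deriv ^^ n) (\<lambda>w. -4 * ?F2 w) 0"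
    by (rule higher_deriv_add[where S="ball 0 1"]) (auto intro!: holomorphic_intros h h[simplified])
  also have "\<dots> = - of_nat m * mobB g * (deriv ^^ n) ?F1 0 + -4 * (deriv ^^ n) ?F2 0"
    using higher_deriv_cmult[OF h(1), of 0 n "- of_nat m * mobB g"] higher_deriv_cmult[OF h(2), of 0 n "-4"] by simp
  finally have "(deriv ^^ Suc n) (mobF g m a) 0 = - of_nat m * mobB g * (deriv ^^ n) ?F1 0 + -4 * (deriv ^^ n) ?F2 0"
    by (simp only: funpow_Suc_right o_def)
  moreover have "of_nat (Suc n) * mobc g m a (Suc n) = (deriv ^^ Suc n) (mobF g m a) 0 / fact n"
    by (simp add: mobc_def del: of_nat_Suc funpow.simps)
  ultimately show ?thesis
    by (simp only: mobc_def add_divide_distrib times_divide_eq_right)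
qed

lemma mobF_bound:
  assumes g: "g \<in> SL2" and a: "rapid a" and w: "norm w \<le> 1"
  shows "norm (mobF g m a w) \<le> wnorm 0 a / (norm (mobA g) - norm (mobB g)) ^ m"
  unfolding mobF_def norm_divide norm_power
  using norm_psum_le[OF a norm_mob(1)[OF g w]] norm_mobd_ge[OF w, of g] norm_mobB_less[OF g] wnorm_nonneg[OF a]
  by (intro frac_le power_mono) auto

text \<open>Induction on the weight with \<open>m\<close> and \<open>a\<close> arbitrary:
  \<open>mobc_Suc\<close> trades one factor n for a larger exponent and for \<open>dseq a\<close>.
  The start is Cauchy's estimate for a function bounded on the disc.\<close>

lemma rapid_mobc:
  assumes g: "g \<in> SL2" and a: "rapid a" shows "rapid (mobc g m a)"
proof (rule rapidI_bounded)
  fix k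
  show "\<exists>C. \<forall>n. real (Suc n) ^ k * norm (mobc g m a n) \<le> C"
    using a
  proof (induction k arbitrary: m a)
    case 0
    have "norm (mobc g m a n) \<le> wnorm 0 a / (norm (mobA g) - norm (mobB g)) ^ m" for n
      by (rule powser_coeff_bound_disc[OF sums_mobc[OF g 0]]) (auto intro!: mobF_bound g 0)
    then show ?case by auto
  next
    case (Suc k)
    obtain C1 where C1: "\<And>n. real (Suc n) ^ k * norm (mobc g (m + 1) a n) \<le> C1" using Suc.IH[OF Suc.prems] by blast
    obtain C2 where C2: "\<And>n. real (Suc n) ^ k * norm (mobc g (m + 2) (dseq a) n) \<le> C2" using Suc.IH[OF rapid_dseq[OF Suc.prems]] by blast
    define C where "C = 2 ^ Suc k * (real m * norm (mobB g) * C1 + 4 * C2)"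
    have step: "real (Suc (Suc n)) ^ Suc k * norm (mobc g m a (Suc n)) \<le> C" for n
    proof -
      have "real (Suc n) * norm (mobc g m a (Suc n)) = norm (of_nat (Suc n) * mobc g m a (Suc n))"
        by (simp only: norm_mult norm_of_nat)
      also have "\<dots> \<le> norm (- of_nat m * mobB g * mobc g (m + 1) a n) + norm (-4 * mobc g (m + 2) (dseq a) n)"
        unfolding mobc_Suc[OF g Suc.prems] by (rule norm_triangle_ineq)
      finally have 1: "real (Suc n) * norm (mobc g m a (Suc n)) \<le> real m * norm (mobB g) * norm (mobc g (m + 1) a n) + 4 * norm (mobc g (m + 2) (dseq a) n)"
        by (simp add: norm_mult)
      have "real (Suc (Suc n)) ^ Suc k * norm (mobc g m a (Suc n)) \<le> (2 * real (Suc n)) ^ Suc k * norm (mobc g m a (Suc n))"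
        by (intro mult_right_mono power_mono) auto
      also have "\<dots> = 2 ^ Suc k * (real (Suc n) ^ k * (real (Suc n) * norm (mobc g m a (Suc n))))"
        unfolding power_mult_distrib power_Suc[of "real (Suc n)"] by (simp only: ac_simps)
      also have "\<dots> \<le> 2 ^ Suc k * (real (Suc n) ^ k * (real m * norm (mobB g) * norm (mobc g (m + 1) a n) + 4 * norm (mobc g (m + 2) (dseq a) n)))"
        by (intro mult_left_mono 1) auto
      also have "\<dots> = 2 ^ Suc k * (real m * norm (mobB g) * (real (Suc n) ^ k * norm (mobc g (m + 1) a n)) + 4 * (real (Suc n) ^ k * norm (mobc g (m + 2) (dseq a) n)))"
        by (simp only: distrib_left ac_simps)
      also have "\<dots> \<le> C" unfolding C_def
        by (intro mult_left_mono add_mono C1 C2) auto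
      finally show ?thesis .
    qed
    have "real (Suc n) ^ Suc k * norm (mobc g m a n) \<le> max C (norm (mobc g m a 0))" for n
      using step by (cases n) (auto simp: le_max_iff_disj)
    then show ?case by blast
  qed
qed

lemma continuous_on_mobF:
  assumes g: "g \<in> SL2" and a: "rapid a" shows "continuous_on (cball 0 1) (mobF g m a)"
proof -
  have cd: "continuous_on (cball 0 1) (mobd g)" unfolding mobd_def by (intro continuous_intros)
  have cm: "continuous_on (cball 0 1) (mob g)"
    unfolding mob_def using mobd_nonzero[OF g] by (intro continuous_intros cd) auto
  have "continuous_on (cball 0 1) (\<lambda>w. psum a (mob g w))"
    by (rule continuous_on_compose2[OF continuous_on_psum[OF a] cm]) (use norm_mob(1)[OF g] in auto)
  then show ?thesis
    unfolding mobF_def using mobd_nonzero[OF g] by (intro continuous_intros cd) auto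
qed

text \<open>Taylor expansion gives the equality inside the disc; both sides are continuous on the
  closed disc, so it extends to the circle, where it is applied.\<close>

lemma psum_mobc:
  assumes g: "g \<in> SL2" and a: "rapid a" and w: "norm w \<le> 1"
  shows "psum (mobc g m a) w = mobF g m a w"
proof -
  have "(\<lambda>k. psum (mobc g m a) (radial w k)) \<longlonglongrightarrow> psum (mobc g m a) w"
    by (rule continuous_radial[OF continuous_on_psum[OF rapid_mobc[OF g a]] w])
  moreover have "(\<lambda>k. mobF g m a (radial w k)) \<longlonglongrightarrow> mobF g m a w"
    by (rule continuous_radial[OF continuous_on_mobF[OF g a] w])
  moreover have "psum (mobc g m a) (radial w k) = mobF g m a (radial w k)" for k
    using sums_mobc[OF g a norm_radial[OF w], of m k] by (simp add: psum_def sums_iff)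
  ultimately show ?thesis by (simp add: LIMSEQ_unique)
qed

section \<open>The representation on Hardy functions\<close>

text \<open>The limit clause of \<open>pi_rep\<close> concerns at most one point, and there the
  limit is dictated by a continuous function that agrees with the formula elsewhere.\<close>

lemma pi_rep_eqI:
  assumes g: "g \<in> SL2" and c: "\<And>x. isCont f x"
    and eq: "\<And>x. g $ 2 $ 1 * x + g $ 1 $ 1 \<noteq> 0 \<Longrightarrow> pi_rep d g \<phi> x = f x"
  shows "pi_rep d g \<phi> = f"
proof
  fix x
  define p q r s where "p = g $ 1 $ 1" and "q = g $ 1 $ 2" and "r = g $ 2 $ 1" and "s = g $ 2 $ 2"
  show "pi_rep d g \<phi> x = f x"
  proof (cases "r * x + p = 0")
    case True
    have r0: "r \<noteq> 0" using True SL2_det[OF g] by (auto simp: p_def q_def r_def s_def)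
    define F where "F = (\<lambda>x. (r * x + p) powi (- int d - 1) *\<^sub>R \<phi> ((s * x + q) / (r * x + p)))"
    have "F x' = f x'" if "x' \<noteq> x" for x'
    proof -
      have "r * x' + p \<noteq> 0"
      proof
        assume "r * x' + p = 0"
        moreover have "r * (x' - x) = (r * x' + p) - (r * x + p)" by (simp add: algebra_simps)
        ultimately have "r * (x' - x) = 0" using True by (simp only: diff_self)
        then show False using r0 that by simp
      qed
      then show ?thesis
        using eq[of x'] unfolding pi_rep_def Let_def F_def by (simp add: p_def q_def r_def s_def)
    qed
    then have "\<forall>\<^sub>F x' in at x. f x' = F x'" by (auto simp: eventually_at_filter)
    with c[of x] have "(F \<longlongrightarrow> f x) (at x)" unfolding isCont_def by (rule Lim_transform_eventually)
    then have "Lim (at x) F = f x" by (intro tendsto_Lim) auto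
    then show ?thesis
      using True unfolding pi_rep_def Let_def F_def by (simp add: p_def q_def r_def s_def)
  qed (use eq in \<open>simp add: p_def r_def\<close>)
qed

theorem pi_rep_Hf:
  assumes g: "g \<in> SL2" and a: "rapid a"
  shows "pi_rep d g (Hf d a) = Hf d (\<lambda>n. (2 * \<i>) ^ Suc d * mobc g (Suc d) a n)"
proof (rule pi_rep_eqI[OF g])
  have "rapid (\<lambda>n. (2 * \<i>) ^ Suc d * mobc g (Suc d) a n)" by (intro rapid_cmul rapid_mobc g a)
  then show "isCont (Hf d (\<lambda>n. (2 * \<i>) ^ Suc d * mobc g (Suc d) a n)) x" for x
    using has_vector_derivative_continuous[OF Hf_has_vector_derivative] by blast
next
  fix x
  define p q r s where "p = g $ 1 $ 1" and "q = g $ 1 $ 2" and "r = g $ 2 $ 1" and "s = g $ 2 $ 2"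
  have det: "p * s - q * r = 1" using SL2_det[OF g] by (simp add: p_def q_def r_def s_def)
  let ?R = "Hf d (\<lambda>n. (2 * \<i>) ^ Suc d * mobc g (Suc d) a n)"
  have R: "?R x = (2 * \<i>) ^ Suc d * (psum a (mob g (cay x)) / mobd g (cay x) ^ Suc d) / (of_real x + \<i>) ^ Suc d" for x
    unfolding Hf_def by (subst psum_cmul[OF rapid_mobc[OF g a]]) (simp_all only: norm_cay order_refl psum_mobc[OF g a] mobF_def)
  have gen: "pi_rep d g (Hf d a) x = ?R x" if nz: "r * x + p \<noteq> 0" for x
  proof -
    define y where "y = (s * x + q) / (r * x + p)"
    define u v where "u = complex_of_real (s * x + q)" and "v = complex_of_real (r * x + p)"
    have v: "v \<noteq> 0" using nz unfolding v_def by (simp only: of_real_eq_0_iff) simp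
    have uv: "u + \<i> * v \<noteq> 0" using nz by (auto simp: u_def v_def complex_eq_iff)
    have yi: "of_real y + \<i> = (u + \<i> * v) / v" "of_real y - \<i> = (u - \<i> * v) / v"
      using v by (simp_all only: y_def of_real_divide u_def[symmetric] v_def[symmetric]) (simp_all add: field_simps)
    have cy: "cay y = (u - \<i> * v) / (u + \<i> * v)" unfolding cay_def yi using v by simp
    define z where "z = of_real x + \<i>"
    have z: "z \<noteq> 0" by (simp add: z_def)
    have x: "complex_of_real x = z - \<i>" by (simp add: z_def)
    have wz: "cay x * z = z - 2 * \<i>" using z by (simp add: cay_def x)
    have AB: "mobA g = of_real (q - r) + \<i> * of_real (s + p)" "mobB g = - of_real (q + r) + \<i> * of_real (s - p)"
      by (simp_all add: mobA_def mobB_def p_def q_def r_def s_def complex_eq_iff)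
    \<comment> \<open>With u / v the image of x, multiplication by z = x + i turns denominator and
      numerator of \<open>mob g (cay x)\<close> into 2 i (u + i v) and 2 i (u - i v); their quotient
      is the Cayley coordinate of u / v.\<close>
    have 1: "mobd g (cay x) * z = 2 * \<i> * (u + \<i> * v)"
    proof -
      have "mobd g (cay x) * z = mobA g * z + mobB g * (cay x * z)" by (simp add: mobd_def algebra_simps)
      also have "\<dots> = 2 * \<i> * (u + \<i> * v)"
        unfolding wz AB u_def v_def of_real_add of_real_mult x by (simp add: algebra_simps)
      finally show ?thesis .
    qed
    have 2: "- (cnj (mobB g) + cnj (mobA g) * cay x) * z = 2 * \<i> * (u - \<i> * v)"
    proof -
      have "- (cnj (mobB g) + cnj (mobA g) * cay x) * z = - (cnj (mobB g) * z + cnj (mobA g) * (cay x * z))"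
        by (simp add: algebra_simps)
      also have "\<dots> = 2 * \<i> * (u - \<i> * v)"
        unfolding wz AB u_def v_def of_real_add of_real_mult x by (simp add: algebra_simps)
      finally show ?thesis .
    qed
    have "mob g (cay x) = (- (cnj (mobB g) + cnj (mobA g) * cay x) * z) / (mobd g (cay x) * z)"
      using z by (simp add: mob_def)
    then have mob: "mob g (cay x) = cay y" unfolding 1 2 cy by simp
    have "pi_rep d g (Hf d a) x = inverse v ^ Suc d * Hf d a y"
      using pi_rep_apply[of g x d "Hf d a"] nz by (simp add: p_def q_def r_def s_def v_def y_def)
    also have "\<dots> = psum a (cay y) / (u + \<i> * v) ^ Suc d"
      unfolding Hf_def yi power_divide power_inverse using v by (simp add: field_simps del: power_Suc)
    also have "(u + \<i> * v) = mobd g (cay x) * z / (2 * \<i>)" unfolding 1 by simp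
    also have "psum a (cay y) / (mobd g (cay x) * z / (2 * \<i>)) ^ Suc d = ?R x"
    proof -
      have "X / (M * z / J) ^ n = J ^ n * (X / M ^ n) / z ^ n" for X M J :: complex and n
        by (simp add: power_divide power_mult_distrib divide_inverse power_inverse ac_simps)
      then show ?thesis unfolding R mob z_def[symmetric] .
    qed
    finally show ?thesis .
  qed
  assume "g $ 2 $ 1 * x + g $ 1 $ 1 \<noteq> 0"
  then show "pi_rep d g (Hf d a) x = ?R x" by (intro gen) (simp add: p_def r_def)
qed

lemma SL2_invariant_Hardy: "SL2_invariant d (Hardy d)"
  unfolding SL2_invariant_def Hardy_def
  by (auto simp: pi_rep_Hf intro!: image_eqI[OF refl] rapid_cmul rapid_mobc)

section \<open>Irreducibility\<close>

lemma Hf_diff: "rapid a \<Longrightarrow> rapid b \<Longrightarrow> Hf d (\<lambda>n. a n - b n) = (\<lambda>x. Hf d a x - Hf d b x)"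
  using Hf_add[of a "\<lambda>n. -1 * b n"] Hf_cmul[of b d "-1"] rapid_cmul[of b "-1"] by simp

lemma complex_subspace_Hardy: "complex_subspace (Hardy d)"
proof -
  have "rapid (\<lambda>n. 0)" by (simp add: rapid_def)
  moreover have "Hf d (\<lambda>n. 0) = (\<lambda>x. 0)" by (simp add: Hf_def psum_def fun_eq_iff)
  ultimately have "(\<lambda>x. 0) \<in> Hardy d" unfolding Hardy_def by (metis image_eqI mem_Collect_eq)
  then show ?thesis
    unfolding complex_subspace_def Hardy_def
    by (auto simp: Hf_add[symmetric] Hf_cmul[symmetric] intro!: rapid_add rapid_cmul image_eqI[OF refl])
qed

lemma complex_subspace_add: "complex_subspace W \<Longrightarrow> \<phi> \<in> W \<Longrightarrow> \<psi> \<in> W \<Longrightarrow> (\<lambda>x. \<phi> x + \<psi> x) \<in> W"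
  by (simp add: complex_subspace_def)

lemma complex_subspace_sum:
  assumes "complex_subspace W" "finite A" "\<And>i. i \<in> A \<Longrightarrow> f i \<in> W"
  shows "(\<lambda>x. \<Sum>i\<in>A. f i x) \<in> W"
  using assms(2,3)
proof (induction A rule: finite_induct)
  case empty
  then show ?case using assms(1) by (simp add: complex_subspace_def)
next
  case (insert i A)
  then have "(\<lambda>x. f i x + (\<Sum>i\<in>A. f i x)) \<in> W"
    by (intro complex_subspace_add[OF assms(1)]) simp_all
  then show ?case using insert by simp
qed

lemma complex_subspace_cmul: "complex_subspace W \<Longrightarrow> \<phi> \<in> W \<Longrightarrow> (\<lambda>x. c * \<phi> x) \<in> W"
  unfolding complex_subspace_def by blast

text \<open>The error vanishes below N and is dominated by \<open>c\<close>, so its seminorms are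
  bounded by tails of \<open>wnorm K c\<close>. The averages over rotations and the truncated series
  are both limits of this kind.\<close>

lemma Hf_limit:
  assumes C: "closedin (I_topology d) C" and a: "rapid a" and c: "rapid c"
    and mem: "\<And>N. Hf d (b N) \<in> C"
    and eq: "\<And>N m. m < N \<Longrightarrow> b N m = a m" and le: "\<And>N m. norm (b N m - a m) \<le> norm (c m)"
  shows "Hf d a \<in> C"
proof (rule closedin_I_sequentially[OF C mem Hf_I_space[OF a]])
  fix D assume D: "D \<in> U_ops d"
  define e where "e N m = b N m - a m" for N m
  have e: "rapid (e N)" for N
    by (rule rapid_comparison(1)[OF c, of _ 1 0]) (simp add: e_def le)
  have b: "rapid (b N)" for N
    using rapid_add[OF e[of N] a] by (simp add: e_def)
  obtain K M where M: "0 \<le> M" "\<And>a. rapid a \<Longrightarrow> I_seminorm d D (Hf d a) \<le> M * wnorm K a"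
    using I_seminorm_Hf[OF D] by blast
  let ?s = "\<lambda>m. real (Suc m) ^ K * norm (c m)"
  have w: "wnorm K (e N) \<le> wnorm K c - (\<Sum>m<N. ?s m)" for N
  proof -
    have "wnorm K (e N) = (\<Sum>m. real (Suc (m + N)) ^ K * norm (e N (m + N))) + (\<Sum>m<N. real (Suc m) ^ K * norm (e N m))"
      unfolding wnorm_def by (rule suminf_split_initial_segment[OF rapid_summable[OF e]])
    also have "(\<Sum>m<N. real (Suc m) ^ K * norm (e N m)) = 0"
      by (intro sum.neutral) (auto simp: e_def eq)
    also have "(\<Sum>m. real (Suc (m + N)) ^ K * norm (e N (m + N))) \<le> (\<Sum>m. ?s (m + N))"
      using summable_ignore_initial_segment[OF rapid_summable[OF e[of N], of K], of N]
        summable_ignore_initial_segment[OF rapid_summable[OF c, of K], of N]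
      by (intro suminf_le mult_left_mono) (auto simp: e_def le)
    also have "(\<Sum>m. ?s (m + N)) = wnorm K c - (\<Sum>m<N. ?s m)"
      unfolding wnorm_def using suminf_split_initial_segment[OF rapid_summable[OF c, of K], of N] by simp
    finally show ?thesis by simp
  qed
  have "(\<lambda>N. M * (wnorm K c - (\<Sum>m<N. ?s m))) \<longlonglongrightarrow> M * (wnorm K c - wnorm K c)"
    unfolding wnorm_def by (intro tendsto_intros summable_LIMSEQ rapid_summable c)
  then have lim: "(\<lambda>N. M * (wnorm K c - (\<Sum>m<N. ?s m))) \<longlonglongrightarrow> 0" by simp
  have up: "I_seminorm d D (\<lambda>x. Hf d (b N) x - Hf d a x) \<le> M * (wnorm K c - (\<Sum>m<N. ?s m))" for N
  proof -
    have "(\<lambda>x. Hf d (b N) x - Hf d a x) = Hf d (e N)" unfolding e_def by (rule Hf_diff[symmetric, OF b a])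
    then have "I_seminorm d D (\<lambda>x. Hf d (b N) x - Hf d a x) \<le> M * wnorm K (e N)" using M(2)[OF e] by simp
    also have "\<dots> \<le> M * (wnorm K c - (\<Sum>m<N. ?s m))" by (intro mult_left_mono w M)
    finally show ?thesis .
  qed
  have low: "0 \<le> I_seminorm d D (\<lambda>x. Hf d (b N) x - Hf d a x)" for N
    by (simp add: I_seminorm_def integral_nonneg_AE zero_le_power add_nonneg_nonneg)
  show "(\<lambda>N. I_seminorm d D (\<lambda>x. Hf d (b N) x - Hf d a x)) \<longlonglongrightarrow> 0"
    by (rule tendsto_sandwich[OF _ _ tendsto_const lim]) (intro always_eventually allI up low)+
qed

section \<open>Isolating single monomials\<close>

lemma rotation_mem:
  assumes W: "complex_subspace W" "SL2_invariant d W" and a: "rapid a" "Hf d a \<in> W" and \<omega>: "norm \<omega> = 1"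
  shows "Hf d (\<lambda>m. \<omega> ^ m * a m) \<in> W"
proof -
  \<comment> \<open>The rotation matrix of angle t turns the disc by -2 t, hence the half and the
    sign.\<close>
  define t where "t = - Arg \<omega> / 2"
  have \<omega>t: "\<omega> = cis (- 2 * t)"
  proof -
    have "\<omega> \<noteq> 0" using \<omega> by auto
    from cis_Arg[OF this] show ?thesis using \<omega> by (simp add: t_def sgn_eq)
  qed
  define g :: "real^2^2" where "g = vector [vector [cos t, - sin t], vector [sin t, cos t]]"
  have ge: "g $ 1 $ 1 = cos t" "g $ 1 $ 2 = - sin t" "g $ 2 $ 1 = sin t" "g $ 2 $ 2 = cos t"
    by (simp_all add: g_def)
  have g: "g \<in> SL2" by (simp add: SL2_def det_2 ge flip: power2_eq_square)
  have A: "mobA g = 2 * \<i> * cis t" by (simp add: mobA_def ge complex_eq_iff)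
  have B: "mobB g = 0" by (simp add: mobB_def ge complex_eq_iff)
  have md: "mobd g w = 2 * \<i> * cis t" for w by (simp add: mobd_def A B)
  have m: "mob g w = \<omega> * w" for w
  proof -
    have "mob g w = (2 * \<i> * cis (- t) * w) / (2 * \<i> * cis t)"
      unfolding mob_def md by (simp add: A B cis_cnj)
    also have "\<dots> = cis (- t) / cis t * w" by simp
    also have "cis (- t) / cis t = \<omega>" unfolding \<omega>t cis_divide by simp
    finally show ?thesis .
  qed
  have ps: "psum a (\<omega> * w) = psum (\<lambda>m. \<omega> ^ m * a m) w" for w
    unfolding psum_def by (rule arg_cong[of _ _ suminf]) (auto simp: fun_eq_iff power_mult_distrib)
  have "pi_rep d g (Hf d a) \<in> W" using W(2) g a(2) by (auto simp: SL2_invariant_def)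
  \<comment> \<open>A rotation has a constant automorphy factor, which is scaled away.\<close>
  then have "(\<lambda>x. cis t ^ Suc d * pi_rep d g (Hf d a) x) \<in> W" by (rule complex_subspace_cmul[OF W(1)])
  moreover have "cis t ^ Suc d * pi_rep d g (Hf d a) x = Hf d (\<lambda>m. \<omega> ^ m * a m) x" for x
  proof -
    have "pi_rep d g (Hf d a) x = (2 * \<i>) ^ Suc d * mobF g (Suc d) a (cay x) / (of_real x + \<i>) ^ Suc d"
      unfolding pi_rep_Hf[OF g a(1)] Hf_def
      by (subst psum_cmul[OF rapid_mobc[OF g a(1)]]) (simp_all only: norm_cay order_refl psum_mobc[OF g a(1)])
    also have "\<dots> = Hf d (\<lambda>m. \<omega> ^ m * a m) x / cis t ^ Suc d"
      unfolding mobF_def m md ps Hf_def power_mult_distrib by (simp del: power_Suc)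
    finally show ?thesis by (simp del: power_Suc)
  qed
  ultimately show ?thesis by simp
qed

text \<open>Modulo N the number N - 1 is -1, so m + n (N - 1) stands for m - n without subtraction
  of naturals.\<close>

lemma dvd_shift_iff:
  fixes m n N :: nat
  assumes "m < N" "n < N"
  shows "N dvd m + n * (N - 1) \<longleftrightarrow> m = n"
proof
  assume "N dvd m + n * (N - 1)"
  then have "int N dvd int (m + n * (N - 1))" by (simp only: int_dvd_int_iff)
  moreover have "int (m + n * (N - 1)) = (int m - int n) + int n * int N"
    using assms by (cases N) (auto simp: algebra_simps)
  ultimately have "int N dvd (int m - int n) + int n * int N" by (simp only:)
  then have "int N dvd int m - int n" by (metis dvd_add_left_iff dvd_triv_right)
  then have "int m - int n \<noteq> 0 \<Longrightarrow> \<bar>int N\<bar> \<le> \<bar>int m - int n\<bar>" by (intro dvd_imp_le_int)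
  then show "m = n" using assms by linarith
next
  assume "m = n"
  then have "m + n * (N - 1) = N * n" using assms by (cases N) auto
  then show "N dvd m + n * (N - 1)" by simp
qed

text \<open>Averaging over the rotations by \<open>N\<close>-th roots of unity keeps only the coefficients with index
  congruent to \<open>n\<close> modulo \<open>N\<close>; the weight \<open>\<eta>\<^sup>-\<^sup>n\<close> appears as \<open>\<eta>\<^sup>n\<^sup>(\<^sup>N\<^sup>-\<^sup>1\<^sup>)\<close>.\<close>

lemma coefficient_mem:
  assumes W: "complex_subspace W" "SL2_invariant d W" and C: "closedin (I_topology d) W"
    and a: "rapid a" "Hf d a \<in> W"
  shows "Hf d (\<lambda>m. if m = n then a m else 0) \<in> W"
proof (rule Hf_limit[OF C _ a(1)])
  \<comment> \<open>Larger than N and than n: below N the only index congruent to n is n itself, so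
    there the average agrees with the limit.\<close>
  define M where "M N = N + n + 1" for N
  define \<eta> where "\<eta> N = exp (2 * of_real pi * \<i> * of_nat 1 / of_nat (M N))" for N
  have \<eta>: "\<eta> N ^ k = 1 \<longleftrightarrow> M N dvd k" for N k
  proof -
    have "\<eta> N ^ k = exp (2 * of_real pi * \<i> * of_nat k / of_nat (M N))"
      by (simp add: \<eta>_def flip: exp_of_nat_mult) (simp add: algebra_simps)
    then show ?thesis using complex_root_unity_eq_1[of "M N" k] by (simp add: M_def)
  qed
  have n\<eta>: "norm (\<eta> N) = 1" for N by (simp add: \<eta>_def norm_exp_eq_Re)
  define b where "b N m = (\<Sum>j<M N. (1 / of_nat (M N) * \<eta> N ^ (j * (n * (M N - 1)))) * ((\<eta> N ^ j) ^ m * a m))" for N m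
  have b: "b N m = (if M N dvd m + n * (M N - 1) then a m else 0)" for N m
  proof -
    let ?z = "\<eta> N ^ (m + n * (M N - 1))"
    have "b N m = a m / of_nat (M N) * (\<Sum>j<M N. ?z ^ j)"
      unfolding b_def sum_distrib_left
    proof (intro sum.cong refl)
      fix j
      have "\<eta> N ^ (j * K) * (\<eta> N ^ j) ^ m = (\<eta> N ^ (m + K)) ^ j" for K
        unfolding power_mult[symmetric] power_add[symmetric] by (simp add: algebra_simps)
      from this[of "n * (M N - 1)", symmetric]
      show "1 / of_nat (M N) * \<eta> N ^ (j * (n * (M N - 1))) * ((\<eta> N ^ j) ^ m * a m) = a m / of_nat (M N) * ?z ^ j"
        by (simp only:) (simp add: ac_simps)
    qed
    also have "(\<Sum>j<M N. ?z ^ j) = (if ?z = 1 then of_nat (M N) else 0)"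
    proof (cases "?z = 1")
      case False
      have "?z ^ M N = 1" unfolding power_mult[symmetric] \<eta> by simp
      then show ?thesis using geometric_sum[OF False, of "M N"] False by simp
    qed simp
    finally have "b N m = a m / of_nat (M N) * (if ?z = 1 then of_nat (M N) else 0)" .
    moreover have "complex_of_nat (M N) \<noteq> 0" by (simp only: of_nat_eq_0_iff M_def)
    ultimately show ?thesis unfolding \<eta> by simp
  qed
  show "rapid (\<lambda>m. if m = n then a m else 0)"
    by (rule rapid_comparison(1)[OF a(1), of _ 1 0]) simp
  show "b N m = (if m = n then a m else 0)" if "m < N" for N m
    unfolding b using dvd_shift_iff[of m "M N" n] that by (simp add: M_def)
  show "norm (b N m - (if m = n then a m else 0)) \<le> norm (a m)" for N m
    using dvd_shift_iff[of n "M N" n] by (auto simp: b M_def)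
  show "Hf d (b N) \<in> W" for N
  proof -
    have r: "rapid (\<lambda>m. (\<eta> N ^ j) ^ m * a m)" for j
      by (rule rapid_norm_eq[OF a(1)]) (simp add: norm_mult norm_power n\<eta>)
    let ?f = "\<lambda>j x. (1 / of_nat (M N) * \<eta> N ^ (j * (n * (M N - 1)))) * Hf d (\<lambda>m. (\<eta> N ^ j) ^ m * a m) x"
    have mem: "(\<lambda>x. \<Sum>j<M N. ?f j x) \<in> W"
      by (intro complex_subspace_sum[OF W(1)] complex_subspace_cmul[OF W(1)] rotation_mem[OF W a])
         (auto simp: norm_power n\<eta>)
    have "Hf d (b N) x = (\<Sum>j<M N. ?f j x)" for x
    proof -
      have "(\<lambda>m. b N m * cay x ^ m) sums (\<Sum>j<M N. (1 / of_nat (M N) * \<eta> N ^ (j * (n * (M N - 1)))) * psum (\<lambda>m. (\<eta> N ^ j) ^ m * a m) (cay x))"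
        unfolding b_def sum_distrib_right mult.assoc
        by (intro sums_sum sums_mult) (use psum_sums[OF r, of "cay x"] in \<open>simp add: mult.assoc\<close>)
      then show ?thesis
        by (simp add: Hf_def psum_def sums_iff sum_divide_distrib del: power_Suc)
    qed
    then have "Hf d (b N) = (\<lambda>x. \<Sum>j<M N. ?f j x)" by (rule ext)
    then show ?thesis using mem by (simp only:)
  qed
qed

abbreviation delta :: "nat \<Rightarrow> nat \<Rightarrow> complex" where
  "delta n \<equiv> (\<lambda>m. if m = n then 1 else 0)"

lemma rapid_delta: "rapid (delta n)"
  unfolding rapid_def by (intro allI summable_finite[of "{n}"]) auto

lemma psum_delta: "psum (delta n) w = w ^ n"
  using sums_unique[OF sums_single[of n "\<lambda>m. w ^ m"]] by (simp add: psum_def if_distrib if_distribR cong: if_cong)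

lemma delta_mem:
  assumes W: "complex_subspace W" "SL2_invariant d W" and C: "closedin (I_topology d) W"
    and a: "rapid a" "Hf d a \<in> W" "a n \<noteq> 0"
  shows "Hf d (delta n) \<in> W"
proof -
  let ?b = "\<lambda>m. if m = n then a m else 0"
  have "rapid ?b" by (rule rapid_comparison(1)[OF a(1), of _ 1 0]) simp
  moreover have "delta n = (\<lambda>m. inverse (a n) * ?b m)" using a(3) by (auto simp: fun_eq_iff)
  ultimately have "Hf d (delta n) = (\<lambda>x. inverse (a n) * Hf d ?b x)" using Hf_cmul[of ?b d "inverse (a n)"] by simp
  then show ?thesis
    using complex_subspace_cmul[OF W(1) coefficient_mem[OF W C a(1,2), of n], of "inverse (a n)"] by simp
qed

theorem irreducible_Hardy: "irreducible_rep d (Hardy d)"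
  unfolding irreducible_rep_def
proof (intro allI impI)
  fix W assume "complex_subspace W \<and> closedin (subtopology (I_topology d) (Hardy d)) W \<and> SL2_invariant d W"
  then have W: "complex_subspace W" "SL2_invariant d W" and cW: "closedin (subtopology (I_topology d) (Hardy d)) W"
    by auto
  have C: "closedin (I_topology d) W" by (rule closedin_trans_full[OF cW closedin_Hardy])
  have sub: "W \<subseteq> Hardy d" using closedin_subset[OF cW] by auto
  show "W = {\<lambda>x. 0} \<or> W = Hardy d"
  proof (cases "W = {\<lambda>x. 0}")
    case False
    moreover have "(\<lambda>x. 0) \<in> W" using W(1) by (simp add: complex_subspace_def)
    ultimately obtain \<phi> where \<phi>: "\<phi> \<in> W" "\<phi> \<noteq> (\<lambda>x. 0)" by blast
    then obtain a where a: "rapid a" "\<phi> = Hf d a" using sub by (auto simp: Hardy_def)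
    have "\<exists>n. a n \<noteq> 0"
    proof (rule ccontr)
      assume "\<nexists>n. a n \<noteq> 0"
      then have "\<phi> = (\<lambda>x. 0)" by (simp add: a Hf_def psum_def fun_eq_iff)
      then show False using \<phi> by simp
    qed
    then obtain n where n: "a n \<noteq> 0" by blast
    have en: "Hf d (delta n) \<in> W" using delta_mem[OF W C a(1) _ n] \<phi>(1) a(2) by simp
    \<comment> \<open>Its automorphism has |B/A| = 3/5 and therefore does not fix the centre of the
      disc.\<close>
    define g :: "real^2^2" where "g = vector [vector [2, 0], vector [0, 1/2]]"
    have ge: "g $ 1 $ 1 = 2" "g $ 1 $ 2 = 0" "g $ 2 $ 1 = 0" "g $ 2 $ 2 = 1/2" by (simp_all add: g_def)
    have g: "g \<in> SL2" by (simp add: SL2_def det_2 ge)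
    have A: "mobA g = 5 / 2 * \<i>" and B: "mobB g = - 3 / 2 * \<i>"
      by (simp_all add: mobA_def mobB_def ge complex_eq_iff)
    have mem: "Hf d (\<lambda>k. (2 * \<i>) ^ Suc d * mobc g (Suc d) (delta m) k) \<in> W" if "Hf d (delta m) \<in> W" for m
      using W(2) g that unfolding SL2_invariant_def pi_rep_Hf[OF g rapid_delta, symmetric] by blast
    have r: "rapid (\<lambda>k. (2 * \<i>) ^ Suc d * mobc g (Suc d) (delta m) k)" for m
      by (intro rapid_cmul rapid_mobc g rapid_delta)
    \<comment> \<open>The constant coefficient is the value at 0: the n-th power of the nonzero
      number \<open>mob g 0\<close> over a power of \<open>mobA g\<close>.\<close>
    have "mobc g (Suc d) (delta n) 0 = mobF g (Suc d) (delta n) 0" by (simp add: mobc_def)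
    also have "\<dots> \<noteq> 0" by (simp add: mobF_def psum_delta mob_def mobd_def A B)
    finally have e0: "Hf d (delta 0) \<in> W"
      by (intro delta_mem[OF W C r mem[OF en]]) simp
    \<comment> \<open>The constant series is mapped to 1 / (A (1 - 3/5 w))^(d+1), whose binomial
      expansion has no zero coefficient; every monomial is thus reached from the constant.\<close>
    have c0: "mobc g (Suc d) (delta 0) = (\<lambda>m. of_nat ((m + d) choose d) * (3 / 5) ^ m / mobA g ^ Suc d)"
    proof (rule powser_unique)
      show "(\<lambda>m. mobc g (Suc d) (delta 0) m * w ^ m) sums mobF g (Suc d) (delta 0) w" if "norm w < 1" for w
        by (rule sums_mobc[OF g rapid_delta that])
      fix w :: complex assume w: "norm w < 1"
      have "norm (3 / 5 * w) < 1" using w by (simp add: norm_mult)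
      from sums_divide[OF negative_binomial_series[OF this, of d], of "mobA g ^ Suc d"]
      have "(\<lambda>m. of_nat ((m + d) choose d) * (3 / 5 * w) ^ m / mobA g ^ Suc d) sums
          (1 / (1 - 3 / 5 * w) ^ Suc d / mobA g ^ Suc d)" .
      moreover have "1 / (1 - 3 / 5 * w) ^ Suc d / mobA g ^ Suc d = mobF g (Suc d) (delta 0) w"
      proof -
        have "mobd g w = (1 - 3 / 5 * w) * mobA g" by (simp add: mobd_def A B algebra_simps)
        then show ?thesis by (simp only: mobF_def psum_delta power_0 power_mult_distrib divide_divide_eq_left)
      qed
      ultimately have "(\<lambda>m. of_nat ((m + d) choose d) * (3 / 5 * w) ^ m / mobA g ^ Suc d) sums mobF g (Suc d) (delta 0) w"
        by (simp only:)
      then show "(\<lambda>m. of_nat ((m + d) choose d) * (3 / 5) ^ m / mobA g ^ Suc d * w ^ m) sums mobF g (Suc d) (delta 0) w"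
      proof -
        assume S: "(\<lambda>m. of_nat ((m + d) choose d) * (3 / 5 * w) ^ m / mobA g ^ Suc d) sums mobF g (Suc d) (delta 0) w"
        have "C * (3 / 5 * w) ^ m / D = C * (3 / 5) ^ m / D * w ^ m" for C D :: complex and m
          by (simp only: power_mult_distrib divide_inverse ac_simps)
        with S show ?thesis by (simp only:)
      qed
    qed
    have em: "Hf d (delta m) \<in> W" for m
      by (rule delta_mem[OF W C r mem[OF e0]]) (simp add: c0 A)
    \<comment> \<open>The monomials span a dense subspace, as the truncations of a rapidly
      decreasing sequence converge.\<close>
    have "Hf d c \<in> W" if c: "rapid c" for c
    proof (rule Hf_limit[OF C c c])
      fix N
      have "(\<lambda>x. \<Sum>m<N. c m * Hf d (delta m) x) \<in> W"
        by (intro complex_subspace_sum[OF W(1)] complex_subspace_cmul[OF W(1)] em) auto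
      moreover have "(\<Sum>m<N. c m * Hf d (delta m) x) = Hf d (\<lambda>m. if m < N then c m else 0) x" for x
      proof -
        have "psum (\<lambda>m. if m < N then c m else 0) (cay x) = (\<Sum>m<N. (if m < N then c m else 0) * cay x ^ m)"
          unfolding psum_def by (rule suminf_finite) auto
        also have "\<dots> = (\<Sum>m<N. c m * cay x ^ m)" by (rule sum.cong) auto
        finally show ?thesis by (simp add: Hf_def psum_delta sum_divide_distrib del: power_Suc)
      qed
      ultimately show "Hf d (\<lambda>m. if m < N then c m else 0) \<in> W" by simp
    qed auto
    then have "Hardy d \<subseteq> W" by (auto simp: Hardy_def)
    then show ?thesis using sub by blast
  qed simp
qed

section \<open>Complex conjugation and \<open>I\<^sub>d\<^sup>-\<close>\<close>

abbreviation Cnj :: "(real \<Rightarrow> complex) \<Rightarrow> real \<Rightarrow> complex" where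
  "Cnj \<phi> \<equiv> (\<lambda>x. cnj (\<phi> x))"

section \<open>Conjugation, the topology and the group action\<close>

lemma I_seminorm_cnj:
  assumes "D \<in> U_ops d" "\<phi> \<in> I_space d"
  shows "I_seminorm d D (Cnj \<phi>) = I_seminorm d D \<phi>"
  by (simp add: I_seminorm_def U_ops_cnj[OF assms])

lemma I_space_cnj_iff: "Cnj \<phi> \<in> I_space d \<longleftrightarrow> \<phi> \<in> I_space d"
  using I_space_cnj[of \<phi> d] I_space_cnj[of "Cnj \<phi>" d] by auto

text \<open>As the operators are real, conjugation maps a subbasic ball to the ball of the same
  operator and radius around the conjugate centre.\<close>

lemma openin_I_cnj:
  assumes "openin (I_topology d) U" shows "openin (I_topology d) {\<phi>. Cnj \<phi> \<in> U}"
proof -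
  let ?B = "{{\<psi> \<in> I_space d. I_seminorm d D (\<lambda>x. \<psi> x - \<phi> x) < \<epsilon>} | \<phi> D \<epsilon>.
        \<phi> \<in> I_space d \<and> D \<in> U_ops d \<and> \<epsilon> > 0}"
  have "generate_topology_on ?B U"
    using assms by (simp add: I_topology_def openin_topology_generated_by_iff)
  then have "generate_topology_on ?B {\<phi>. Cnj \<phi> \<in> U}"
  proof induction
    case Empty
    then show ?case by (simp add: generate_topology_on.Empty)
  next
    case (Int a b)
    then show ?case using generate_topology_on.Int[OF Int.IH] by (simp add: Collect_conj_eq)
  next
    case (UN K)
    have "generate_topology_on ?B (\<Union>((\<lambda>k. {\<phi>. Cnj \<phi> \<in> k}) ` K))"
      by (rule generate_topology_on.UN) (use UN.IH in blast)
    moreover have "\<Union>((\<lambda>k. {\<phi>. Cnj \<phi> \<in> k}) ` K) = {\<phi>. Cnj \<phi> \<in> \<Union>K}" by auto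
    ultimately show ?case by simp
  next
    case (Basis s)
    then obtain \<phi>0 D \<epsilon> where s: "s = {\<psi> \<in> I_space d. I_seminorm d D (\<lambda>x. \<psi> x - \<phi>0 x) < \<epsilon>}"
      and *: "\<phi>0 \<in> I_space d" "D \<in> U_ops d" "\<epsilon> > 0" by blast
    have "I_seminorm d D (\<lambda>x. cnj (\<phi> x) - \<phi>0 x) = I_seminorm d D (\<lambda>x. \<phi> x - cnj (\<phi>0 x))" if "\<phi> \<in> I_space d" for \<phi>
      using I_seminorm_cnj[OF *(2) I_space_diff[OF that I_space_cnj[OF *(1)]]] by simp
    then have "{\<phi>. Cnj \<phi> \<in> s} = {\<psi> \<in> I_space d. I_seminorm d D (\<lambda>x. \<psi> x - Cnj \<phi>0 x) < \<epsilon>}"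
      unfolding s by (auto simp: I_space_cnj_iff)
    moreover have "\<dots> \<in> ?B"
      by (intro CollectI exI[of _ "Cnj \<phi>0"] exI[of _ D] exI[of _ \<epsilon>] conjI refl) (use * I_space_cnj[OF *(1)] in auto)
    ultimately show ?case by (simp add: generate_topology_on.Basis)
  qed
  then show ?thesis by (simp add: I_topology_def openin_topology_generated_by_iff)
qed

lemma Cnj_image_eq: "Cnj ` V = {\<phi>. Cnj \<phi> \<in> V}"
proof (intro equalityI subsetI)
  fix \<phi> assume "\<phi> \<in> {\<phi>. Cnj \<phi> \<in> V}"
  then show "\<phi> \<in> Cnj ` V" by (intro image_eqI[of _ _ "Cnj \<phi>"]) auto
qed auto

lemma closedin_I_cnj:
  assumes "closedin (I_topology d) V" shows "closedin (I_topology d) (Cnj ` V)"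
proof -
  have V: "V \<subseteq> I_space d" "openin (I_topology d) (I_space d - V)"
    using assms by (auto simp: closedin_def topspace_I_topology)
  have "I_space d - Cnj ` V = {\<phi>. Cnj \<phi> \<in> I_space d - V}"
    by (auto simp: Cnj_image_eq I_space_cnj_iff)
  moreover have "Cnj ` V \<subseteq> I_space d" using V(1) I_space_cnj by blast
  ultimately show ?thesis
    using openin_I_cnj[OF V(2)] by (simp add: closedin_def topspace_I_topology)
qed

lemma complex_subspace_cnj:
  assumes "complex_subspace V" shows "complex_subspace (Cnj ` V)"
  unfolding Cnj_image_eq complex_subspace_def
  using assms complex_subspace_add[OF assms] complex_subspace_cmul[OF assms]
  by (auto simp: complex_subspace_def)

text \<open>The automorphy factor is real, so only the limit at the pole needs care; continuity of
  the image settles it through \<open>pi_rep_eqI\<close>.\<close>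

lemma pi_rep_cnj:
  assumes "g \<in> SL2" and c: "\<And>x. isCont (pi_rep d g \<phi>) x"
  shows "pi_rep d g (Cnj \<phi>) = Cnj (pi_rep d g \<phi>)"
  by (rule pi_rep_eqI[OF assms(1)]) (use c in \<open>simp_all add: pi_rep_apply isCont_def tendsto_cnj\<close>)

lemma pi_rep_cnj_Hardy:
  assumes "g \<in> SL2" "\<phi> \<in> Hardy d"
  shows "pi_rep d g (Cnj \<phi>) = Cnj (pi_rep d g \<phi>)"
proof (rule pi_rep_cnj[OF assms(1)])
  have "pi_rep d g \<phi> \<in> Hardy d" using SL2_invariant_Hardy assms by (auto simp: SL2_invariant_def)
  then obtain b where b: "rapid b" "pi_rep d g \<phi> = Hf d b" by (auto simp: Hardy_def)
  show "isCont (pi_rep d g \<phi>) x" for x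
    unfolding b(2) by (rule has_vector_derivative_continuous[OF Hf_has_vector_derivative[OF b(1)]])
qed

lemma SL2_invariant_cnj_Hardy: "SL2_invariant d (Cnj ` Hardy d)"
  unfolding SL2_invariant_def
proof (intro ballI)
  fix g \<phi> assume g: "g \<in> SL2" and "\<phi> \<in> Cnj ` Hardy d"
  then obtain \<psi> where \<psi>: "\<psi> \<in> Hardy d" "\<phi> = Cnj \<psi>" by blast
  have "pi_rep d g \<psi> \<in> Hardy d" using SL2_invariant_Hardy g \<psi>(1) by (auto simp: SL2_invariant_def)
  then show "pi_rep d g \<phi> \<in> Cnj ` Hardy d" unfolding \<psi>(2) pi_rep_cnj_Hardy[OF g \<psi>(1)] by (rule imageI)
qed

text \<open>Conjugation is an involution compatible with topology and action, so a closed invariant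
  subspace is carried to the Hardy space and back.\<close>

lemma irreducible_cnj_Hardy: "irreducible_rep d (Cnj ` Hardy d)"
  unfolding irreducible_rep_def
proof (intro allI impI)
  fix W assume "complex_subspace W \<and> closedin (subtopology (I_topology d) (Cnj ` Hardy d)) W \<and> SL2_invariant d W"
  then have W: "complex_subspace W" "closedin (subtopology (I_topology d) (Cnj ` Hardy d)) W" "SL2_invariant d W"
    by auto
  have sub: "W \<subseteq> Cnj ` Hardy d" using closedin_subset[OF W(2)] by auto
  then have sub': "Cnj ` W \<subseteq> Hardy d" by auto
  have "closedin (I_topology d) W"
    by (rule closedin_trans_full[OF W(2) closedin_I_cnj[OF closedin_Hardy]])
  then have "closedin (I_topology d) (Cnj ` W)" by (rule closedin_I_cnj)
  then have "closedin (subtopology (I_topology d) (Hardy d)) (Cnj ` W)"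
    using sub' by (intro closedin_subset_topspace)
  moreover have "SL2_invariant d (Cnj ` W)"
    unfolding SL2_invariant_def
  proof (intro ballI)
    fix g \<phi> assume g: "g \<in> SL2" and "\<phi> \<in> Cnj ` W"
    then have \<phi>: "\<phi> \<in> Hardy d" "Cnj \<phi> \<in> W" using sub' by auto
    have "pi_rep d g (Cnj \<phi>) \<in> W" using W(3) g \<phi>(2) by (auto simp: SL2_invariant_def)
    then show "pi_rep d g \<phi> \<in> Cnj ` W" by (simp add: Cnj_image_eq pi_rep_cnj_Hardy[OF g \<phi>(1)])
  qed
  ultimately have "Cnj ` W = {\<lambda>x. 0} \<or> Cnj ` W = Hardy d"
    using irreducible_Hardy complex_subspace_cnj[OF W(1)] unfolding irreducible_rep_def by blast
  moreover have "Cnj ` (Cnj ` W) = W" by (auto simp: image_image)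
  ultimately show "W = {\<lambda>x. 0} \<or> W = Cnj ` Hardy d" by auto
qed

section \<open>Reflection exchanging the two half-lines\<close>

lemma smooth_on_reflect:
  assumes T: "perfect_set T" and ST: "\<And>y. y \<in> T \<Longrightarrow> - y \<in> S" and f: "smooth_on S f"
  shows "smooth_on T (\<lambda>y. cnj (f (- y)))"
    and "y \<in> T \<Longrightarrow> nth_deriv_on T n (\<lambda>y. cnj (f (- y))) y = (-1) ^ n * cnj (nth_deriv_on S n f (- y))"
proof -
  let ?g = "\<lambda>n y. (-1) ^ n * cnj (nth_deriv_on S n f (- y))"
  have D: "(?g n has_vector_derivative ?g (Suc n) y) (at y within T)" if y: "y \<in> T" for n y
  proof -
    have u: "(uminus has_vector_derivative - 1) (at y within T)"
      by (auto intro!: derivative_eq_intros)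
    have "(nth_deriv_on S n f has_vector_derivative nth_deriv_on S (Suc n) f (- y)) (at (- y) within uminus ` T)"
      by (rule has_vector_derivative_within_subset[OF smooth_onD[OF f ST[OF y]]]) (use ST in auto)
    from vector_diff_chain_within[OF u this]
    have "((\<lambda>y. nth_deriv_on S n f (- y)) has_vector_derivative - nth_deriv_on S (Suc n) f (- y)) (at y within T)"
      by (simp add: o_def)
    from has_vector_derivative_mult_right[OF has_vector_derivative_cnj[OF this], of "(-1) ^ n"]
    show ?thesis by simp
  qed
  show "smooth_on T (\<lambda>y. cnj (f (- y)))"
    using smooth_on_family[of T ?g, OF T D] by simp
  show "nth_deriv_on T n (\<lambda>y. cnj (f (- y))) y = (-1) ^ n * cnj (nth_deriv_on S n f (- y))" if "y \<in> T"
    using nth_deriv_on_family[of T ?g, OF T D that, of n] by simp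
qed

lemma rapidly_decreasing_on_reflect:
  assumes T: "perfect_set T" and ST: "\<And>y. y \<in> T \<Longrightarrow> - y \<in> S" and f: "smooth_on S f" "rapidly_decreasing_on S f"
  shows "rapidly_decreasing_on T (\<lambda>y. cnj (f (- y)))"
  unfolding rapidly_decreasing_on_iff
proof (intro allI)
  fix m n
  obtain C where C: "\<And>x. x \<in> S \<Longrightarrow> norm (of_real x ^ m * nth_deriv_on S n f x) \<le> C"
    using f(2) unfolding rapidly_decreasing_on_iff by blast
  have "norm (of_real y ^ m * nth_deriv_on T n (\<lambda>y. cnj (f (- y))) y) \<le> C" if "y \<in> T" for y
    using C[OF ST[OF that]] by (simp add: smooth_on_reflect(2)[OF T ST f(1) that] norm_mult norm_power)
  then show "\<exists>C. \<forall>y\<in>T. norm (of_real y ^ m * nth_deriv_on T n (\<lambda>y. cnj (f (- y))) y) \<le> C" by blast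
qed

lemma S_space_reflect:
  assumes T: "perfect_set T" and ST: "\<And>y. y \<in> T \<longleftrightarrow> - y \<in> S" and "f \<in> S_space d S"
  shows "(\<lambda>y. cnj (f (- y))) \<in> S_space d T"
proof -
  obtain f1 where f1: "smooth_on S f1" "rapidly_decreasing_on S f1"
    "f = (\<lambda>x. if x \<in> S then (\<bar>x\<bar> powr ((real d + 1) / 2)) *\<^sub>R f1 x else 0)"
    using assms(3) by (auto simp: S_space_def)
  have "(\<lambda>y. cnj (f (- y))) = (\<lambda>y. if y \<in> T then (\<bar>y\<bar> powr ((real d + 1) / 2)) *\<^sub>R cnj (f1 (- y)) else 0)"
    by (auto simp: f1(3) ST fun_eq_iff)
  moreover have "smooth_on T (\<lambda>y. cnj (f1 (- y)))" "rapidly_decreasing_on T (\<lambda>y. cnj (f1 (- y)))"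
    using smooth_on_reflect(1)[OF T _ f1(1)] rapidly_decreasing_on_reflect[OF T _ f1(1,2)] ST by blast+
  ultimately show ?thesis unfolding S_space_def by blast
qed

text \<open>Conjugating the kernel gives e^(-iyz), and the substitution y -> -y restores e^(iyz);
  this is why reflection is combined with conjugation.\<close>

lemma T_op_reflect: "T_op d (\<lambda>y. cnj (f (- y))) z = cnj (T_op d f z)"
proof -
  let ?h = "\<lambda>y. (\<bar>y\<bar> powr ((real d - 1) / 2)) *\<^sub>R f y * exp (\<i> * y * z)"
  have "(LINT y|lborel. (\<bar>y\<bar> powr ((real d - 1) / 2)) *\<^sub>R cnj (f (- y)) * exp (\<i> * y * z)) = (LINT y|lborel. cnj (?h (- y)))"
    by (simp add: exp_cnj)
  also have "\<dots> = (LINT y|lborel. cnj (?h y))"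
    using lborel_integral_real_affine[of "-1" "\<lambda>y. cnj (?h y)" 0] by simp
  also have "\<dots> = cnj (LINT y|lborel. ?h y)" by (rule integral_bounded_linear'[OF bounded_linear_cnj bounded_linear_cnj]) simp
  finally show ?thesis by (simp add: T_op_def)
qed

lemma I_minus_eq: "I_minus d = Cnj ` I_plus d"
proof (intro equalityI subsetI)
  fix \<phi> assume "\<phi> \<in> I_minus d"
  then obtain f where f: "f \<in> S_space d {..0}" "\<phi> = T_op d f" by (auto simp: I_minus_def)
  have "(\<lambda>y. cnj (f (- y))) \<in> S_space d {0..}" by (rule S_space_reflect[OF _ _ f(1)]) auto
  then have "T_op d (\<lambda>y. cnj (f (- y))) \<in> I_plus d" unfolding I_plus_def by (rule imageI)
  moreover have "T_op d (\<lambda>y. cnj (f (- y))) = Cnj \<phi>" by (simp add: T_op_reflect f(2) fun_eq_iff)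
  ultimately show "\<phi> \<in> Cnj ` I_plus d" by (simp add: Cnj_image_eq)
next
  fix \<phi> assume "\<phi> \<in> Cnj ` I_plus d"
  then obtain f where f: "f \<in> S_space d {0..}" "\<phi> = Cnj (T_op d f)" by (auto simp: I_plus_def)
  have "(\<lambda>y. cnj (f (- y))) \<in> S_space d {..0}" by (rule S_space_reflect[OF _ _ f(1)]) auto
  then have "T_op d (\<lambda>y. cnj (f (- y))) \<in> I_minus d" unfolding I_minus_def by (rule imageI)
  moreover have "T_op d (\<lambda>y. cnj (f (- y))) = \<phi>" by (simp add: T_op_reflect f(2) fun_eq_iff)
  ultimately show "\<phi> \<in> I_minus d" by simp
qed

theorem corollary6p5:
  fixes d :: nat
  assumes "d > 0"
  shows "complex_subspace (I_plus d) \<and> closedin (I_topology d) (I_plus d)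
           \<and> SL2_invariant d (I_plus d) \<and> irreducible_rep d (I_plus d)
       \<and> complex_subspace (I_minus d) \<and> closedin (I_topology d) (I_minus d)
           \<and> SL2_invariant d (I_minus d) \<and> irreducible_rep d (I_minus d)"
  unfolding I_minus_eq I_plus_eq_Hardy[OF assms]
  by (intro conjI complex_subspace_Hardy closedin_Hardy SL2_invariant_Hardy irreducible_Hardy
      complex_subspace_cnj closedin_I_cnj SL2_invariant_cnj_Hardy irreducible_cnj_Hardy)

end
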